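(* Let $p$ be a prime and let $W$ be a DVR with quotient field $\mathbb{Q}(X)$ such that $W\cap\mathbb{Q}=\mathbb{Z}_{(p)}$ and $X\in W$. Then $W$ is unramified over $\mathbb{Z}_{(p)}$ (i.e. $e(W\mid\mathbb{Z}_{(p)})=1$) if and only if there exists an admissible pair $(\alpha,\delta)\in\mathbb{O}_p^{\mathrm{br}}\times(\mathbb{Z}_{\ge0}\cup\{\infty\})$, which is a minimal pair when $\delta<\infty$, such that $W=\mathbb{Z}_{(p),\alpha,\delta}$ and $\mathbb{Q}_p(\alpha)/\mathbb{Q}_p$ is unramified.
   Context: Fix a prime $p$. $\overline{\mathbb{Q}_p}$ is an algebraic closure of $\mathbb{Q}_p$, $v_p$ the unique extension of the $p$-adic valuation, $\mathbb{C}_p$ the completion of $\overline{\mathbb{Q}_p}$, $\mathbb{O}_p=\{x\in\mathbb{C}_p:v_p(x)\ge0\}$. $\mathbb{C}_p^{\mathrm{br}}$ is the set of $\alpha\in\mathbb{C}_p$ such that the ramification index of $\mathbb{Q}_p(\alpha)/\mathbb{Q}_p$ (index of $\mathbb{Z}$ in $v_p(\mathbb{Q}_p(\alpha)^* )$) is finite; $\mathbb{Q}_p(\alpha)/\mathbb{Q}_p$ is unramified if this index is $1$; $\mathbb{O}_p^{\mathrm{br}}=\mathbb{O}_p\cap\mathbb{C}_p^{\mathrm{br}}$. A pair $(\alpha,\delta)\in\mathbb{C}_p\times(\mathbb{Q}\cup\{\infty\})$ is admissible if: when $\delta\in\mathbb{Q}$, $\alpha\in\overline{\mathbb{Q}_p}$;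 when $\delta=\infty$, $\alpha$ is transcendental over $\mathbb{Q}$. A pair $(\alpha,\delta)\in\overline{\mathbb{Q}_p}\times\mathbb{Q}$ is minimal if every $\beta\in\overline{\mathbb{Q}_p}$ with $v_p(\beta-\alpha)\ge\delta$ satisfies $[\mathbb{Q}_p(\beta):\mathbb{Q}_p]\ge[\mathbb{Q}_p(\alpha):\mathbb{Q}_p]$. For $\delta\in\mathbb{Q}$, $v_{p,\alpha,\delta}$ is the monomial valuation on $\mathbb{C}_p(X)$ given on polynomials by $v_{p,\alpha,\delta}(\sum_i a_i(X-\alpha)^i)=\min_i\{v_p(a_i)+i\delta\}$; for $\delta=\infty$, $v_{p,\alpha,\infty}(\varphi)=v_p(\varphi(\alpha))$ for $\varphi\in\mathbb{Q}(X)$. $\mathbb{Z}_{(p),\alpha,\delta}=\{\varphi\in\mathbb{Q}(X):v_{p,\alpha,\delta}(\varphi)\ge0\}$. $e(W\mid\mathbb{Z}_{(p)})$ is the index of the value group of $\mathbb{Z}_{(p)}$ in that of $W$. *)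

theory Defs
  imports "HOL-Computational_Algebra.Computational_Algebra" "HOL-Library.Extended_Nat"
begin

definition vp_rat :: "nat \<Rightarrow> rat \<Rightarrow> int" where
  "vp_rat p q = (let (a, b) = quotient_of q in
      int (multiplicity (int p) a) - int (multiplicity (int p) b))"

text \<open>A valued field of characteristic 0 whose valuation v (given on nonzero elements;
  v 0 = infinity is encoded by the disjunctions "x = y \<or> v (x - y) > N") restricts to the
  p-adic valuation on Q, which is algebraically closed, complete, and in which the algebraic
  numbers are dense. Such a valued field is isomorphic to the completion C_p of an algebraic
  closure of Q_p.\<close>

definition is_Cp :: "nat \<Rightarrow> ('k::field_char_0 \<Rightarrow> real) \<Rightarrow> bool" where
  "is_Cp p v \<longleftrightarrow>
     prime p \<and>
     (\<forall>x y. x \<noteq> 0 \<longrightarrow> y \<noteq> 0 \<longrightarrow> v (x * y) = v x + v y) \<and>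
     (\<forall>x y. x \<noteq> 0 \<longrightarrow> y \<noteq> 0 \<longrightarrow> x + y \<noteq> 0 \<longrightarrow> v (x + y) \<ge> min (v x) (v y)) \<and>
     (\<forall>q. q \<noteq> 0 \<longrightarrow> v (of_rat q) = of_int (vp_rat p q)) \<and>
     (\<forall>P :: 'k poly. degree P > 0 \<longrightarrow> (\<exists>z. poly P z = 0)) \<and>
     (\<forall>s :: nat \<Rightarrow> 'k.
        (\<forall>N::real. \<exists>M. \<forall>m\<ge>M. \<forall>n\<ge>M. s m = s n \<or> v (s m - s n) > N) \<longrightarrow>
        (\<exists>y. \<forall>N::real. \<exists>M. \<forall>n\<ge>M. s n = y \<or> v (s n - y) > N)) \<and>
     (\<forall>x N::real. \<exists>y. algebraic y \<and> (x = y \<or> v (x - y) > N))"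

definition Qp_in :: "('k::field_char_0 \<Rightarrow> real) \<Rightarrow> 'k set" where
  "Qp_in v = {x. \<forall>N::real. \<exists>q. x = of_rat q \<or> v (x - of_rat q) > N}"

definition Qp_poly :: "('k::field_char_0 \<Rightarrow> real) \<Rightarrow> 'k poly \<Rightarrow> bool" where
  "Qp_poly v P \<longleftrightarrow> (\<forall>i. coeff P i \<in> Qp_in v)"

definition Qp_alg :: "('k::field_char_0 \<Rightarrow> real) \<Rightarrow> 'k \<Rightarrow> bool" where
  "Qp_alg v a \<longleftrightarrow> (\<exists>P. P \<noteq> 0 \<and> Qp_poly v P \<and> poly P a = 0)"

definition Qp_deg :: "('k::field_char_0 \<Rightarrow> real) \<Rightarrow> 'k \<Rightarrow> nat" where
  "Qp_deg v a = (LEAST n. \<exists>P. P \<noteq> 0 \<and> Qp_poly v P \<and> poly P a = 0 \<and> degree P = n)"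

definition Qp_adj :: "('k::field_char_0 \<Rightarrow> real) \<Rightarrow> 'k \<Rightarrow> 'k set" where
  "Qp_adj v a = {poly P a / poly Q a | P Q. Qp_poly v P \<and> Qp_poly v Q \<and> poly Q a \<noteq> 0}"

definition Qp_adj_vgroup :: "('k::field_char_0 \<Rightarrow> real) \<Rightarrow> 'k \<Rightarrow> real set" where
  "Qp_adj_vgroup v a = v ` (Qp_adj v a - {0})"

text \<open>Finite ramification index: Z has finite index in the value group (which contains Z),
  i.e. the value group lies in (1/e)Z for some e > 0.\<close>
definition Cp_br :: "('k::field_char_0 \<Rightarrow> real) \<Rightarrow> 'k \<Rightarrow> bool" where
  "Cp_br v a \<longleftrightarrow> (\<exists>e::nat. e > 0 \<and> (\<forall>g\<in>Qp_adj_vgroup v a. of_nat e * g \<in> \<int>))"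

definition Qp_unramified :: "('k::field_char_0 \<Rightarrow> real) \<Rightarrow> 'k \<Rightarrow> bool" where
  "Qp_unramified v a \<longleftrightarrow> Qp_adj_vgroup v a = \<int>"

definition Op_br :: "('k::field_char_0 \<Rightarrow> real) \<Rightarrow> 'k set" where
  "Op_br v = {a. (a = 0 \<or> v a \<ge> 0) \<and> Cp_br v a}"

text \<open>Admissible pairs, with delta in Q \<union> {\<infinity>} restricted to Z_{\<ge>0} \<union> {\<infinity>} (enat).\<close>
definition admissible :: "('k::field_char_0 \<Rightarrow> real) \<Rightarrow> 'k \<Rightarrow> enat \<Rightarrow> bool" where
  "admissible v a d \<longleftrightarrow> (d \<noteq> \<infinity> \<longrightarrow> Qp_alg v a) \<and> (d = \<infinity> \<longrightarrow> \<not> algebraic a)"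

definition minimal_pair :: "('k::field_char_0 \<Rightarrow> real) \<Rightarrow> 'k \<Rightarrow> real \<Rightarrow> bool" where
  "minimal_pair v a d \<longleftrightarrow> Qp_alg v a \<and>
     (\<forall>b. Qp_alg v b \<longrightarrow> (b = a \<or> v (b - a) \<ge> d) \<longrightarrow> Qp_deg v b \<ge> Qp_deg v a)"

type_synonym ratfun = "rat poly fract"

definition taylor_coeff :: "'k::field_char_0 \<Rightarrow> rat poly \<Rightarrow> nat \<Rightarrow> 'k" where
  "taylor_coeff a f i = coeff (pcompose (map_poly of_rat f) [:a, 1:]) i"

definition mono_val :: "('k::field_char_0 \<Rightarrow> real) \<Rightarrow> 'k \<Rightarrow> real \<Rightarrow> rat poly \<Rightarrow> real" where
  "mono_val v a d f = Min {v (taylor_coeff a f i) + of_nat i * d | i. taylor_coeff a f i \<noteq> 0}"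

definition Zp_ring :: "('k::field_char_0 \<Rightarrow> real) \<Rightarrow> 'k \<Rightarrow> enat \<Rightarrow> ratfun set" where
  "Zp_ring v a d =
     (if d = \<infinity> then
        {phi. \<exists>f g. g \<noteq> 0 \<and> phi = Fract f g \<and> poly (map_poly of_rat g) a \<noteq> 0 \<and>
           (poly (map_poly of_rat f) a = 0 \<or>
            v (poly (map_poly of_rat f) a) \<ge> v (poly (map_poly of_rat g) a))}
      else
        {phi. \<exists>f g. g \<noteq> 0 \<and> phi = Fract f g \<and>
           (f = 0 \<or> mono_val v a (real (the_enat d)) f \<ge> mono_val v a (real (the_enat d)) g)})"

definition const_rf :: "rat \<Rightarrow> ratfun" where
  "const_rf c = Fract [:c:] 1"

definition X_rf :: ratfun where
  "X_rf = Fract [:0, 1:] 1"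

definition dvr_valuation :: "ratfun set \<Rightarrow> (ratfun \<Rightarrow> int) \<Rightarrow> bool" where
  "dvr_valuation W w \<longleftrightarrow>
     (\<forall>x y. x \<noteq> 0 \<longrightarrow> y \<noteq> 0 \<longrightarrow> w (x * y) = w x + w y) \<and>
     (\<forall>x y. x \<noteq> 0 \<longrightarrow> y \<noteq> 0 \<longrightarrow> x + y \<noteq> 0 \<longrightarrow> w (x + y) \<ge> min (w x) (w y)) \<and>
     (\<forall>n. \<exists>x. x \<noteq> 0 \<and> w x = n) \<and>
     W = {x. x = 0 \<or> w x \<ge> 0}"

definition is_dvr :: "ratfun set \<Rightarrow> bool" where
  "is_dvr W \<longleftrightarrow> (\<exists>w. dvr_valuation W w)"

definition Z_loc :: "nat \<Rightarrow> rat set" where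
  "Z_loc p = {of_int a / of_int b | a b. \<not> int p dvd b}"

text \<open>e(W | Z_(p)) = 1: the value group of Z_(p) = W \<inter> Q (the image of Q^* under
  the normalized valuation) is all of the value group Z of W.\<close>
definition dvr_unramified :: "ratfun set \<Rightarrow> bool" where
  "dvr_unramified W \<longleftrightarrow>
     (\<forall>w. dvr_valuation W w \<longrightarrow> w ` (const_rf ` (UNIV - {0})) = UNIV)"

end

theory Submission
  imports Defs "HOL-Library.Product_Plus"
begin

text \<open>If \<open>W\<close> is unramified, then \<open>p\<close> is a uniformizer of its valuation \<open>w\<close>. The residues of \<open>w\<close> that
  are algebraic over the prime field are matched with residues of \<open>v\<close> by a subring of \<open>\<rat>(X) \<times> \<complex>\<^sub>p\<close>, maximal
  among those in which the two components have positive valuation simultaneously; this replaces an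
  embedding of residue fields, and no completion of \<open>\<rat>(X)\<close> is needed. Modulo any power of \<open>p\<close> it lifts
  integral combinations of roots of unity of order prime to \<open>p\<close> isometrically to \<open>\<rat>(X)\<close>.

  Expand \<open>X\<close> into Teichmueller digits: if \<open>X - r\<close> is divisible by \<open>p\<^sup>m\<close>, where \<open>r\<close> lifts a partial sum
  \<open>a\<close>, and \<open>(X - r) / p\<^sup>m\<close> has an algebraic residue, then this residue gives the next digit. If the
  process never stops, \<open>w f = v (f (a))\<close> for the limit \<open>a\<close>. If the residue is transcendental at step \<open>m\<close>,
  the Taylor expansion at \<open>r\<close> shows that \<open>w\<close> is the monomial valuation of the pair \<open>(a, m)\<close>. This pair is
  minimal because every \<open>b\<close> with \<open>v (b - a) \<ge> m\<close> determines the digits of \<open>a\<close> as limits of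
  polynomials in \<open>b\<close>. Conversely, if \<open>a\<close> is unramified then the valuation of \<open>(a, \<delta>)\<close> takes integral
  values, so \<open>p\<close> is a uniformizer.\<close>

section \<open>Componentwise multiplication on pairs\<close>

text \<open>Q(X) is not complete for w, so a residue algebraic over the prime field need not have a
  Teichmueller representative there: iterated Frobenius powers provide one only modulo a chosen
  power of p. Digit sums are therefore exact in C_p, while their counterparts in Q(X) depend on a
  precision M, and \<open>stage\<close> asks for a counterpart at each precision. That both
  components of a pair in the ring reach the maximal ideals simultaneously means that the ring
  reduces to the graph of an isomorphism between two rings of residues. Evaluating a polynomial at a
  pair (r, a) then compares its values at r and at a inside a single ring. In the direction from W
  to a pair, the absence of ramification enters through w(p) = 1 combined with integral values:
  every element of the maximal ideal is divisible by p, so one correct residue gains a full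
  digit.\<close>

instantiation prod :: (times, times) times
begin
definition times_prod_def: "x * y = (fst x * fst y, snd x * snd y)"
instance ..
end

instantiation prod :: (one, one) one
begin
definition one_prod_def: "1 = (1, 1)"
instance ..
end

lemma fst_mult [simp]: "fst (x * y) = fst x * fst y"
  and snd_mult [simp]: "snd (x * y) = snd x * snd y"
  and fst_one [simp]: "fst 1 = 1"
  and snd_one [simp]: "snd 1 = 1"
  by (simp_all add: times_prod_def one_prod_def)

instance prod :: (comm_ring_1, comm_ring_1) comm_ring_1
  by standard (simp_all add: prod_eq_iff algebra_simps)

lemma fst_power [simp]: "fst (x ^ n) = fst (x :: 'a::comm_ring_1 \<times> 'b::comm_ring_1) ^ n"
  and snd_power [simp]: "snd (x ^ n) = snd x ^ n"
  by (induction n) simp_all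

lemma fst_of_nat [simp]: "fst (of_nat n :: 'a::comm_ring_1 \<times> 'b::comm_ring_1) = of_nat n"
  and snd_of_nat [simp]: "snd (of_nat n :: 'a \<times> 'b) = of_nat n"
  by (induction n) simp_all

lemma fst_of_int [simp]: "fst (of_int n :: 'a::comm_ring_1 \<times> 'b::comm_ring_1) = of_int n"
  and snd_of_int [simp]: "snd (of_int n :: 'a \<times> 'b) = of_int n"
  by (cases n; simp)+

lemma fst_poly: "fst (poly F z) = poly (map_poly fst F) (fst (z :: 'a::comm_ring_1 \<times> 'b::comm_ring_1))"
  and snd_poly: "snd (poly F z) = poly (map_poly snd F) (snd z)"
  by (induction F; simp add: map_poly_pCons)+

section \<open>Subrings, ideals and Frobenius\<close>

definition is_subring :: "'r::comm_ring_1 set \<Rightarrow> bool" where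
  "is_subring S \<longleftrightarrow> 1 \<in> S \<and> (\<forall>x\<in>S. \<forall>y\<in>S. x + y \<in> S \<and> x * y \<in> S) \<and> (\<forall>x\<in>S. - x \<in> S)"

lemma is_subringI:
  assumes "1 \<in> S" "\<And>x y. x \<in> S \<Longrightarrow> y \<in> S \<Longrightarrow> x + y \<in> S"
    "\<And>x y. x \<in> S \<Longrightarrow> y \<in> S \<Longrightarrow> x * y \<in> S" "\<And>x. x \<in> S \<Longrightarrow> - x \<in> S"
  shows "is_subring S"
  using assms unfolding is_subring_def by blast

lemma subring_add: "is_subring S \<Longrightarrow> x \<in> S \<Longrightarrow> y \<in> S \<Longrightarrow> x + y \<in> S"
  and subring_mult: "is_subring S \<Longrightarrow> x \<in> S \<Longrightarrow> y \<in> S \<Longrightarrow> x * y \<in> S"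
  and subring_uminus: "is_subring S \<Longrightarrow> x \<in> S \<Longrightarrow> - x \<in> S"
  and subring_one: "is_subring S \<Longrightarrow> 1 \<in> S"
  unfolding is_subring_def by blast+

lemma subring_diff: "is_subring S \<Longrightarrow> x \<in> S \<Longrightarrow> y \<in> S \<Longrightarrow> x - y \<in> S"
  using subring_add[of S x "- y"] subring_uminus[of S y] by simp

lemma subring_zero: "is_subring S \<Longrightarrow> 0 \<in> S"
  using subring_diff[of S 1 1] subring_one[of S] by simp

lemma subring_power: "is_subring S \<Longrightarrow> x \<in> S \<Longrightarrow> x ^ n \<in> S"
  by (induction n) (auto intro: subring_one subring_mult)

lemma subring_of_nat: "is_subring S \<Longrightarrow> of_nat n \<in> S"
  by (induction n) (auto intro: subring_one subring_add subring_zero)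

lemma subring_of_int: "is_subring S \<Longrightarrow> of_int n \<in> S"
  by (metis of_int_minus of_int_of_nat_eq int_cases2 subring_of_nat subring_uminus)

lemma subring_sum: "is_subring S \<Longrightarrow> (\<And>i. i \<in> I \<Longrightarrow> f i \<in> S) \<Longrightarrow> sum f I \<in> S"
  by (induction I rule: infinite_finite_induct) (auto intro: subring_zero subring_add)

lemma subring_prod: "is_subring S \<Longrightarrow> (\<And>i. i \<in> I \<Longrightarrow> f i \<in> S) \<Longrightarrow> prod f I \<in> S"
  by (induction I rule: infinite_finite_induct) (auto intro: subring_one subring_mult)

definition polys_over :: "'r::comm_ring_1 set \<Rightarrow> 'r poly set" where
  "polys_over S = {F. \<forall>i. coeff F i \<in> S}"

lemma coeff_polys_over: "F \<in> polys_over S \<Longrightarrow> coeff F i \<in> S"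
  by (simp add: polys_over_def)

lemma pCons_polys_over [simp]: "pCons a F \<in> polys_over S \<longleftrightarrow> a \<in> S \<and> F \<in> polys_over S"
  by (auto simp: polys_over_def coeff_pCons split: nat.splits)

lemma zero_polys_over: "is_subring S \<Longrightarrow> 0 \<in> polys_over S"
  by (simp add: polys_over_def subring_zero)

lemma subring_polys_over: "is_subring S \<Longrightarrow> is_subring (polys_over S)"
  by (rule is_subringI)
    (auto simp: polys_over_def coeff_mult coeff_1
      intro: subring_one subring_zero subring_add subring_uminus intro!: subring_sum subring_mult)

lemma poly_in_subring: "is_subring S \<Longrightarrow> F \<in> polys_over S \<Longrightarrow> x \<in> S \<Longrightarrow> poly F x \<in> S"
  by (simp add: poly_altdef polys_over_def subring_sum subring_mult subring_power)

lemma pcompose_polys_over: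
  assumes "is_subring S" "F \<in> polys_over S" "H \<in> polys_over S"
  shows "pcompose F H \<in> polys_over S"
  using assms(2)
  by (induction F)
    (auto simp: pcompose_pCons zero_polys_over assms
      intro!: subring_add[OF subring_polys_over] subring_mult[OF subring_polys_over])

section \<open>Ideals of a subring\<close>

definition is_ideal_in :: "'r::comm_ring_1 set \<Rightarrow> 'r set \<Rightarrow> bool" where
  "is_ideal_in S J \<longleftrightarrow> J \<subseteq> S \<and> 0 \<in> J \<and> (\<forall>x\<in>J. \<forall>y\<in>J. x + y \<in> J) \<and> (\<forall>s\<in>S. \<forall>x\<in>J. s * x \<in> J)"

lemma ideal_add: "is_ideal_in S J \<Longrightarrow> x \<in> J \<Longrightarrow> y \<in> J \<Longrightarrow> x + y \<in> J"
  and ideal_mult: "is_ideal_in S J \<Longrightarrow> s \<in> S \<Longrightarrow> x \<in> J \<Longrightarrow> s * x \<in> J"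
  and ideal_zero: "is_ideal_in S J \<Longrightarrow> 0 \<in> J"
  unfolding is_ideal_in_def by blast+

lemma ideal_mult2: "is_ideal_in S J \<Longrightarrow> s \<in> S \<Longrightarrow> x \<in> J \<Longrightarrow> x * s \<in> J"
  using ideal_mult by (metis mult.commute)

lemma ideal_uminus: "is_subring S \<Longrightarrow> is_ideal_in S J \<Longrightarrow> x \<in> J \<Longrightarrow> - x \<in> J"
  using ideal_mult[of S J "-1" x] by (simp add: subring_one subring_uminus)

lemma ideal_sum: "is_ideal_in S J \<Longrightarrow> (\<And>i. i \<in> I \<Longrightarrow> f i \<in> J) \<Longrightarrow> sum f I \<in> J"
  by (induction I rule: infinite_finite_induct) (auto intro: ideal_zero ideal_add)

lemma ideal_power_diff:
  assumes "is_subring S" "is_ideal_in S J" "x \<in> S" "y \<in> S" "x - y \<in> J"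
  shows "x ^ n - y ^ n \<in> J"
proof -
  have "(x - y) * (\<Sum>i<n. y ^ (n - Suc i) * x ^ i) \<in> J"
    using assms by (intro ideal_mult2[OF assms(2)] subring_sum subring_mult subring_power)
  then show ?thesis by (simp add: power_diff_sumr2)
qed

section \<open>Frobenius powers modulo an ideal that contains p\<close>

lemma frobenius_add_prime:
  assumes S: "is_subring S" and J: "is_ideal_in S J" and p: "prime p" "of_nat p \<in> J"
    and xy: "x \<in> S" "y \<in> S"
  shows "(x + y) ^ p - x ^ p - y ^ p \<in> J"
proof -
  have p0: "p > 0" using p(1) by (simp add: prime_gt_0_nat)
  have "(x + y) ^ p = (\<Sum>k\<le>p. of_nat (p choose k) * x ^ k * y ^ (p - k))"
    by (rule binomial_ring)
  also have "{..p} = insert 0 (insert p {0<..<p})" using p0 by auto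
  finally have "(x + y) ^ p - x ^ p - y ^ p =
      (\<Sum>k\<in>{0<..<p}. of_nat (p choose k) * x ^ k * y ^ (p - k))"
    using p0 by simp
  moreover have "of_nat (p choose k) * x ^ k * y ^ (p - k) \<in> J" if "k \<in> {0<..<p}" for k
  proof -
    have "p dvd (p choose k)" using that p(1) by (intro dvd_choose_prime) auto
    then obtain c where c: "p choose k = p * c" by (elim dvdE)
    have "of_nat c * x ^ k * y ^ (p - k) \<in> S"
      using S xy by (intro subring_mult subring_power subring_of_nat)
    then have "(of_nat c * x ^ k * y ^ (p - k)) * of_nat p \<in> J"
      using p(2) by (rule ideal_mult[OF J])
    then show ?thesis by (simp add: c mult_ac)
  qed
  ultimately show ?thesis by (simp only: ideal_sum[OF J])
qed

lemma frobenius_add: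
  assumes S: "is_subring S" and J: "is_ideal_in S J" and p: "prime p" "of_nat p \<in> J"
    and xy: "x \<in> S" "y \<in> S"
  shows "(x + y) ^ (p ^ n) - x ^ (p ^ n) - y ^ (p ^ n) \<in> J"
proof (induction n)
  case 0
  then show ?case using ideal_zero[OF J] by simp
next
  case (Suc n)
  let ?q = "p ^ n"
  have "((x + y) ^ ?q) - (x ^ ?q + y ^ ?q) \<in> J" using Suc by (simp add: algebra_simps)
  then have "((x + y) ^ ?q) ^ p - (x ^ ?q + y ^ ?q) ^ p \<in> J"
    using S J xy by (intro ideal_power_diff[OF S J] subring_power subring_add) auto
  moreover have "(x ^ ?q + y ^ ?q) ^ p - (x ^ ?q) ^ p - (y ^ ?q) ^ p \<in> J"
    using S J p xy by (intro frobenius_add_prime subring_power) auto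
  ultimately have "((x + y) ^ ?q) ^ p - (x ^ ?q + y ^ ?q) ^ p
      + ((x ^ ?q + y ^ ?q) ^ p - (x ^ ?q) ^ p - (y ^ ?q) ^ p) \<in> J"
    by (rule ideal_add[OF J])
  then show ?case by (simp add: power_mult[symmetric] mult.commute algebra_simps)
qed

text \<open>The elements whose class satisfies z^q = z for q = p^n. The pair S, J stays general
  because it occurs in two ways: as a valuation ring with its maximal ideal, where the classes form
  a finite field, and as \<open>lifts M\<close> with \<open>small M\<close>, whose quotient is not
  known to be a domain.\<close>

definition frob_fixed :: "nat \<Rightarrow> 'r::comm_ring_1 set \<Rightarrow> 'r set \<Rightarrow> nat \<Rightarrow> 'r set" where
  "frob_fixed p S J n = {z\<in>S. z ^ (p ^ n) - z \<in> J}"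

lemma subring_frob_fixed:
  assumes S: "is_subring S" and J: "is_ideal_in S J" and p: "prime p" "of_nat p \<in> J" and n: "n > 0"
  shows "is_subring (frob_fixed p S J n)"
proof (rule is_subringI)
  let ?q = "p ^ n"
  show "1 \<in> frob_fixed p S J n"
    using S J by (simp add: frob_fixed_def subring_one ideal_zero)
  fix x assume x: "x \<in> frob_fixed p S J n"
  then have xS: "x \<in> S" and xJ: "x ^ ?q - x \<in> J" by (auto simp: frob_fixed_def)
  show "- x \<in> frob_fixed p S J n"
  proof (cases "p = 2")
    case True
    \<comment> \<open>The exponent is even here and the sign disappears; the resulting error 2 x
      lies in J because p does.\<close>
    then have "(- x) ^ ?q - (- x) = (x ^ ?q - x) + of_nat p * x"
      using n by (simp add: algebra_simps power_minus_even)
    moreover have "(x ^ ?q - x) + of_nat p * x \<in> J"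
      by (rule ideal_add[OF J xJ ideal_mult2[OF J xS p(2)]])
    ultimately have "(- x) ^ ?q - (- x) \<in> J" by (simp only:)
    then show ?thesis using subring_uminus[OF S xS] unfolding frob_fixed_def by blast
  next
    case False
    then have "odd ?q" using p(1) by (metis even_power primes_dvd_imp_eq two_is_prime_nat)
    then have "(- x) ^ ?q - (- x) = - (x ^ ?q - x)" by simp
    then have "(- x) ^ ?q - (- x) \<in> J" using ideal_uminus[OF S J xJ] by (simp only:)
    then show ?thesis using subring_uminus[OF S xS] unfolding frob_fixed_def by blast
  qed
  fix y assume y: "y \<in> frob_fixed p S J n"
  then have yS: "y \<in> S" and yJ: "y ^ ?q - y \<in> J" by (auto simp: frob_fixed_def)
  have "((x + y) ^ ?q - x ^ ?q - y ^ ?q) + ((x ^ ?q - x) + (y ^ ?q - y)) \<in> J"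
    using xJ yJ by (intro ideal_add[OF J] frobenius_add[OF S J p xS yS])
  then show "x + y \<in> frob_fixed p S J n"
    using S xS yS by (simp add: frob_fixed_def subring_add algebra_simps)
  have "x ^ ?q * (y ^ ?q - y) + (x ^ ?q - x) * y \<in> J"
    using xJ yJ S xS yS by (intro ideal_add[OF J] ideal_mult[OF J] ideal_mult2[OF J] subring_power)
  then show "x * y \<in> frob_fixed p S J n"
    using S xS yS by (simp add: frob_fixed_def subring_mult algebra_simps)
qed

text \<open>Mirrors the inclusion of the field with p^n elements in the one with p^(n k) elements,
  so that finitely many elements can be given a common exponent.\<close>

lemma frob_fixed_mult:
  assumes S: "is_subring S" and J: "is_ideal_in S J"
  shows "frob_fixed p S J n \<subseteq> frob_fixed p S J (n * k)"
proof
  fix x assume x: "x \<in> frob_fixed p S J n"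
  then have xS: "x \<in> S" and xJ: "x ^ (p ^ n) - x \<in> J" by (auto simp: frob_fixed_def)
  have "x ^ (p ^ (n * k)) - x \<in> J"
  proof (induction k)
    case 0
    then show ?case using ideal_zero[OF J] by simp
  next
    case (Suc k)
    have "(x ^ (p ^ (n * k))) ^ (p ^ n) - x ^ (p ^ n) \<in> J"
      using Suc xS by (intro ideal_power_diff[OF S J] subring_power[OF S])
    then have "(x ^ (p ^ (n * k))) ^ (p ^ n) - x ^ (p ^ n) + (x ^ (p ^ n) - x) \<in> J"
      using xJ by (rule ideal_add[OF J])
    then show ?case by (simp add: power_mult[symmetric] power_add mult.commute)
  qed
  then show "x \<in> frob_fixed p S J (n * k)" using xS by (simp add: frob_fixed_def)
qed

text \<open>For a valuation ring and its maximal ideal these are the elements whose residue is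
  algebraic over the prime field. Membership in some finite field replaces a polynomial equation,
  which makes closure under the ring operations immediate.\<close>

definition frob_alg :: "nat \<Rightarrow> 'r::comm_ring_1 set \<Rightarrow> 'r set \<Rightarrow> 'r set" where
  "frob_alg p S J = (\<Union>n\<in>{0<..}. frob_fixed p S J n)"

lemma frob_alg_finite:
  assumes S: "is_subring S" and J: "is_ideal_in S J" and "finite A" "A \<subseteq> frob_alg p S J"
  shows "\<exists>n>0. A \<subseteq> frob_fixed p S J n"
  using assms(3,4)
proof (induction A)
  case empty
  then show ?case by auto
next
  case (insert x A)
  then obtain n where n: "n > 0" "A \<subseteq> frob_fixed p S J n" by auto
  from insert obtain k where k: "k > 0" "x \<in> frob_fixed p S J k" by (auto simp: frob_alg_def)
  have "x \<in> frob_fixed p S J (k * n)" using k frob_fixed_mult[OF S J] by blast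
  moreover have "A \<subseteq> frob_fixed p S J (k * n)"
    using n frob_fixed_mult[OF S J, of p n k] by (simp add: mult.commute)
  ultimately show ?case using n k by (intro exI[of _ "k * n"]) auto
qed

lemma subring_frob_alg:
  assumes S: "is_subring S" and J: "is_ideal_in S J" and p: "prime p" "of_nat p \<in> J"
  shows "is_subring (frob_alg p S J)"
proof (rule is_subringI)
  note R = subring_frob_fixed[OF S J p]
  have I: "x \<in> frob_alg p S J" if "x \<in> frob_fixed p S J n" "n > 0" for x n
    using that by (auto simp: frob_alg_def)
  show "1 \<in> frob_alg p S J" using I[of 1 1] subring_one[OF R, of 1] by simp
  fix x assume x: "x \<in> frob_alg p S J"
  then obtain m where "m > 0" "x \<in> frob_fixed p S J m" by (auto simp: frob_alg_def)
  then show "- x \<in> frob_alg p S J" using I subring_uminus[OF R] by blast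
  fix y assume y: "y \<in> frob_alg p S J"
  obtain n where n: "n > 0" and "x \<in> frob_fixed p S J n" "y \<in> frob_fixed p S J n"
    using frob_alg_finite[OF S J, of "{x, y}"] x y by auto
  then show "x + y \<in> frob_alg p S J" "x * y \<in> frob_alg p S J"
    by (auto intro!: I[OF _ n] subring_add[OF R[OF n]] subring_mult[OF R[OF n]])
qed

inductive_set gen_ring :: "'r::comm_ring_1 set \<Rightarrow> 'r set" for A :: "'r set" where
  gen: "x \<in> A \<Longrightarrow> x \<in> gen_ring A"
| one: "1 \<in> gen_ring A"
| add: "x \<in> gen_ring A \<Longrightarrow> y \<in> gen_ring A \<Longrightarrow> x + y \<in> gen_ring A"
| mult: "x \<in> gen_ring A \<Longrightarrow> y \<in> gen_ring A \<Longrightarrow> x * y \<in> gen_ring A"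
| neg: "x \<in> gen_ring A \<Longrightarrow> - x \<in> gen_ring A"

lemma subring_gen_ring: "is_subring (gen_ring A)"
  by (rule is_subringI) (auto intro: gen_ring.intros)

lemma gen_ring_subset: "is_subring S \<Longrightarrow> A \<subseteq> S \<Longrightarrow> gen_ring A \<subseteq> S"
proof
  fix x assume S: "is_subring S" "A \<subseteq> S" "x \<in> gen_ring A"
  show "x \<in> S" using S(3)
    by induction (use S in \<open>simp_all add: is_subring_def subset_eq\<close>)
qed

section \<open>Valuations normalized at a prime\<close>

text \<open>Modulo J all q summands equal y^(q-1), which leaves q y^(q-1). The sum is the cofactor
  of x - y in x^q - y^q, so it governs both the gain of precision under powers and the uniqueness of
  Teichmueller representatives.\<close>

lemma ideal_geometric_sum:
  assumes S: "is_subring S" and J: "is_ideal_in S J" and q: "of_nat q \<in> J"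
    and xy: "x \<in> S" "y \<in> S" "x - y \<in> J"
  shows "(\<Sum>i<q. y ^ (q - Suc i) * x ^ i) \<in> J"
proof -
  have *: "y ^ (q - Suc i) * (x ^ i - y ^ i) \<in> J" for i
    by (rule ideal_mult[OF J subring_power[OF S xy(2)] ideal_power_diff[OF S J xy]])
  have "y ^ (q - Suc i) * x ^ i = y ^ (q - Suc i) * (x ^ i - y ^ i) + y ^ (q - 1)" if "i < q" for i
    using that by (simp add: algebra_simps flip: power_add)
  then have "(\<Sum>i<q. y ^ (q - Suc i) * x ^ i) =
      (\<Sum>i<q. y ^ (q - Suc i) * (x ^ i - y ^ i)) + y ^ (q - 1) * of_nat q"
    by (simp add: sum.distrib mult.commute)
  also have "\<dots> \<in> J"
    by (rule ideal_add[OF J ideal_sum[OF J *] ideal_mult[OF J subring_power[OF S xy(2)] q]])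
  finally show ?thesis .
qed

locale pvaluation =
  fixes p :: nat and v :: "'a::field \<Rightarrow> real"
  assumes prime_p: "prime p"
    and v_mult: "x \<noteq> 0 \<Longrightarrow> y \<noteq> 0 \<Longrightarrow> v (x * y) = v x + v y"
    and v_add: "x \<noteq> 0 \<Longrightarrow> y \<noteq> 0 \<Longrightarrow> x + y \<noteq> 0 \<Longrightarrow> min (v x) (v y) \<le> v (x + y)"
    and p_nz [simp]: "of_nat p \<noteq> (0::'a)"
    and v_p: "v (of_nat p) = 1"
begin

text \<open>\<open>v 0\<close> is an arbitrary real, so estimates are phrased by balls around 0 that
  contain 0 by definition.\<close>

definition vge :: "real \<Rightarrow> 'a set" where "vge r = {x. x = 0 \<or> r \<le> v x}"
definition vgt :: "real \<Rightarrow> 'a set" where "vgt r = {x. x = 0 \<or> r < v x}"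

abbreviation "\<O> \<equiv> vge 0"
abbreviation "\<M> \<equiv> vgt 0"

lemma v_one [simp]: "v 1 = 0"
  using v_mult[of 1 1] by simp

lemma v_minus_one: "v (- 1) = 0"
  using v_mult[of "-1" "-1"] by simp

lemma v_uminus [simp]: "v (- x) = v x" 
  using v_mult[of "-1" x] v_minus_one by (cases "x = 0") auto

lemma v_power: "x \<noteq> 0 \<Longrightarrow> v (x ^ n) = of_nat n * v x"
  by (induction n) (auto simp: v_mult algebra_simps)

lemma v_inverse: "x \<noteq> 0 \<Longrightarrow> v (inverse x) = - v x"
  using v_mult[of x "inverse x"] by simp

lemma v_divide: "x \<noteq> 0 \<Longrightarrow> y \<noteq> 0 \<Longrightarrow> v (x / y) = v x - v y"
  by (simp add: divide_inverse v_mult v_inverse)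

lemma v_p_power: "v (of_nat p ^ k) = of_nat k"
  by (simp add: v_power v_p)

lemma vge_zero [simp]: "0 \<in> vge r" and vgt_zero [simp]: "0 \<in> vgt r"
  by (auto simp: vge_def vgt_def)

lemma vge_mono: "x \<in> vge r \<Longrightarrow> s \<le> r \<Longrightarrow> x \<in> vge s"
  by (auto simp: vge_def)

lemma vgt_imp_vge: "x \<in> vgt r \<Longrightarrow> x \<in> vge r"
  by (auto simp: vge_def vgt_def)

lemma vge_imp_vgt: "x \<in> vge r \<Longrightarrow> s < r \<Longrightarrow> x \<in> vgt s"
  by (auto simp: vge_def vgt_def)

lemma vge_add: "x \<in> vge r \<Longrightarrow> y \<in> vge r \<Longrightarrow> x + y \<in> vge r"
  using v_add[of x y] by (cases "x = 0"; cases "y = 0"; cases "x + y = 0"; auto simp: vge_def)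

lemma vgt_add: "x \<in> vgt r \<Longrightarrow> y \<in> vgt r \<Longrightarrow> x + y \<in> vgt r"
  using v_add[of x y] by (cases "x = 0"; cases "y = 0"; cases "x + y = 0"; auto simp: vgt_def)

lemma vge_uminus [simp]: "- x \<in> vge r \<longleftrightarrow> x \<in> vge r" and vgt_uminus [simp]: "- x \<in> vgt r \<longleftrightarrow> x \<in> vgt r"
  by (auto simp: vge_def vgt_def)

lemma vge_diff: "x \<in> vge r \<Longrightarrow> y \<in> vge r \<Longrightarrow> x - y \<in> vge r"
  using vge_add[of x r "- y"] by simp

lemma vgt_diff: "x \<in> vgt r \<Longrightarrow> y \<in> vgt r \<Longrightarrow> x - y \<in> vgt r"
  using vgt_add[of x r "- y"] by simp

lemma vge_minus_commute: "x - y \<in> vge r \<longleftrightarrow> y - x \<in> vge r"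
  using vge_uminus[of "x - y" r] by simp

lemma vgt_minus_commute: "x - y \<in> vgt r \<longleftrightarrow> y - x \<in> vgt r"
  using vgt_uminus[of "x - y" r] by simp

lemma vge_diff_iff: "x - y \<in> vge r \<Longrightarrow> x \<in> vge r \<longleftrightarrow> y \<in> vge r"
  using vge_add[of "x - y" r y] vge_diff[of x r "x - y"] by auto

lemma vgt_diff_iff: "x - y \<in> vgt r \<Longrightarrow> x \<in> vgt r \<longleftrightarrow> y \<in> vgt r"
  using vgt_add[of "x - y" r y] vgt_diff[of x r "x - y"] by auto

lemma vge_trans: "x - y \<in> vge r \<Longrightarrow> y - z \<in> vge r \<Longrightarrow> x - z \<in> vge r"
  using vge_add[of "x - y" r "y - z"] by simp

lemma vgt_trans: "x - y \<in> vgt r \<Longrightarrow> y - z \<in> vgt r \<Longrightarrow> x - z \<in> vgt r"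
  using vgt_add[of "x - y" r "y - z"] by simp

lemma vge_mult: "x \<in> vge r \<Longrightarrow> y \<in> vge s \<Longrightarrow> x * y \<in> vge (r + s)"
  by (cases "x = 0"; cases "y = 0"; auto simp: vge_def v_mult)

lemma vgt_mult: "x \<in> vge r \<Longrightarrow> y \<in> vgt s \<Longrightarrow> x * y \<in> vgt (r + s)"
  by (cases "x = 0"; cases "y = 0"; auto simp: vge_def vgt_def v_mult)

lemma vge_integral_mult: "x \<in> \<O> \<Longrightarrow> y \<in> vge s \<Longrightarrow> x * y \<in> vge s"
  using vge_mult[of x 0 y s] by simp

lemma v_eq_of_close: 
  assumes "x \<noteq> 0" "x - y \<in> vgt (v x)"
  shows "y \<noteq> 0" "v y = v x"
proof -
  show y: "y \<noteq> 0" using assms by (auto simp: vgt_def)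
  show "v y = v x"
  proof (cases "x = y")
    case False
    then have d: "v x < v (x - y)" using assms by (simp add: vgt_def)
    have "v x \<ge> min (v (x - y)) (v y)"
      using v_add[of "x - y" y] False y assms by simp
    moreover have "v y \<ge> min (v x) (v (x - y))"
      using v_add[of x "- (x - y)"] v_uminus[of "x - y"] False y assms
      by (simp del: v_uminus)
    ultimately show ?thesis using d by linarith
  qed simp
qed

lemma subring_O: "is_subring \<O>"
  using vge_mult[of _ 0 _ 0] by (intro is_subringI vge_add) (auto simp: vge_def[of 0])

lemma ideal_vge: "0 \<le> r \<Longrightarrow> is_ideal_in \<O> (vge r)"
  unfolding is_ideal_in_def by (auto intro: vge_add vge_integral_mult vge_mono)

lemma ideal_M: "is_ideal_in \<O> \<M>"
  unfolding is_ideal_in_def using vgt_mult[of _ 0 _ 0] by (auto intro: vgt_add vgt_imp_vge)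

lemma p_in_M [simp]: "of_nat p \<in> \<M>" and p_in_vge1: "of_nat p \<in> vge 1"
  by (auto simp: vgt_def vge_def v_p)

lemma one_notin_M [simp]: "1 \<notin> \<M>" by (auto simp: vgt_def)

lemma unit_iff: "x \<in> \<O> - \<M> \<longleftrightarrow> x \<noteq> 0 \<and> v x = 0"
  by (auto simp: vge_def vgt_def)

lemma unit_mult_vge: "s \<in> \<O> - \<M> \<Longrightarrow> s * x \<in> vge r \<longleftrightarrow> x \<in> vge r"
  and unit_mult_vgt: "s \<in> \<O> - \<M> \<Longrightarrow> s * x \<in> vgt r \<longleftrightarrow> x \<in> vgt r"
  unfolding unit_iff by (cases "x = 0"; auto simp: vge_def vgt_def v_mult)+

lemma mult_in_M: "x \<in> \<O> \<Longrightarrow> y \<in> \<O> \<Longrightarrow> x * y \<in> \<M> \<longleftrightarrow> x \<in> \<M> \<or> y \<in> \<M>"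
  by (cases "x = 0"; cases "y = 0"; auto simp: vge_def vgt_def v_mult)

lemma power_in_M: "x \<in> \<O> \<Longrightarrow> n > 0 \<Longrightarrow> x ^ n \<in> \<M> \<longleftrightarrow> x \<in> \<M>"
  by (cases "x = 0") (auto simp: vge_def vgt_def v_power zero_less_mult_iff power_0_left)

lemma prod_notin_M: "(\<And>i. i \<in> I \<Longrightarrow> f i \<in> \<O> - \<M>) \<Longrightarrow> prod f I \<in> \<O> - \<M>"
  unfolding unit_iff by (induction I rule: infinite_finite_induct) (auto simp: v_mult)

lemma one_minus_unit: "x \<in> \<M> \<Longrightarrow> 1 - x \<in> \<O> - \<M>"
  using vgt_diff[of 1 0 "1 - x"] vge_diff[of 1 0 x] subring_one[OF subring_O] one_notin_M
    vgt_add[of "1 - x" 0 x] vgt_imp_vge[of x 0] by auto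

lemma p_mult_vge: "of_nat p * x \<in> vge (r + 1) \<longleftrightarrow> x \<in> vge r"
  by (cases "x = 0"; auto simp: vge_def v_mult v_p)

lemma div_p_vge: "x / of_nat p ^ k \<in> vge r \<longleftrightarrow> x \<in> vge (r + of_nat k)"
  by (cases "x = 0"; auto simp: vge_def v_divide v_p_power)

lemma div_p_vgt: "x / of_nat p ^ k \<in> vgt r \<longleftrightarrow> x \<in> vgt (r + of_nat k)"
  by (cases "x = 0"; auto simp: vgt_def v_divide v_p_power)

lemma p_power_mult_vge: "of_nat p ^ k * x \<in> vge (r + of_nat k) \<longleftrightarrow> x \<in> vge r"
  by (cases "x = 0"; auto simp: vge_def v_mult v_p_power)

text \<open>For an integer prime to p, a Bezout identity with p would put 1 in the maximal ideal. No
  formula for the values of integers is presupposed, so this applies to w as well as to v.\<close>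

lemma of_int_in_M: "of_int n \<in> \<M> \<longleftrightarrow> int p dvd n"
proof
  assume "int p dvd n"
  then obtain k where "n = int p * k" by (elim dvdE)
  then show "of_int n \<in> \<M>"
    using ideal_mult2[OF ideal_M subring_of_int[OF subring_O, of k] p_in_M] by simp
next
  assume n: "of_int n \<in> \<M>"
  show "int p dvd n"
  proof (rule ccontr)
    assume "\<not> int p dvd n"
    then have "coprime (int p) n" using prime_p by (simp add: prime_imp_coprime)
    then obtain a b where "a * int p + b * n = 1"
      using bezout_int[of "int p" n] by (auto simp: coprime_iff_gcd_eq_1)
    then have "1 = of_int a * of_nat p + of_int b * (of_int n :: 'a)"
      by (metis of_int_1 of_int_add of_int_mult of_int_of_nat_eq)
    also have "\<dots> \<in> \<M>"
      using n by (intro vgt_add ideal_mult[OF ideal_M] subring_of_int[OF subring_O] p_in_M)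
    finally show False by simp
  qed
qed

section \<open>Exponents that are powers of p, and Teichmueller representatives\<close>

lemma power_p_diff:
  assumes "x \<in> \<O>" "y \<in> \<O>" "x - y \<in> vge r" "1 \<le> r"
  shows "x ^ p - y ^ p \<in> vge (r + 1)"
proof -
  \<comment> \<open>The ideal at level 1 contains both p and x - y; the cofactor of x - y thereby
    contributes one further unit of precision.\<close>
  have "(\<Sum>i<p. y ^ (p - Suc i) * x ^ i) \<in> vge 1"
    using assms by (intro ideal_geometric_sum[OF subring_O ideal_vge] p_in_vge1) (auto intro: vge_mono)
  then show ?thesis using vge_mult[OF assms(3)] by (simp add: power_diff_sumr2)
qed

lemma power_p_power_diff:
  assumes "x \<in> \<O>" "y \<in> \<O>" "x - y \<in> vge r" "1 \<le> r"
  shows "x ^ (p ^ n) - y ^ (p ^ n) \<in> vge (r + of_nat n)"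
proof (induction n)
  case (Suc n)
  have "(x ^ (p ^ n)) ^ p - (y ^ (p ^ n)) ^ p \<in> vge (r + of_nat n + 1)"
    using assms Suc by (intro power_p_diff subring_power[OF subring_O]) auto
  then show ?case by (simp add: power_mult[symmetric] mult.commute add_ac)
qed (use assms in simp)

text \<open>The Teichmueller representatives of the field with p^n elements, as far as they lie in
  the given field: 0 and the roots of unity of order dividing p^n - 1.\<close>

definition teich :: "nat \<Rightarrow> 'a set" where "teich n = {t. t ^ (p ^ n) = t}"

lemma p_power_gt_1: "n > 0 \<Longrightarrow> p ^ n > 1"
  using prime_p by (simp add: prime_gt_1_nat one_less_power del: One_nat_def)

lemma teich_integral: assumes "n > 0" "t \<in> teich n" shows "t \<in> \<O>"
proof (cases "t = 0")
  case False
  have "of_nat (p ^ n) * v t = v t" using assms False v_power[of t "p ^ n"] by (simp add: teich_def)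
  then have "(of_nat (p ^ n) - 1) * v t = 0" by (simp add: algebra_simps)
  moreover have "real (p ^ n) \<noteq> 1" using p_power_gt_1[OF assms(1)] by linarith
  ultimately have "v t = 0" by simp
  then show ?thesis by (simp add: vge_def)
qed simp

lemma p_power_in_M: "n > 0 \<Longrightarrow> of_nat (p ^ n) \<in> \<M>"
  by (simp add: power_in_M vgt_imp_vge)

text \<open>For t different from u, cancelling t - u in t^q - u^q = t - u makes the geometric sum
  equal to 1, although the sum lies in the maximal ideal when t and u are congruent.\<close>

lemma teich_separated:
  assumes n: "n > 0" and t: "t \<in> teich n" "u \<in> teich n" "t - u \<in> \<M>"
  shows "t = u"
proof (rule ccontr)
  assume "t \<noteq> u"
  let ?s = "\<Sum>i<p ^ n. u ^ (p ^ n - Suc i) * t ^ i"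
  have "(t - u) * ?s = (t - u) * 1" using t by (simp add: teich_def flip: power_diff_sumr2)
  then have "?s = 1" using \<open>t \<noteq> u\<close> by (subst (asm) mult_left_cancel) auto
  moreover have "?s \<in> \<M>"
    using n t by (intro ideal_geometric_sum[OF subring_O ideal_M] p_power_in_M teich_integral)
  ultimately show False by simp
qed

lemma teich_mult: "t \<in> teich n \<Longrightarrow> t \<in> teich (n * k)"
proof (induction k)
  case (Suc k)
  then have "(t ^ (p ^ (n * k))) ^ (p ^ n) = t" by (simp add: teich_def)
  then show ?case by (simp add: teich_def power_add mult.commute flip: power_mult)
qed (simp add: teich_def)

lemma zero_in_teich: "n > 0 \<Longrightarrow> 0 \<in> teich n"
  using prime_p by (simp add: teich_def power_0_left prime_gt_0_nat)

lemma synthetic_div_polys_over: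
  assumes "is_subring S" "F \<in> polys_over S" "c \<in> S"
  shows "synthetic_div F c \<in> polys_over S"
  using assms(2) by (induction F) (auto simp: assms zero_polys_over poly_in_subring)

text \<open>Over the residue field this is the bound on the number of roots by the degree. It is
  phrased with pairwise incongruent representatives, so that no quotient is formed; the remainder of
  each synthetic division lies in the maximal ideal instead of being 0.\<close>

lemma coeffs_in_M_of_many_roots:
  assumes "finite C" "C \<subseteq> \<O>" "\<And>c d. c \<in> C \<Longrightarrow> d \<in> C \<Longrightarrow> c - d \<in> \<M> \<Longrightarrow> c = d"
    and "F \<in> polys_over \<O>" "degree F < card C" "\<And>c. c \<in> C \<Longrightarrow> poly F c \<in> \<M>"
  shows "F \<in> polys_over \<M>"
  using assms
proof (induction C arbitrary: F)
  case (insert c C)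
  show ?case
  proof (cases "degree F = 0")
    case True
    then obtain a where "F = [:a:]" by (metis degree_eq_zeroE)
    then show ?thesis using insert.prems(5)[of c] by (auto simp: polys_over_def coeff_pCons split: nat.splits)
  next
    case False
    define Q where "Q = synthetic_div F c"
    have F: "[:- c, 1:] * Q + [:poly F c:] = F" unfolding Q_def by (rule synthetic_div_correct')
    have Q: "Q \<in> polys_over \<O>" 
      using insert.prems unfolding Q_def by (intro synthetic_div_polys_over subring_O) auto
    have "poly Q d \<in> \<M>" if d: "d \<in> C" for d
    proof -
      have "poly F d = (d - c) * poly Q d + poly F c" by (subst F[symmetric]) (simp add: algebra_simps)
      then have "(d - c) * poly Q d \<in> \<M>"
        using vgt_diff[OF insert.prems(5)[of d] insert.prems(5)[of c]] d by simp
      moreover have "d - c \<in> \<O>" "d - c \<notin> \<M>"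
        using insert.prems(1,2) insert.hyps d vge_diff[of d 0 c] by auto
      ultimately show ?thesis
        using mult_in_M poly_in_subring[OF subring_O Q] insert.prems(1) d by auto
    qed
    then have "Q \<in> polys_over \<M>"
      using insert.prems(1,2,4) insert.hyps Q False
      by (intro insert.IH) (auto simp: Q_def degree_synthetic_div)
    then have QM: "coeff Q i \<in> \<M>" for i by (simp add: polys_over_def)
    have "coeff F i \<in> \<M>" for i
    proof -
      have cQ: "c * coeff Q i \<in> \<M>"
        using QM insert.prems(1) by (intro ideal_mult[OF ideal_M]) auto
      have "coeff F i = - (c * coeff Q i) + (case i of 0 \<Rightarrow> poly F c | Suc j \<Rightarrow> coeff Q j)"
        by (subst F[symmetric]) (auto simp: coeff_pCons split: nat.splits)
      also have "\<dots> \<in> \<M>"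
        using QM insert.prems(5) cQ by (intro vgt_add) (auto split: nat.splits)
      finally show ?thesis .
    qed
    then show ?thesis by (simp add: polys_over_def)
  qed
qed simp

section \<open>Elements with algebraic residue\<close>

abbreviation "alg_res_n \<equiv> frob_fixed p \<O> \<M>"
abbreviation "alg_res \<equiv> frob_alg p \<O> \<M>"

lemmas subring_alg_res_n = subring_frob_fixed[OF subring_O ideal_M prime_p p_in_M]
lemmas subring_alg_res = subring_frob_alg[OF subring_O ideal_M prime_p p_in_M]

lemma teich_alg_res_n: "n > 0 \<Longrightarrow> t \<in> teich n \<Longrightarrow> t \<in> alg_res_n n"
  by (simp add: frob_fixed_def teich_integral) (simp add: teich_def)

lemma alg_res_n_subset: "n > 0 \<Longrightarrow> alg_res_n n \<subseteq> alg_res"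
  by (auto simp: frob_alg_def)

lemma M_alg_res_n: assumes "n > 0" "x \<in> \<M>" shows "x \<in> alg_res_n n"
proof -
  have "x ^ (p ^ n) \<in> \<M>" using assms prime_p by (simp add: power_in_M vgt_imp_vge prime_gt_0_nat)
  then show ?thesis using assms vgt_diff[of "x ^ (p ^ n)" 0 x] by (simp add: frob_fixed_def vgt_imp_vge)
qed

lemma M_alg_res: "x \<in> \<M> \<Longrightarrow> x \<in> alg_res"
  using M_alg_res_n[of 1 x] alg_res_n_subset[of 1] by auto

lemma alg_res_integral: "x \<in> alg_res \<Longrightarrow> x \<in> \<O>"
  by (auto simp: frob_alg_def frob_fixed_def)

lemma alg_res_n_inverse: 
  assumes "n > 0" "x \<in> alg_res_n n" "x \<notin> \<M>" shows "inverse x \<in> alg_res_n n"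
proof -
  have x: "x \<in> \<O> - \<M>" "x ^ (p ^ n) - x \<in> \<M>" "x \<noteq> 0" using assms by (auto simp: frob_fixed_def)
  then have vx: "v x = 0" using unit_iff by blast
  have u: "inverse x \<in> \<O> - \<M>" unfolding unit_iff using x(3) vx by (simp add: v_inverse)
  have "inverse x ^ (p ^ n) - inverse x = - ((inverse x ^ (p ^ n) * inverse x) * (x ^ (p ^ n) - x))"
    using x by (simp add: field_simps)
  also have "\<dots> \<in> \<M>" unfolding vgt_uminus
    using u x by (intro ideal_mult[OF ideal_M] subring_mult[OF subring_O] subring_power[OF subring_O]) auto
  finally show ?thesis using u by (simp add: frob_fixed_def)
qed

end

section \<open>Counting Teichmueller representatives in an algebraically closed field\<close>

lemma card_roots_of_simple_roots:
  fixes P :: "'a::field poly"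
  assumes alg_closed: "\<And>P :: 'a poly. degree P > 0 \<Longrightarrow> \<exists>z. poly P z = 0"
    and "P \<noteq> 0" "\<And>z. order z P \<le> 1"
  shows "card {z. poly P z = 0} = degree P"
  using assms(2,3)
proof (induction "degree P" arbitrary: P)
  case 0
  then obtain a where "P = [:a:]" by (metis degree_eq_zeroE)
  with 0 show ?case by simp
next
  case (Suc n)
  then obtain z where z: "poly P z = 0" using alg_closed by fastforce
  then obtain Q where P: "P = [:- z, 1:] * Q" by (meson dvdE poly_eq_0_iff_dvd)
  have Q: "Q \<noteq> 0" using P Suc.prems by auto
  have ord: "order x P = order x [:- z, 1:] + order x Q" for x
    using order_mult[of "[:- z, 1:]" Q x] Suc.prems(1) unfolding P by blast
  have "order z [:- z, 1:] \<ge> 1"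
    using order_root[of "[:- z, 1:]" z] by simp
  then have "poly Q z \<noteq> 0"
    using Suc.prems(2)[of z] ord[of z] Q order_root[of Q z] by linarith
  moreover have "{x. poly P x = 0} = insert z {x. poly Q x = 0}" by (auto simp: P)
  moreover have "degree P = Suc (degree Q)" unfolding P using degree_mult_eq[OF _ Q, of "[:- z, 1:]"] by simp
  moreover have "card {x. poly Q x = 0} = degree Q"
  proof (rule Suc.hyps(1))
    show "n = degree Q" using Suc.hyps(2) calculation(3) by simp
    show "order x Q \<le> 1" for x using Suc.prems(2)[of x] ord[of x] by linarith
  qed fact
  ultimately show ?case using Q by (simp add: poly_roots_finite)
qed

locale closed_pvaluation = pvaluation p v for p and v :: "'a::field \<Rightarrow> real" +
  assumes alg_closed: "degree P > 0 \<Longrightarrow> \<exists>z::'a. poly P z = 0"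
begin

text \<open>At a double root z of T^q - T the derivative would give q z^(q-1) = 1, but z is integral
  and q lies in the maximal ideal. The exact count matters: q points force a polynomial of degree
  below q to vanish modulo the maximal ideal.\<close>

lemma card_teich: assumes n: "n > 0" shows "card (teich n) = p ^ n" "finite (teich n)"
proof -
  let ?q = "p ^ n"
  let ?P = "monom 1 ?q - monom 1 1 :: 'a poly"
  have q: "?q > 1" by (rule p_power_gt_1[OF n])
  have deg: "degree ?P = ?q"
    using q degree_add_eq_left[of "- monom 1 1" "monom 1 ?q :: 'a poly"] by (simp add: degree_monom_eq)
  then have P0: "?P \<noteq> 0" using q by (metis degree_0 not_less0)
  have T: "teich n = {z. poly ?P z = 0}" by (simp add: teich_def poly_monom)
  have "order z ?P \<le> 1" for z
  proof (rule ccontr)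
    assume "\<not> order z ?P \<le> 1"
    then have "2 \<le> order z ?P" by simp
    then have "[:- z, 1:] ^ 2 dvd ?P" using P0 by (simp add: order_divides)
    then obtain R where R: "?P = [:- z, 1:] ^ 2 * R" by (elim dvdE)
    have "poly ?P z = 0" unfolding R by simp
    then have z: "z \<in> teich n" by (simp add: T)
    have "poly (pderiv ?P) z = 0" unfolding R power2_eq_square by (simp add: pderiv_mult pderiv_pCons del: mult_pCons_left)
    then have "of_nat ?q * z ^ (?q - 1) = 1"
      by (simp add: pderiv_diff pderiv_monom poly_monom)
    moreover have "of_nat ?q * z ^ (?q - 1) \<in> \<M>"
      using teich_integral[OF n z] p_power_in_M[OF n]
      by (intro ideal_mult2[OF ideal_M] subring_power[OF subring_O])
    ultimately show False by simp
  qed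
  then show "card (teich n) = p ^ n"
    using card_roots_of_simple_roots[OF alg_closed P0] deg by (simp add: T)
  show "finite (teich n)" unfolding T using P0 by (rule poly_roots_finite)
qed

end

section \<open>Residue-compatible correspondences between two valued fields\<close>

locale valuation_pair = A: pvaluation p w + K: closed_pvaluation p v
  for p and w :: "'a::field \<Rightarrow> real" and v :: "'k::field \<Rightarrow> real" +
  assumes w_Ints: "x \<noteq> 0 \<Longrightarrow> w x \<in> \<int>"
begin

text \<open>The algebraic residue of the second component is what later turns one implication
  between the maximal ideals into both: a unit x of this kind has x^(q-1) congruent to 1 for some
  q.\<close>

definition compatible :: "('a \<times> 'k) set \<Rightarrow> bool" where
  "compatible G \<longleftrightarrow> is_subring G \<and>
     (\<forall>z\<in>G. fst z \<in> A.\<O> \<and> snd z \<in> K.alg_res \<and> (fst z \<in> A.\<M> \<longleftrightarrow> snd z \<in> K.\<M>))"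

lemma compatibleD:
  assumes "compatible G"
  shows "is_subring G" "z \<in> G \<Longrightarrow> fst z \<in> A.\<O>" "z \<in> G \<Longrightarrow> snd z \<in> K.alg_res"
    "z \<in> G \<Longrightarrow> snd z \<in> K.\<O>" "z \<in> G \<Longrightarrow> fst z \<in> A.\<M> \<longleftrightarrow> snd z \<in> K.\<M>"
  using assms K.alg_res_integral unfolding compatible_def by blast+

text \<open>Division by Y^q - Y, one Horner step at a time: the coefficient \<open>l\<close> that
  multiplication by Y moves to Y^q is moved on to Y, which changes nothing where f^q is congruent to
  f and c^q = c. The order of the quantifiers is essential, since one R has to serve all
  Teichmueller points c.\<close>

lemma reduce_exponents:
  assumes G: "compatible G" and q: "q \<ge> 2" and F: "F \<in> polys_over G"
  shows "\<exists>R\<in>polys_over G. degree R < q \<and>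
    (\<forall>f\<in>A.\<O>. \<forall>c. f ^ q - f \<in> A.\<M> \<longrightarrow> c ^ q = c \<longrightarrow>
      fst (poly F (f, c)) - fst (poly R (f, c)) \<in> A.\<M> \<and>
      snd (poly F (f, c)) = snd (poly R (f, c)))"
  using F
proof (induction F)
  case 0
  then show ?case using q by (intro bexI[of _ 0]) auto
next
  case (pCons a F)
  note S = compatibleD(1)[OF G] and SP = subring_polys_over[OF compatibleD(1)[OF G]]
  from pCons obtain R where R: "R \<in> polys_over G" "degree R < q" and
    close: "\<And>f c. f \<in> A.\<O> \<Longrightarrow> f ^ q - f \<in> A.\<M> \<Longrightarrow> c ^ q = c \<Longrightarrow>
      fst (poly F (f, c)) - fst (poly R (f, c)) \<in> A.\<M> \<and> snd (poly F (f, c)) = snd (poly R (f, c))"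
    by auto
  define l where "l = coeff R (q - 1)"
  have l: "l \<in> G" using R by (simp add: l_def polys_over_def)
  define R' where "R' = pCons a R - monom l q + monom l 1"
  have mon: "monom l n \<in> polys_over G" for n
    using l by (auto simp: polys_over_def subring_zero[OF S])
  have "R' \<in> polys_over G"
    unfolding R'_def using pCons.prems R mon
    by (intro subring_add[OF SP] subring_diff[OF SP]) auto
  moreover have "degree R' < q"
  proof -
    have "coeff R' i = 0" if i: "i > q - 1" for i
    proof -
      obtain j where j: "i = Suc j" "j \<ge> q - 1" using i by (cases i) auto
      have "coeff R j = 0" if "j \<noteq> q - 1" using that j R(2) by (intro coeff_eq_0) linarith
      then show ?thesis using j q by (auto simp: R'_def l_def)
    qed
    then have "degree R' \<le> q - 1" by (intro degree_le) auto
    then show ?thesis using q by linarith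
  qed
  moreover have "fst (poly (pCons a F) (f, c)) - fst (poly R' (f, c)) \<in> A.\<M> \<and>
      snd (poly (pCons a F) (f, c)) = snd (poly R' (f, c))"
    if f: "f \<in> A.\<O>" "f ^ q - f \<in> A.\<M>" and c: "c ^ q = c" for f c
  proof
    have "fst (poly (pCons a F) (f, c)) - fst (poly R' (f, c)) =
      f * (fst (poly F (f, c)) - fst (poly R (f, c))) + fst l * (f ^ q - f)"
      by (simp add: R'_def poly_monom algebra_simps)
    also have "\<dots> \<in> A.\<M>"
      using close[OF f c] f compatibleD(2)[OF G l]
      by (intro A.vgt_add ideal_mult[OF A.ideal_M]) auto
    finally show "fst (poly (pCons a F) (f, c)) - fst (poly R' (f, c)) \<in> A.\<M>" .
    show "snd (poly (pCons a F) (f, c)) = snd (poly R' (f, c))"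
      using close[OF f c] c by (simp add: R'_def poly_monom algebra_simps)
  qed
  ultimately show ?case by blast
qed

lemma fst_poly_integral:
  "compatible G \<Longrightarrow> F \<in> polys_over G \<Longrightarrow> f \<in> A.\<O> \<Longrightarrow> fst (poly F (f, c)) \<in> A.\<O>"
  unfolding fst_poly
  by (rule poly_in_subring[OF A.subring_O])
    (auto simp: polys_over_def coeff_map_poly compatibleD)

lemma snd_poly_alg_res:
  "compatible G \<Longrightarrow> F \<in> polys_over G \<Longrightarrow> c \<in> K.alg_res \<Longrightarrow> snd (poly F (f, c)) \<in> K.alg_res"
  unfolding snd_poly
  by (rule poly_in_subring[OF K.subring_alg_res])
    (auto simp: polys_over_def coeff_map_poly compatibleD)

text \<open>If every candidate image \<open>c\<close> of \<open>f\<close> failed, the product of the witnesses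
  would be a polynomial that vanishes modulo the maximal ideal at all \<open>q\<close> Teichmueller points but
  not at \<open>f\<close>; modulo \<open>Y\<^sup>q - Y\<close> it has fewer than \<open>q\<close> coefficients, so it is zero.\<close>
lemma choose_residue:
  assumes G: "compatible G" and n: "n > 0" and f: "f \<in> A.alg_res_n n"
  shows "\<exists>c\<in>K.teich n. \<forall>F\<in>polys_over G. snd (poly F (f, c)) \<in> K.\<M> \<longrightarrow> fst (poly F (f, c)) \<in> A.\<M>"
proof (rule ccontr)
  let ?q = "p ^ n"
  assume "\<not> ?thesis"
  then obtain W where W: "\<And>c. c \<in> K.teich n \<Longrightarrow> W c \<in> polys_over G"
      "\<And>c. c \<in> K.teich n \<Longrightarrow> snd (poly (W c) (f, c)) \<in> K.\<M>"
      "\<And>c. c \<in> K.teich n \<Longrightarrow> fst (poly (W c) (f, c)) \<notin> A.\<M>"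
    by metis
  have f': "f \<in> A.\<O>" "f ^ ?q - f \<in> A.\<M>" using f by (auto simp: frob_fixed_def)
  have TA: "K.teich n \<subseteq> K.alg_res"
    using K.teich_alg_res_n[OF n] K.alg_res_n_subset[OF n] by auto
  define F where "F = (\<Prod>c\<in>K.teich n. W c)"
  have fin: "finite (K.teich n)" by (rule K.card_teich[OF n])
  have F: "F \<in> polys_over G"
    unfolding F_def by (intro subring_prod subring_polys_over compatibleD G W)
  have fst_F: "fst (poly F (f, d)) \<notin> A.\<M>" for d
  proof -
    have "fst (poly F (f, d)) = (\<Prod>c\<in>K.teich n. fst (poly (W c) (f, c)))"
      unfolding F_def by (induction rule: finite_induct[OF fin]) (simp_all add: fst_poly)
    moreover have "\<dots> \<in> A.\<O> - A.\<M>"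
      using W f' by (intro A.prod_notin_M) (auto intro: fst_poly_integral[OF G])
    ultimately show ?thesis by simp
  qed
  have snd_F: "snd (poly F (f, c)) \<in> K.\<M>" if c: "c \<in> K.teich n" for c
  proof -
    have "F = W c * (\<Prod>d\<in>K.teich n - {c}. W d)"
      unfolding F_def using fin c by (simp add: prod.remove)
    moreover have "(\<Prod>d\<in>K.teich n - {c}. W d) \<in> polys_over G"
      using W by (intro subring_prod subring_polys_over compatibleD(1)[OF G]) auto
    then have "snd (poly (\<Prod>d\<in>K.teich n - {c}. W d) (f, c)) \<in> K.\<O>"
      using K.alg_res_integral snd_poly_alg_res[OF G] c TA by blast
    ultimately show ?thesis using W(2)[OF c] ideal_mult2[OF K.ideal_M] by simp
  qed
  have "?q \<ge> 2" using A.p_power_gt_1[OF n] by simp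
  from reduce_exponents[OF G this F] obtain R where R: "R \<in> polys_over G" "degree R < ?q"
    and close: "\<And>c. c \<in> K.teich n \<Longrightarrow> fst (poly F (f, c)) - fst (poly R (f, c)) \<in> A.\<M> \<and>
      snd (poly F (f, c)) = snd (poly R (f, c))"
    using f' by (auto simp: K.teich_def)
  have "map_poly snd R \<in> polys_over K.\<M>"
  proof (rule K.coeffs_in_M_of_many_roots[OF fin])
    show "K.teich n \<subseteq> K.\<O>" using K.teich_integral[OF n] by auto
    show "c = d" if "c \<in> K.teich n" "d \<in> K.teich n" "c - d \<in> K.\<M>" for c d
      using K.teich_separated[OF n that] .
    show "map_poly snd R \<in> polys_over K.\<O>"
      using R(1) compatibleD(4)[OF G] by (auto simp: polys_over_def coeff_map_poly)
    have "degree (map_poly snd R) \<le> degree R" by (rule map_poly_degree_leq)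
    then show "degree (map_poly snd R) < card (K.teich n)" using R(2) K.card_teich(1)[OF n] by simp
    show "poly (map_poly snd R) c \<in> K.\<M>" if "c \<in> K.teich n" for c
      using close[OF that] snd_F[OF that] by (simp add: snd_poly)
  qed
  then have "fst (coeff R i) \<in> A.\<M>" for i
    using compatibleD(5)[OF G, of "coeff R i"] R(1) by (auto simp: polys_over_def coeff_map_poly)
  then have "poly (map_poly fst R) f \<in> A.\<M>"
    unfolding poly_altdef using f'(1)
    by (intro ideal_sum[OF A.ideal_M] ideal_mult2[OF A.ideal_M] subring_power[OF A.subring_O])
      (simp_all add: coeff_map_poly)
  \<comment> \<open>The entry 0 is a placeholder: the first component of the value depends on f
    alone, and 0 is one of the points at which F and R are compared.\<close>
  then have "fst (poly F (f, 0)) \<in> A.\<M>"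
    using close[OF K.zero_in_teich[OF n]] A.vgt_diff_iff by (auto simp: fst_poly)
  then show False using fst_F by blast
qed

section \<open>Enlarging a compatible ring, and a maximal one\<close>

definition adjoin :: "('a \<times> 'k) set \<Rightarrow> 'a \<times> 'k \<Rightarrow> ('a \<times> 'k) set" where
  "adjoin G z = (\<lambda>F. poly F z) ` polys_over G"

text \<open>The choice of c supplies only one implication. For the other, suppose that the second
  component x of F at (f, c) is a unit while the first lies in the maximal ideal. With x^q congruent
  to x, the polynomial H = F^(q-1) - 1 has second component in the maximal ideal, hence also its
  first; but that first component is congruent to -1.\<close>

lemma adjoin_compatible:
  assumes G: "compatible G" and n: "n > 0" and f: "f \<in> A.alg_res_n n"
  shows "\<exists>c\<in>K.teich n. compatible (adjoin G (f, c))"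
proof -
  obtain c where c: "c \<in> K.teich n" and
    *: "\<And>F. F \<in> polys_over G \<Longrightarrow> snd (poly F (f, c)) \<in> K.\<M> \<Longrightarrow> fst (poly F (f, c)) \<in> A.\<M>"
    using choose_residue[OF G n f] by blast
  have f': "f \<in> A.\<O>" using f by (auto simp: frob_fixed_def)
  have cA: "c \<in> K.alg_res" using K.teich_alg_res_n[OF n c] K.alg_res_n_subset[OF n] by auto
  note SP = subring_polys_over[OF compatibleD(1)[OF G]]
  have bwd: "snd (poly F (f, c)) \<in> K.\<M>"
    if F: "F \<in> polys_over G" and F0: "fst (poly F (f, c)) \<in> A.\<M>" for F
  proof (rule ccontr)
    let ?x = "snd (poly F (f, c))"
    assume x: "?x \<notin> K.\<M>"
    have "?x \<in> K.alg_res" by (rule snd_poly_alg_res[OF G F cA])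
    then obtain k where k: "k > 0" "?x \<in> K.\<O>" "?x ^ (p ^ k) - ?x \<in> K.\<M>"
      by (auto simp: frob_alg_def frob_fixed_def)
    define H where "H = F ^ (p ^ k - 1) - 1"
    have Suc: "p ^ k = Suc (p ^ k - 1)" "p ^ k - 1 > 0" using A.p_power_gt_1[OF k(1)] by auto
    have "?x * snd (poly H (f, c)) = ?x ^ (p ^ k) - ?x"
      by (subst Suc(1)) (simp add: H_def algebra_simps del: Suc_pred)
    then have "?x * snd (poly H (f, c)) \<in> K.\<M>" using k by (simp only:)
    then have "snd (poly H (f, c)) \<in> K.\<M>" using x k(2) K.unit_mult_vgt[of ?x] by blast
    moreover have H: "H \<in> polys_over G"
      unfolding H_def using F by (intro subring_diff[OF SP] subring_power[OF SP] subring_one[OF SP])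
    ultimately have "fst (poly H (f, c)) \<in> A.\<M>" using * by blast
    moreover have "fst (poly F (f, c)) ^ (p ^ k - 1) \<in> A.\<M>"
      using A.power_in_M[OF fst_poly_integral[OF G F f'] Suc(2)] F0 by blast
    ultimately show False
      using A.vgt_diff[of "fst (poly F (f, c)) ^ (p ^ k - 1)" 0 "fst (poly H (f, c))"]
      by (simp add: H_def)
  qed
  have "compatible (adjoin G (f, c))"
    unfolding compatible_def
  proof (intro conjI ballI)
    show "is_subring (adjoin G (f, c))"
    proof (rule is_subringI)
      show "1 \<in> adjoin G (f, c)"
        unfolding adjoin_def using subring_one[OF SP] by (intro image_eqI[of _ _ 1]) auto
      fix x assume "x \<in> adjoin G (f, c)"
      then obtain F where F: "F \<in> polys_over G" "x = poly F (f, c)" by (auto simp: adjoin_def)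
      show "- x \<in> adjoin G (f, c)"
        unfolding adjoin_def using F subring_uminus[OF SP] by (intro image_eqI[of _ _ "- F"]) auto
      fix y assume "y \<in> adjoin G (f, c)"
      then obtain H where H: "H \<in> polys_over G" "y = poly H (f, c)" by (auto simp: adjoin_def)
      show "x + y \<in> adjoin G (f, c)"
        unfolding adjoin_def using F H subring_add[OF SP] by (intro image_eqI[of _ _ "F + H"]) auto
      show "x * y \<in> adjoin G (f, c)"
        unfolding adjoin_def using F H subring_mult[OF SP] by (intro image_eqI[of _ _ "F * H"]) auto
    qed
    fix z assume "z \<in> adjoin G (f, c)"
    then obtain F where F: "F \<in> polys_over G" "z = poly F (f, c)" by (auto simp: adjoin_def)
    show "fst z \<in> A.\<O>" using F fst_poly_integral[OF G _ f'] by blast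
    show "snd z \<in> K.alg_res" using F snd_poly_alg_res[OF G _ cA] by blast
    show "fst z \<in> A.\<M> \<longleftrightarrow> snd z \<in> K.\<M>" using F * bwd by blast
  qed
  with c show ?thesis by blast
qed

lemma adjoin_superset: "compatible G \<Longrightarrow> G \<subseteq> adjoin G z" "compatible G \<Longrightarrow> z \<in> adjoin G z"
proof -
  assume G: "compatible G"
  note S = compatibleD(1)[OF G]
  show "G \<subseteq> adjoin G z"
    unfolding adjoin_def using zero_polys_over[OF S]
    by (auto intro!: image_eqI[of _ _ "[:_:]"])
  show "z \<in> adjoin G z"
    unfolding adjoin_def using zero_polys_over[OF S] subring_zero[OF S] subring_one[OF S]
    by (intro image_eqI[of _ _ "[:0, 1:]"]) auto
qed

text \<open>The starting point for Zorn's lemma: both residue fields contain the same prime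
  field.\<close>

lemma compatible_range_of_int: "compatible (range of_int)"
  unfolding compatible_def
proof (intro conjI ballI)
  show "is_subring (range of_int :: ('a \<times> 'k) set)"
  proof (rule is_subringI)
    show "1 \<in> (range of_int :: ('a \<times> 'k) set)" by (metis of_int_1 rangeI)
  qed (auto simp flip: of_int_add of_int_mult of_int_minus)
  fix z :: "'a \<times> 'k" assume "z \<in> range of_int"
  then obtain m where m: "z = of_int m" by blast
  show "fst z \<in> A.\<O>" using subring_of_int[OF A.subring_O] m by simp
  show "snd z \<in> K.alg_res" using subring_of_int[OF K.subring_alg_res] m by simp
  show "fst z \<in> A.\<M> \<longleftrightarrow> snd z \<in> K.\<M>" using A.of_int_in_M K.of_int_in_M m by simp
qed

text \<open>A maximal ring absorbs every adjunction. The partner of f is moreover an exact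
  Teichmueller representative rather than a mere element of the right residue class; the digits of
  the generator are such partners.\<close>

lemma exists_maximal_compatible:
  "\<exists>G. compatible G \<and> (\<forall>n>0. \<forall>f\<in>A.alg_res_n n. \<exists>c\<in>K.teich n. (f, c) \<in> G)"
proof -
  have "\<exists>G\<in>Collect compatible. \<forall>H\<in>Collect compatible. G \<subseteq> H \<longrightarrow> H = G"
  proof (rule subset_Zorn_nonempty)
    show "Collect compatible \<noteq> {}" using compatible_range_of_int by blast
    fix \<C> assume ne: "\<C> \<noteq> {}" and "subset.chain (Collect compatible) \<C>"
    then have C: "\<And>X. X \<in> \<C> \<Longrightarrow> compatible X" "\<And>X Y. X \<in> \<C> \<Longrightarrow> Y \<in> \<C> \<Longrightarrow> X \<subseteq> Y \<or> Y \<subseteq> X"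
      by (auto simp: subset_chain_def)
    have "is_subring (\<Union>\<C>)"
    proof (rule is_subringI)
      show "1 \<in> \<Union>\<C>" using ne C(1) compatibleD(1) subring_one by blast
      fix x assume "x \<in> \<Union>\<C>"
      then obtain X where X: "X \<in> \<C>" "x \<in> X" by blast
      then show "- x \<in> \<Union>\<C>" using C(1) compatibleD(1) subring_uminus by blast
      fix y assume "y \<in> \<Union>\<C>"
      then obtain Y where Y: "Y \<in> \<C>" "y \<in> Y" by blast
      obtain Z where Z: "Z \<in> \<C>" "x \<in> Z" "y \<in> Z" using C(2)[OF X(1) Y(1)] X Y by blast
      note SZ = compatibleD(1)[OF C(1)[OF Z(1)]]
      show "x + y \<in> \<Union>\<C>" "x * y \<in> \<Union>\<C>"
        using Z subring_add[OF SZ Z(2,3)] subring_mult[OF SZ Z(2,3)] by blast+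
    qed
    moreover have "\<forall>z\<in>\<Union>\<C>. fst z \<in> A.\<O> \<and> snd z \<in> K.alg_res \<and> (fst z \<in> A.\<M> \<longleftrightarrow> snd z \<in> K.\<M>)"
      using C(1) unfolding compatible_def by blast
    ultimately show "\<Union>\<C> \<in> Collect compatible" by (simp add: compatible_def)
  qed
  then obtain G where G: "compatible G" "\<And>H. compatible H \<Longrightarrow> G \<subseteq> H \<Longrightarrow> H = G" by auto
  have "\<exists>c\<in>K.teich n. (f, c) \<in> G" if nf: "n > 0" "f \<in> A.alg_res_n n" for n f
  proof -
    obtain c where c: "c \<in> K.teich n" "compatible (adjoin G (f, c))"
      using adjoin_compatible[OF G(1) nf] by blast
    then have "adjoin G (f, c) = G" using G adjoin_superset(1) by blast
    then show ?thesis using c(1) adjoin_superset(2)[OF G(1), of "(f, c)"] by auto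
  qed
  with G(1) show ?thesis by blast
qed

end

section \<open>Isometric lifting of unramified elements\<close>

locale residue_matching = valuation_pair p w v
  for p and w :: "'a::field \<Rightarrow> real" and v :: "'k::field \<Rightarrow> real" +
  fixes G :: "('a \<times> 'k) set"
  assumes compatible_G: "compatible G"
    and total_G: "n > 0 \<Longrightarrow> f \<in> A.alg_res_n n \<Longrightarrow> \<exists>c\<in>K.teich n. (f, c) \<in> G"
begin

lemmas subring_G = compatibleD(1)[OF compatible_G]
lemmas fst_G = compatibleD(2)[OF compatible_G]
lemmas snd_G = compatibleD(4)[OF compatible_G]
lemmas G_in_M_iff = compatibleD(5)[OF compatible_G]

text \<open>The partner of e is a Teichmueller representative in the maximal ideal, and 0 is the
  only one. Hence a first component may move within its residue class while the second stays
  fixed.\<close>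

lemma M_times_zero_in_G: assumes "e \<in> A.\<M>" shows "(e, 0) \<in> G"
proof -
  obtain c where c: "c \<in> K.teich 1" "(e, c) \<in> G"
    using total_G[of 1 e] A.M_alg_res_n[OF _ assms] by auto
  then have "c \<in> K.\<M>" using G_in_M_iff[OF c(2)] assms by simp
  then have "c = 0" using K.teich_separated[of 1 c 0] c K.zero_in_teich[of 1] by simp
  with c show ?thesis by simp
qed

lemma fst_alg_res: assumes z: "z \<in> G" shows "fst z \<in> A.alg_res"
proof -
  obtain n where n: "n > 0" "snd z ^ (p ^ n) - snd z \<in> K.\<M>"
    using compatibleD(3)[OF compatible_G z] by (auto simp: frob_alg_def frob_fixed_def)
  have "z ^ (p ^ n) - z \<in> G" by (intro subring_diff[OF subring_G] subring_power[OF subring_G] z)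
  then have "fst z ^ (p ^ n) - fst z \<in> A.\<M>" using G_in_M_iff n by fastforce
  then show ?thesis using n fst_G[OF z] by (auto simp: frob_alg_def frob_fixed_def)
qed

text \<open>Here the absence of ramification is used: values are integers and p has value 1, so the
  maximal ideal is generated by p.\<close>

lemma w_gt_0_imp_ge_1: "x \<in> A.\<M> \<longleftrightarrow> x \<in> A.vge 1"
proof (cases "x = 0")
  case False
  then obtain k where "w x = of_int k" using w_Ints by (auto elim: Ints_cases)
  then show ?thesis using False by (auto simp: A.vgt_def A.vge_def)
qed simp

text \<open>\<open>lifts M\<close> relates an integral combination of roots of unity in the second field to its lift,
  determined modulo \<open>p\<^sup>M\<close>, to the (incomplete) first field.\<close>

definition lifts :: "nat \<Rightarrow> ('a \<times> 'k) set" where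
  "lifts M = gen_ring {(f, t) | f t. (f, t) \<in> G \<and>
     (\<exists>n>0. t \<in> K.teich n \<and> f ^ (p ^ n) - f \<in> A.vge (real M))}"

lemma subring_lifts: "is_subring (lifts M)"
  unfolding lifts_def by (rule subring_gen_ring)

lemma lifts_subset_G: "lifts M \<subseteq> G"
  unfolding lifts_def by (rule gen_ring_subset[OF subring_G]) auto

lemma lifts_antimono: "M \<le> N \<Longrightarrow> lifts N \<subseteq> lifts M"
  unfolding lifts_def[of N]
proof (rule gen_ring_subset[OF subring_lifts], safe)
  fix f t n
  assume MN: "M \<le> N" and f: "f ^ (p ^ n) - f \<in> A.vge (real N)"
    and *: "(f, t) \<in> G" "0 < n" "t \<in> K.teich n"
  have "f ^ (p ^ n) - f \<in> A.vge (real M)" using MN by (intro A.vge_mono[OF f]) simp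
  with * show "(f, t) \<in> lifts M"
    unfolding lifts_def by (intro gen_ring.gen) blast
qed

text \<open>Up to precision M such an e is an approximate Teichmueller lift of 0, because e^p is as
  small as e. These pairs absorb all rounding errors.\<close>

lemma small_in_lifts: assumes M: "M \<ge> 1" and e: "e \<in> A.vge (real M)" shows "(e, 0) \<in> lifts M"
proof -
  have eM: "e \<in> A.\<M>" using A.vge_imp_vgt[OF e] M by simp
  have "e * e ^ (p - 1) \<in> A.vge (real M)"
    using e A.vgt_imp_vge[OF eM] by (intro ideal_mult2[OF A.ideal_vge] subring_power[OF A.subring_O]) auto
  moreover have "e * e ^ (p - 1) = e ^ p"
    using A.prime_p by (metis power_eq_if prime_gt_0_nat less_numeral_extra(3))
  ultimately have "e ^ (p ^ 1) - e \<in> A.vge (real M)" using e A.vge_diff by simp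
  then show ?thesis unfolding lifts_def
    using M_times_zero_in_G[OF eM] K.zero_in_teich[of 1] by (intro gen_ring.gen) auto
qed

text \<open>The multiples of p, enlarged by the rounding errors. The error is kept apart because (e,
  0) is not known to be p times a member of \<open>lifts M\<close>; it affects only the first
  component, so division by p is exact in the second.\<close>

definition small :: "nat \<Rightarrow> ('a \<times> 'k) set" where
  "small M = {of_nat p * z + (e, 0) | z e. z \<in> lifts M \<and> e \<in> A.vge (real M)}"

lemma ideal_small: assumes M: "M \<ge> 1" shows "is_ideal_in (lifts M) (small M)"
  unfolding is_ideal_in_def
proof (intro conjI ballI subsetI)
  note S = subring_lifts[of M]
  show "x \<in> lifts M" if "x \<in> small M" for x
    using that small_in_lifts[OF M]
    by (auto simp: small_def intro!: subring_add[OF S] subring_mult[OF S] subring_of_nat[OF S])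
  show "0 \<in> small M"
    unfolding small_def by (rule CollectI, rule exI[of _ 0], rule exI[of _ 0])
      (auto simp: prod_eq_iff subring_zero[OF S])
  fix x y assume "x \<in> small M"
  then obtain z e where x: "x = of_nat p * z + (e, 0)" "z \<in> lifts M" "e \<in> A.vge (real M)"
    by (auto simp: small_def)
  show "x + y \<in> small M" if "y \<in> small M"
  proof -
    from that obtain z' e' where y: "y = of_nat p * z' + (e', 0)" "z' \<in> lifts M" "e' \<in> A.vge (real M)"
      by (auto simp: small_def)
    show ?thesis unfolding small_def
      by (rule CollectI, rule exI[of _ "z + z'"], rule exI[of _ "e + e'"])
        (use x y in \<open>auto simp: prod_eq_iff algebra_simps intro: subring_add[OF S] A.vge_add\<close>)
  qed
  show "s * x \<in> small M" if s: "s \<in> lifts M" for s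
  proof -
    have "fst s * e \<in> A.vge (real M)"
      using x(3) fst_G[of s] s lifts_subset_G[of M] by (intro A.vge_integral_mult) auto
    moreover have "s * x = of_nat p * (s * z) + (fst s * e, 0)"
      by (simp add: x(1) prod_eq_iff algebra_simps)
    ultimately show ?thesis using subring_mult[OF S s x(2)] unfolding small_def by blast
  qed
qed

lemma p_in_small: "M \<ge> 1 \<Longrightarrow> of_nat p \<in> small M"
  unfolding small_def by (rule CollectI, rule exI[of _ 1], rule exI[of _ 0])
    (auto simp: prod_eq_iff subring_one[OF subring_lifts])

text \<open>Each generator satisfies z^q = z modulo \<open>small M\<close> by construction, and the
  elements with this property for some q form a ring.\<close>

lemma lifts_frobenius: assumes M: "M \<ge> 1" shows "lifts M \<subseteq> frob_alg p (lifts M) (small M)"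
proof -
  have "gen_ring {(f, t) | f t. (f, t) \<in> G \<and>
     (\<exists>n>0. t \<in> K.teich n \<and> f ^ (p ^ n) - f \<in> A.vge (real M))} \<subseteq> frob_alg p (lifts M) (small M)"
  proof (rule gen_ring_subset, goal_cases)
    case 1
    show ?case
      by (rule subring_frob_alg[OF subring_lifts ideal_small[OF M] A.prime_p p_in_small[OF M]])
  next
    case 2
    show ?case
    proof safe
      fix f t n
      assume ft: "(f, t) \<in> G" "0 < n" "t \<in> K.teich n" "f ^ (p ^ n) - f \<in> A.vge (real M)"
      then have "(f, t) \<in> lifts M" unfolding lifts_def by (intro gen_ring.gen) auto
      moreover have "(f, t) ^ (p ^ n) - (f, t) \<in> small M"
        unfolding small_def
        by (rule CollectI, rule exI[of _ 0], rule exI[of _ "f ^ (p ^ n) - f"])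
          (use ft in \<open>auto simp: prod_eq_iff subring_zero[OF subring_lifts] K.teich_def\<close>)
      ultimately show "(f, t) \<in> frob_alg p (lifts M) (small M)"
        using ft(2) by (auto simp: frob_alg_def frob_fixed_def)
    qed
  qed
  then show ?thesis by (simp add: lifts_def)
qed

text \<open>A non-unit \<open>z\<close> satisfies \<open>z (1 - z\<^sup>q\<^sup>-\<^sup>1) = z - z\<^sup>q \<in> p S\<close> with a unit \<open>1 - z\<^sup>q\<^sup>-\<^sup>1\<close>, so that one
  can divide by \<open>p\<close> without leaving the ring, although \<open>p\<close> need not be prime in it.\<close>
lemma divide_by_p:
  assumes M: "M \<ge> 1" and z: "z \<in> lifts M" and zM: "fst z \<in> A.\<M> \<or> snd z \<in> K.\<M>"
  shows "\<exists>s\<in>lifts M. \<exists>y\<in>lifts M. \<exists>e\<in>A.vge (real M). fst s \<in> A.\<M> \<and> snd s \<in> K.\<M> \<and>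
    (1 - s) * z = of_nat p * y + (e, 0)"
proof -
  obtain n where n: "n > 0" "z ^ (p ^ n) - z \<in> small M"
    using lifts_frobenius[OF M] z by (auto simp: frob_alg_def frob_fixed_def)
  note S = subring_lifts[of M]
  have "- (z ^ (p ^ n) - z) \<in> small M" by (rule ideal_uminus[OF S ideal_small[OF M] n(2)])
  then obtain y e where y: "y \<in> lifts M" "e \<in> A.vge (real M)"
    "- (z ^ (p ^ n) - z) = of_nat p * y + (e, 0)"
    by (auto simp: small_def)
  have zM: "fst z \<in> A.\<M>" "snd z \<in> K.\<M>" using zM G_in_M_iff lifts_subset_G z by blast+
  have k: "p ^ n = Suc (p ^ n - 1)" "p ^ n - 1 > 0" using A.p_power_gt_1[OF n(1)] by auto
  have "fst (z ^ (p ^ n - 1)) \<in> A.\<M>" "snd (z ^ (p ^ n - 1)) \<in> K.\<M>"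
    using zM k(2) A.power_in_M[OF A.vgt_imp_vge] K.power_in_M[OF K.vgt_imp_vge] by simp_all
  moreover have "(1 - z ^ (p ^ n - 1)) * z = - (z ^ (p ^ n) - z)"
    by (subst (2) k(1)) (simp add: algebra_simps)
  ultimately show ?thesis using y subring_power[OF S z] by metis
qed

text \<open>A unit multiple of a non-unit z is p y + (e, 0) with y again in \<open>lifts M\<close>.
  The error is invisible up to precision M, so both components lose the same factor p and y takes
  over with k lowered by 1.\<close>

lemma lifts_isometry:
  assumes M: "M \<ge> 1" shows "z \<in> lifts M \<Longrightarrow> k \<le> M \<Longrightarrow> fst z \<in> A.vge (real k) \<longleftrightarrow> snd z \<in> K.vge (real k)"
proof (induction k arbitrary: z)
  case 0
  then show ?case using lifts_subset_G fst_G snd_G by fastforce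
next
  case (Suc k)
  show ?case
  proof (cases "fst z \<in> A.\<M> \<or> snd z \<in> K.\<M>")
    case False
    then show ?thesis
      using A.vge_imp_vgt[of "fst z" "real (Suc k)" 0] K.vge_imp_vgt[of "snd z" "real (Suc k)" 0] by auto
  next
    case True
    then obtain s y e where s: "fst s \<in> A.\<M>" "snd s \<in> K.\<M>" and y: "y \<in> lifts M"
      and e: "e \<in> A.vge (real M)" and eq: "(1 - s) * z = of_nat p * y + (e, 0)"
      using divide_by_p[OF M Suc.prems(1)] by blast
    have e': "e \<in> A.vge (real (Suc k))" using e Suc.prems(2) by (intro A.vge_mono[OF e]) simp
    have 1: "(1 - fst s) * fst z = of_nat p * fst y + e"
      using arg_cong[OF eq, of fst] by simp
    have 2: "(1 - snd s) * snd z = of_nat p * snd y"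
      using arg_cong[OF eq, of snd] by simp
    have "fst z \<in> A.vge (real (Suc k)) \<longleftrightarrow> of_nat p * fst y + e \<in> A.vge (real (Suc k))"
      unfolding 1[symmetric] using A.unit_mult_vge[OF A.one_minus_unit[OF s(1)]] by blast
    also have "\<dots> \<longleftrightarrow> of_nat p * fst y \<in> A.vge (real (Suc k))"
      using A.vge_diff_iff[of "of_nat p * fst y + e" "of_nat p * fst y"] e' by simp
    also have "\<dots> \<longleftrightarrow> fst y \<in> A.vge (real k)"
      using A.p_mult_vge[of _ "real k"] by (simp add: add.commute)
    also have "\<dots> \<longleftrightarrow> snd y \<in> K.vge (real k)" using Suc.IH[OF y] Suc.prems(2) by simp
    also have "\<dots> \<longleftrightarrow> (1 - snd s) * snd z \<in> K.vge (real (Suc k))"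
      unfolding 2 using K.p_mult_vge[of _ "real k"] by (simp add: add.commute)
    also have "\<dots> \<longleftrightarrow> snd z \<in> K.vge (real (Suc k))"
      using K.unit_mult_vge[OF K.one_minus_unit[OF s(2)]] by blast
    finally show ?thesis .
  qed
qed

text \<open>Each exact division by p in the second component lowers the value by 1 until a unit is
  reached. The bound N makes this descent terminate, since values are nonnegative
  throughout.\<close>

lemma v_snd_lifts_aux:
  assumes M: "M \<ge> 1" shows "z \<in> lifts M \<Longrightarrow> snd z \<noteq> 0 \<Longrightarrow> v (snd z) < real N \<Longrightarrow> v (snd z) \<in> \<int>"
proof (induction N arbitrary: z)
  case 0
  then have "snd z \<in> K.\<O>" using lifts_subset_G snd_G by blast
  with 0 show ?case by (auto simp: K.vge_def)
next
  case (Suc N)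
  have zO: "snd z \<in> K.\<O>" using Suc.prems(1) lifts_subset_G snd_G by blast
  show ?case
  proof (cases "snd z \<in> K.\<M>")
    case False
    then have "v (snd z) = 0" using zO K.unit_iff by blast
    then show ?thesis by simp
  next
    case True
    then obtain s y e where s: "snd s \<in> K.\<M>" and y: "y \<in> lifts M"
      and eq: "(1 - s) * z = of_nat p * y + (e, 0)"
      using divide_by_p[OF M Suc.prems(1)] by blast
    have 2: "(1 - snd s) * snd z = of_nat p * snd y"
      using arg_cong[OF eq, of snd] by simp
    have u: "1 - snd s \<noteq> 0" "v (1 - snd s) = 0" using K.one_minus_unit[OF s] K.unit_iff by blast+
    have y0: "snd y \<noteq> 0" using 2 u Suc.prems(2) by auto
    have "v (snd z) = 1 + v (snd y)"
      using arg_cong[OF 2, of v] u y0 Suc.prems(2) by (simp add: K.v_mult K.v_p)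
    moreover have "v (snd y) \<in> \<int>" using Suc.IH[OF y y0] Suc.prems(3) calculation by simp
    ultimately show ?thesis by simp
  qed
qed

lemma v_snd_lifts: "M \<ge> 1 \<Longrightarrow> z \<in> lifts M \<Longrightarrow> snd z \<noteq> 0 \<Longrightarrow> v (snd z) \<in> \<int>"
  using v_snd_lifts_aux reals_Archimedean2 by blast

text \<open>Dividing k times by p stays in \<open>lifts M\<close> up to factors congruent to 1 and
  rounding errors. Strictness in k < M matters: after the division an error of size p^M must still
  lie in the maximal ideal.\<close>

lemma lifts_quotient_alg_res_aux:
  assumes M: "M \<ge> 1" 
  shows "z \<in> lifts M \<Longrightarrow> k < M \<Longrightarrow> fst z \<in> A.vge (real k) \<Longrightarrow>
    \<exists>y\<in>lifts M. fst z / of_nat p ^ k - fst y \<in> A.\<M>"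
proof (induction k arbitrary: z)
  case 0
  then show ?case by (intro bexI[of _ z]) auto
next
  case (Suc k)
  have "fst z \<in> A.\<M>" using A.vge_imp_vgt[OF Suc.prems(3), of 0] by simp
  then obtain s y e where s: "fst s \<in> A.\<M>" and y: "y \<in> lifts M"
    and e: "e \<in> A.vge (real M)" and eq: "(1 - s) * z = of_nat p * y + (e, 0)"
    using divide_by_p[OF M Suc.prems(1)] by blast
  have 1: "(1 - fst s) * fst z = of_nat p * fst y + e"
    using arg_cong[OF eq, of fst] by simp
  have e': "e \<in> A.vge (real (Suc k))" using Suc.prems(2) by (intro A.vge_mono[OF e]) simp
  have "(1 - fst s) * fst z \<in> A.vge (real (Suc k))"
    using A.unit_mult_vge[OF A.one_minus_unit[OF s]] Suc.prems(3) by blast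
  then have "of_nat p * fst y \<in> A.vge (real (Suc k))"
    unfolding 1 using A.vge_diff_iff[of "of_nat p * fst y + e" "of_nat p * fst y"] e' by simp
  then have "fst y \<in> A.vge (real k)" using A.p_mult_vge[of _ "real k"] by (simp add: add.commute)
  then obtain y' where y': "y' \<in> lifts M" "fst y / of_nat p ^ k - fst y' \<in> A.\<M>"
    using Suc.IH[OF y] Suc.prems(2) by auto
  have zk: "fst z / of_nat p ^ Suc k \<in> A.\<O>"
    using Suc.prems(3) A.div_p_vge[of "fst z" "Suc k" 0] by simp
  have ek: "e / of_nat p ^ Suc k \<in> A.\<M>"
    using A.vge_imp_vgt[OF e, of "real (Suc k)"] Suc.prems(2) A.div_p_vgt[of e "Suc k" 0] by simp
  have "fst z / of_nat p ^ Suc k - fst y' =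
    (fst z / of_nat p ^ Suc k) * fst s + e / of_nat p ^ Suc k + (fst y / of_nat p ^ k - fst y')"
  proof -
    have "fst z = fst z * fst s + of_nat p * fst y + e" using 1 by (simp add: algebra_simps)
    then have "fst z / of_nat p ^ Suc k = (fst z * fst s + of_nat p * fst y + e) / of_nat p ^ Suc k"
      by simp
    also have "\<dots> = (fst z / of_nat p ^ Suc k) * fst s + fst y / of_nat p ^ k + e / of_nat p ^ Suc k"
      by (simp add: add_divide_distrib)
    finally show ?thesis by (simp only: algebra_simps)
  qed
  also have "\<dots> \<in> A.\<M>"
    using zk s ek y'(2) by (intro A.vgt_add ideal_mult[OF A.ideal_M])
  finally show ?case using y'(1) by blast
qed

lemma lifts_quotient_alg_res:
  assumes "z \<in> lifts M" "k < M" "fst z \<in> A.vge (real k)"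
  shows "fst z / of_nat p ^ k \<in> A.alg_res"
proof -
  obtain y where y: "y \<in> lifts M" "fst z / of_nat p ^ k - fst y \<in> A.\<M>"
    using lifts_quotient_alg_res_aux[of M z k] assms by auto
  have "fst y + (fst z / of_nat p ^ k - fst y) \<in> A.alg_res"
    using y lifts_subset_G by (intro subring_add[OF A.subring_alg_res] fst_alg_res A.M_alg_res) auto
  then show ?thesis by simp
qed

section \<open>Algebraic residues are closed under algebraic equations\<close>

text \<open>Frobenius is injective on residues. Taking out p^i-th roots turns the congruence of two
  iterates into x being congruent to its power with exponent p^(j-i).\<close>

lemma frobenius_iterate_close:
  assumes x: "x \<in> A.\<O>" and ij: "i < j" and eq: "x ^ (p ^ i) - x ^ (p ^ j) \<in> A.\<M>"
  shows "x \<in> A.alg_res"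
proof -
  let ?y = "x ^ (p ^ (j - i))"
  have y: "?y \<in> A.\<O>" by (rule subring_power[OF A.subring_O x])
  have "((x - ?y) + ?y) ^ (p ^ i) - (x - ?y) ^ (p ^ i) - ?y ^ (p ^ i) \<in> A.\<M>"
    using x y by (intro frobenius_add[OF A.subring_O A.ideal_M A.prime_p A.p_in_M] A.vge_diff)
  moreover have "?y ^ (p ^ i) = x ^ (p ^ j)"
    using ij by (simp flip: power_mult power_add)
  ultimately have "(x ^ (p ^ i) - x ^ (p ^ j)) - (x - ?y) ^ (p ^ i) \<in> A.\<M>"
    by (simp add: algebra_simps)
  then have "(x - ?y) ^ (p ^ i) \<in> A.\<M>" using A.vgt_diff_iff eq by blast
  then have "x - ?y \<in> A.\<M>"
    using A.power_in_M[OF A.vge_diff[OF x y]] A.prime_p prime_gt_0_nat by auto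
  then have "x \<in> A.alg_res_n (j - i)" using x by (simp add: frob_fixed_def A.vgt_minus_commute)
  then show ?thesis using A.alg_res_n_subset[of "j - i"] ij by auto
qed

text \<open>By the equation every power of y reduces to a combination of the powers below d with
  coefficients in one fixed finite field; two Frobenius iterates of y therefore coincide modulo the
  maximal ideal.\<close>

lemma alg_res_of_monic_equation:
  assumes y: "y \<in> A.\<O>" and n: "n > 0" and c: "\<And>i. i < d \<Longrightarrow> c i \<in> A.alg_res_n n"
    and eq: "y ^ d - (\<Sum>i<d. c i * y ^ i) \<in> A.\<M>"
  shows "y \<in> A.alg_res"
proof -
  note R = A.subring_alg_res_n[OF n]
  have cO: "b \<in> A.\<O>" if "b \<in> A.alg_res_n n" for b using that by (simp add: frob_fixed_def)
  have "\<exists>b. (\<forall>i. b i \<in> A.alg_res_n n) \<and> y ^ j - (\<Sum>i<d. b i * y ^ i) \<in> A.\<M>" for j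
  proof (induction j)
    case 0
    show ?case
    proof (cases "d = 0")
      case True
      then show ?thesis using eq by (auto intro!: exI[of _ "\<lambda>_. 0"] subring_zero[OF R])
    next
      case False
      have "(\<Sum>i<d. (if i = 0 then 1 else 0) * y ^ i) = (\<Sum>i<d. if i = 0 then 1 else 0)"
        by (intro sum.cong) auto
      also have "\<dots> = 1" using False by (simp add: sum.delta)
      finally have "y ^ 0 - (\<Sum>i<d. (if i = 0 then 1 else 0) * y ^ i) \<in> A.\<M>" by simp
      then show ?thesis
        by (intro exI[of _ "\<lambda>i. if i = 0 then 1 else 0"])
          (auto intro: subring_zero[OF R] subring_one[OF R])
    qed
  next
    case (Suc j)
    then obtain b where b: "\<And>i. b i \<in> A.alg_res_n n" "y ^ j - (\<Sum>i<d. b i * y ^ i) \<in> A.\<M>" by auto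
    show ?case
    proof (cases d)
      case 0
      then have "y * y ^ j - 0 \<in> A.\<M>" using b(2) y by (simp add: ideal_mult[OF A.ideal_M])
      then show ?thesis using 0 by (auto intro!: exI[of _ "\<lambda>_. 0"] subring_zero[OF R])
    next
      case (Suc e)
      \<comment> \<open>Multiplication by y shifts the coefficients by one place; the overflow
        \<open>b e\<close> at y^d is fed back through the equation.\<close>
      define b' where "b' = (\<lambda>i. b e * (if i < d then c i else 0) + (if i = 0 then 0 else b (i - 1)))"
      have "(\<Sum>i<d. b i * y ^ i) = (\<Sum>i<e. b i * y ^ i) + b e * y ^ e" using Suc by simp
      moreover have "(\<Sum>i<d. b' i * y ^ i) = b e * (\<Sum>i<d. c i * y ^ i) + y * (\<Sum>i<e. b i * y ^ i)"
      proof -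
        have "(\<Sum>i<d. b' i * y ^ i) = (\<Sum>i<d. b e * (c i * y ^ i) + (if i = 0 then 0 else b (i - 1)) * y ^ i)"
          by (intro sum.cong) (auto simp: b'_def algebra_simps)
        also have "\<dots> = b e * (\<Sum>i<d. c i * y ^ i) + (\<Sum>i<d. (if i = 0 then 0 else b (i - 1)) * y ^ i)"
          by (simp add: sum.distrib sum_distrib_left)
        also have "(\<Sum>i<d. (if i = 0 then 0 else b (i - 1)) * y ^ i) = (\<Sum>i<e. b i * y ^ Suc i)"
          unfolding Suc by (subst sum.lessThan_Suc_shift) simp
        also have "\<dots> = y * (\<Sum>i<e. b i * y ^ i)" by (simp add: sum_distrib_left mult_ac)
        finally show ?thesis .
      qed
      ultimately have "y ^ Suc j - (\<Sum>i<d. b' i * y ^ i) =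
          y * (y ^ j - (\<Sum>i<d. b i * y ^ i)) + b e * (y ^ d - (\<Sum>i<d. c i * y ^ i))"
        using Suc by (simp add: algebra_simps)
      also have "\<dots> \<in> A.\<M>"
        using b(2) eq y cO[OF b(1)] by (intro A.vgt_add ideal_mult[OF A.ideal_M])
      finally have "y ^ Suc j - (\<Sum>i<d. b' i * y ^ i) \<in> A.\<M>" .
      moreover have "b' i \<in> A.alg_res_n n" for i
        using b(1) c unfolding b'_def
        by (auto intro!: subring_add[OF R] subring_mult[OF R] subring_zero[OF R])
      ultimately show ?thesis by blast
    qed
  qed
  then obtain b where b: "\<And>j i. b j i \<in> A.alg_res_n n" "\<And>j. y ^ j - (\<Sum>i<d. b j i * y ^ i) \<in> A.\<M>"
    by metis
  obtain t where t: "\<And>j i. t j i \<in> K.teich n" "\<And>j i. (b j i, t j i) \<in> G"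
    using total_G[OF n b(1)] by metis
  text \<open>Pigeonhole: up to the maximal ideal there are only finitely many coefficient vectors, because
    their images under \<open>G\<close> have entries in the finite set \<open>teich n\<close>.\<close>
  define \<phi> where "\<phi> j = map (t (p ^ j)) [0..<d]" for j
  have "range \<phi> \<subseteq> {xs. set xs \<subseteq> K.teich n \<and> length xs = d}" using t(1) by (auto simp: \<phi>_def)
  then have "finite (range \<phi>)"
    using finite_lists_length_eq[OF K.card_teich(2)[OF n]] finite_subset by blast
  then have "\<not> inj \<phi>" using finite_imageD infinite_UNIV_nat by blast
  then obtain i j where ij: "i < j" "\<phi> i = \<phi> j" by (metis injI linorder_neqE_nat)
  have "b (p ^ i) k - b (p ^ j) k \<in> A.\<M>" if "k < d" for k
  proof -
    have "t (p ^ i) k = t (p ^ j) k" using ij(2) that by (simp add: \<phi>_def)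
    then show ?thesis
      using G_in_M_iff[OF subring_diff[OF subring_G t(2) t(2)], of "p ^ i" k "p ^ j" k] by simp
  qed
  then have "(\<Sum>k<d. (b (p ^ i) k - b (p ^ j) k) * y ^ k) \<in> A.\<M>"
    using y by (intro ideal_sum[OF A.ideal_M] ideal_mult2[OF A.ideal_M] subring_power[OF A.subring_O]) auto
  then have "(y ^ (p ^ i) - (\<Sum>k<d. b (p ^ i) k * y ^ k)) - (y ^ (p ^ j) - (\<Sum>k<d. b (p ^ j) k * y ^ k))
      + (\<Sum>k<d. (b (p ^ i) k - b (p ^ j) k) * y ^ k) \<in> A.\<M>"
    by (rule A.vgt_add[OF A.vgt_diff[OF b(2) b(2)]])
  then have "y ^ (p ^ i) - y ^ (p ^ j) \<in> A.\<M>"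
    by (simp add: algebra_simps sum_subtractf)
  then show ?thesis by (rule frobenius_iterate_close[OF y ij(1)])
qed

text \<open>Leading coefficients in the maximal ideal are dropped until a unit appears, which must
  happen at index i at the latest; division by it gives a monic equation.\<close>

lemma alg_res_of_equation:
  assumes y: "y \<in> A.\<O>" and c: "\<And>i. i \<le> d \<Longrightarrow> c i \<in> A.alg_res"
    and eq: "(\<Sum>i\<le>d. c i * y ^ i) \<in> A.\<M>" and ne: "i \<le> d" "c i \<notin> A.\<M>"
  shows "y \<in> A.alg_res"
  using assms
proof (induction d)
  case 0
  then show ?case by simp
next
  case (Suc d)
  show ?case
  proof (cases "c (Suc d) \<in> A.\<M>")
    case True
    then have "c (Suc d) * y ^ Suc d \<in> A.\<M>"
      using y by (intro ideal_mult2[OF A.ideal_M] subring_power[OF A.subring_O])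
    then have "(\<Sum>i\<le>d. c i * y ^ i) \<in> A.\<M>"
      using A.vgt_diff[OF Suc.prems(3), of "c (Suc d) * y ^ Suc d"] by (simp del: power_Suc)
    moreover have "i \<le> d" using True Suc.prems(4,5) le_Suc_eq by auto
    ultimately show ?thesis using Suc by auto
  next
    case False
    have "c ` {..Suc d} \<subseteq> A.alg_res" using Suc.prems(2) by auto
    then obtain n where n: "n > 0" "c ` {..Suc d} \<subseteq> A.alg_res_n n"
      using frob_alg_finite[OF A.subring_O A.ideal_M, of "c ` {..Suc d}" p] by auto
    note R = A.subring_alg_res_n[OF n(1)]
    let ?u = "inverse (c (Suc d))"
    have u: "?u \<in> A.alg_res_n n" using A.alg_res_n_inverse[OF n(1) _ False] n(2) by auto
    have c0: "c (Suc d) \<noteq> 0" using False by auto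
    have "y ^ Suc d - (\<Sum>i<Suc d. (- ?u * c i) * y ^ i) = ?u * (\<Sum>i\<le>Suc d. c i * y ^ i)"
      using c0 by (simp add: lessThan_Suc_atMost sum_distrib_left sum_negf algebra_simps)
    also have "\<dots> \<in> A.\<M>" using Suc.prems(3) u by (intro ideal_mult[OF A.ideal_M]) (auto simp: frob_fixed_def)
    finally show ?thesis
      using n u by (intro alg_res_of_monic_equation[OF y n(1), of "Suc d" "\<lambda>i. - ?u * c i"])
        (auto intro!: subring_uminus[OF R] subring_mult[OF R])
  qed
qed

end

section \<open>Successive digits of the generator\<close>

lemma ideal_poly_diff:
  assumes S: "is_subring S" and J: "is_ideal_in S J" and "F \<in> polys_over S" "x \<in> S" "y \<in> S" "x - y \<in> J"
  shows "poly F x - poly F y \<in> J"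
proof -
  have "poly F x - poly F y = (\<Sum>i\<le>degree F. coeff F i * (x ^ i - y ^ i))"
    by (simp add: poly_altdef sum_subtractf algebra_simps)
  also have "\<dots> \<in> J"
    using assms by (intro ideal_sum[OF J] ideal_mult[OF J] ideal_power_diff[OF S J]) (auto simp: polys_over_def)
  finally show ?thesis .
qed

lemma of_int_polys_over: "is_subring S \<Longrightarrow> map_poly of_int F \<in> polys_over S"
  by (simp add: polys_over_def coeff_map_poly subring_of_int)

lemma map_poly_fst_of_int [simp]: "map_poly fst (map_poly of_int F :: ('a::comm_ring_1 \<times> 'b::comm_ring_1) poly) = map_poly of_int F"
  and map_poly_snd_of_int [simp]: "map_poly snd (map_poly of_int F :: ('a \<times> 'b) poly) = map_poly of_int F"
  by (rule poly_eqI, simp add: coeff_map_poly)+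

lemma map_poly_snd_pcompose:
  "map_poly snd (pcompose F H) = pcompose (map_poly snd F) (map_poly snd (H :: ('a::comm_ring_1 \<times> 'b::comm_ring_1) poly))"
proof -
  have add: "map_poly snd (P + Q) = map_poly snd P + map_poly snd Q" for P Q :: "('a \<times> 'b) poly"
    by (rule poly_eqI) (simp add: coeff_map_poly)
  have mult: "map_poly snd (P * Q) = map_poly snd P * map_poly snd Q" for P Q :: "('a \<times> 'b) poly"
    by (rule poly_eqI) (simp add: coeff_map_poly coeff_mult snd_sum)
  show ?thesis
    by (induction F) (simp_all add: pcompose_pCons map_poly_pCons add mult)
qed

context pvaluation
begin

text \<open>Partial sums of a p-adic digit expansion with m digits. Each digit may be a root of
  unity from a different finite field, so n is not fixed.\<close>

inductive teich_sum :: "nat \<Rightarrow> 'a \<Rightarrow> bool" where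
  teich_sum_0: "teich_sum 0 0"
| teich_sum_Suc: "teich_sum m a \<Longrightarrow> n > 0 \<Longrightarrow> t \<in> teich n \<Longrightarrow> teich_sum (Suc m) (a + of_nat p ^ m * t)"

end

locale generator_matching = residue_matching p w v G
  for p and w :: "'a::field \<Rightarrow> real" and v :: "'k::field \<Rightarrow> real" and G +
  fixes X :: 'a
  assumes X_integral: "X \<in> A.\<O>"
begin

text \<open>Two independent precisions occur: m measures how well X is approximated, and M how
  accurately r represents the exact digit sum a.\<close>

definition stage :: "nat \<Rightarrow> 'k \<Rightarrow> bool" where
  "stage m a \<longleftrightarrow> (\<forall>M\<ge>1. \<exists>r. (r, a) \<in> lifts M \<and> X - r \<in> A.vge (real m))"

text \<open>For M > m two lifts of a differ by a multiple of p^(m+1), so the residue of (X - r) /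
  p^m does not depend on M and r. The universal form is convenient for use, and its negation
  provides the single instance that determines the next digit.\<close>

definition terminal :: "nat \<Rightarrow> 'k \<Rightarrow> bool" where
  "terminal m a \<longleftrightarrow> stage m a \<and>
     (\<forall>M\<ge>Suc m. \<forall>r. (r, a) \<in> lifts M \<longrightarrow> X - r \<in> A.vge (real m) \<longrightarrow> (X - r) / of_nat p ^ m \<notin> A.alg_res)"

lemma stage_0: "stage 0 0"
  unfolding stage_def
  using X_integral subring_zero[OF subring_lifts] by (auto intro!: exI[of _ 0] simp: zero_prod_def)

text \<open>One pair (r0, M0) with an algebraic quotient determines the digit t. At any other
  precision the quotient y has the same residue, hence the same partner t, and a high Frobenius
  power of y lifts t with the required accuracy.\<close>

lemma stage_step:
  assumes st: "stage m a" and nt: "\<not> terminal m a"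
  shows "\<exists>n>0. \<exists>t\<in>K.teich n. stage (Suc m) (a + of_nat p ^ m * t)"
proof -
  let ?P = "of_nat p ^ m"
  obtain M0 r0 where M0: "M0 \<ge> Suc m" and r0: "(r0, a) \<in> lifts M0" "X - r0 \<in> A.vge (real m)"
    and y0: "(X - r0) / ?P \<in> A.alg_res"
    using st nt unfolding terminal_def by blast
  then obtain n where n: "n > 0" "(X - r0) / ?P \<in> A.alg_res_n n" by (auto simp: frob_alg_def)
  then obtain t where t: "t \<in> K.teich n" "((X - r0) / ?P, t) \<in> G" using total_G by blast
  have "\<exists>r. (r, a + of_nat p ^ m * t) \<in> lifts M \<and> X - r \<in> A.vge (real (Suc m))" if M: "M \<ge> 1" for M
  proof -
    \<comment> \<open>Precision m + 1 is what the comparison of r with r0 needs: their difference is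
      a lift of 0, hence divisible by p^(m+1), and falls into the maximal ideal after division by
      p^m.\<close>
    define M' where "M' = max M (Suc m)"
    have M': "M' \<ge> 1" "M \<le> M'" "Suc m \<le> M'" using M by (auto simp: M'_def)
    obtain r where r: "(r, a) \<in> lifts M'" "X - r \<in> A.vge (real m)"
      using st M'(1) unfolding stage_def by blast
    define y where "y = (X - r) / ?P"
    have "(r0, a) - (r, a) \<in> lifts (Suc m)"
      using r0(1) r(1) M0 M' lifts_antimono by (intro subring_diff[OF subring_lifts]) blast+
    then have "r0 - r \<in> A.vge (real (Suc m))"
      using lifts_isometry[of "Suc m" "(r0, a) - (r, a)" "Suc m"] by simp
    then have "r0 - r \<in> A.vgt (real m)" by (rule A.vge_imp_vgt) simp
    then have "(r0 - r) / ?P \<in> A.\<M>" by (simp add: A.div_p_vgt)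
    then have d: "y - (X - r0) / ?P \<in> A.\<M>" by (simp add: y_def diff_divide_distrib)
    note R = A.subring_alg_res_n[OF n(1)]
    have yn: "y \<in> A.alg_res_n n"
      using subring_add[OF R n(2) A.M_alg_res_n[OF n(1) d]] by simp
    then have yO: "y \<in> A.\<O>" "y ^ (p ^ n) - y \<in> A.\<M>" by (auto simp: frob_fixed_def)
    have yG: "(y, t) \<in> G"
      using subring_add[OF subring_G t(2) M_times_zero_in_G[OF d]] by (simp add: plus_prod_def)
    \<comment> \<open>Raising to q = p^n repeatedly leaves t unchanged and the residue of y as well,
      while every round improves the accuracy of the equation z^q = z; M rounds suffice because n is
      at least 1.\<close>
    define \<eta> where "\<eta> = y ^ (p ^ (n * M))"
    have "(y, t) ^ (p ^ (n * M)) \<in> G" by (rule subring_power[OF subring_G yG])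
    moreover have "(y, t) ^ (p ^ (n * M)) = (\<eta>, t)"
      using K.teich_mult[OF t(1), of M] by (simp add: \<eta>_def prod_eq_iff K.teich_def)
    ultimately have "(\<eta>, t) \<in> G" by simp
    moreover have "\<eta> ^ (p ^ n) - \<eta> \<in> A.vge (real M)"
    proof -
      have "(y ^ (p ^ n)) ^ (p ^ (n * M)) - y ^ (p ^ (n * M)) \<in> A.vge (1 + real (n * M))"
        using yO w_gt_0_imp_ge_1 by (intro A.power_p_power_diff subring_power[OF A.subring_O]) auto
      moreover have "M \<le> n * M" using n(1) by simp
      then have "real M \<le> 1 + real (n * M)" by linarith
      ultimately show ?thesis
        by (auto simp: \<eta>_def mult.commute simp flip: power_mult intro: A.vge_mono)
    qed
    ultimately have "(\<eta>, t) \<in> lifts M"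
      unfolding lifts_def using n(1) t(1) by (intro gen_ring.gen) blast
    moreover have "(r, a) \<in> lifts M" using r(1) lifts_antimono M'(2) by blast
    ultimately have "(r, a) + of_nat p ^ m * (\<eta>, t) \<in> lifts M"
      by (intro subring_add[OF subring_lifts] subring_mult[OF subring_lifts]
        subring_power[OF subring_lifts] subring_of_nat[OF subring_lifts])
    then have "(r + ?P * \<eta>, a + of_nat p ^ m * t) \<in> lifts M"
      by (simp add: plus_prod_def)
    moreover have "X - (r + ?P * \<eta>) \<in> A.vge (real (Suc m))"
    proof -
      have "y \<in> A.alg_res_n (n * M)" using yn frob_fixed_mult[OF A.subring_O A.ideal_M] by blast
      then have "\<eta> - y \<in> A.\<M>" by (simp add: \<eta>_def frob_fixed_def)
      then have "y - \<eta> \<in> A.vge 1" using w_gt_0_imp_ge_1 A.vgt_minus_commute by blast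
      then have "?P * (y - \<eta>) \<in> A.vge (1 + real m)" by (simp add: A.p_power_mult_vge)
      moreover have "?P * y = X - r" by (simp add: y_def)
      then have "?P * (y - \<eta>) = X - (r + ?P * \<eta>)" by (simp add: right_diff_distrib)
      ultimately show ?thesis by (simp add: add.commute)
    qed
    ultimately show ?thesis by blast
  qed
  then show ?thesis using n(1) t(1) unfolding stage_def by blast
qed

lemma terminal_or_infinite:
  "(\<exists>m a. K.teich_sum m a \<and> terminal m a) \<or>
   (\<exists>s. \<forall>m. stage m (s m) \<and> s (Suc m) - s m \<in> K.vge (real m))"
proof (cases "\<exists>m a. K.teich_sum m a \<and> terminal m a")
  case False
  have "\<exists>s. \<forall>m. (K.teich_sum m (s m) \<and> stage m (s m)) \<and> s (Suc m) - s m \<in> K.vge (real m)"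
  proof (rule dependent_nat_choice)
    show "\<exists>a. K.teich_sum 0 a \<and> stage 0 a" using stage_0 K.teich_sum_0 by blast
    fix a m assume a: "K.teich_sum m a \<and> stage m a"
    then obtain n t where n: "n > 0" "t \<in> K.teich n" "stage (Suc m) (a + of_nat p ^ m * t)"
      using stage_step False by blast
    moreover have "of_nat p ^ m * t \<in> K.vge (real m)"
      using K.teich_integral[OF n(1,2)] K.p_power_mult_vge[of m t 0] by simp
    ultimately show "\<exists>b. (K.teich_sum (Suc m) b \<and> stage (Suc m) b) \<and> b - a \<in> K.vge (real m)"
      using a K.teich_sum_Suc by (intro exI[of _ "a + of_nat p ^ m * t"]) auto
  qed
  then show ?thesis by blast
qed blast

lemma stage_integral: "stage m a \<Longrightarrow> a \<in> K.\<O>"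
  using lifts_subset_G snd_G unfolding stage_def by fastforce

section \<open>Values of integer polynomials at a stage and at the generator\<close>

lemma v_poly_stage:
  assumes "stage m a" "poly (map_poly of_int F) a \<noteq> 0" shows "v (poly (map_poly of_int F) a) \<in> \<int>"
proof -
  obtain r where r: "(r, a) \<in> lifts 1" using assms by (auto simp: stage_def)
  have "poly (map_poly of_int F) (r, a) \<in> lifts 1"
    by (intro poly_in_subring[OF subring_lifts] of_int_polys_over subring_lifts r)
  then show ?thesis using v_snd_lifts[of 1 "poly (map_poly of_int F) (r, a)"] assms(2) by (simp add: snd_poly)
qed

lemma poly_stage_isometry:
  assumes st: "stage k a" "k \<ge> 1"
  shows "poly (map_poly of_int F) X \<in> A.vge (real k) \<longleftrightarrow> poly (map_poly of_int F) a \<in> K.vge (real k)"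
proof -
  obtain r where r: "(r, a) \<in> lifts k" "X - r \<in> A.vge (real k)" using assms by (auto simp: stage_def)
  have rO: "r \<in> A.\<O>" using r(1) lifts_subset_G fst_G by fastforce
  have "poly (map_poly of_int F) X - poly (map_poly of_int F) r \<in> A.vge (real k)"
    using X_integral rO r(2)
    by (intro ideal_poly_diff[OF A.subring_O A.ideal_vge] of_int_polys_over A.subring_O) auto
  then have "poly (map_poly of_int F) X \<in> A.vge (real k) \<longleftrightarrow> poly (map_poly of_int F) r \<in> A.vge (real k)"
    by (rule A.vge_diff_iff)
  also have "\<dots> \<longleftrightarrow> poly (map_poly of_int F) a \<in> K.vge (real k)"
  proof -
    have "poly (map_poly of_int F) (r, a) \<in> lifts k"
      by (intro poly_in_subring[OF subring_lifts] of_int_polys_over subring_lifts r)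
    then show ?thesis using lifts_isometry[OF st(2), of "poly (map_poly of_int F) (r, a)" k]
      by (simp add: fst_poly snd_poly)
  qed
  finally show ?thesis .
qed

text \<open>The isometry compares balls of integral radius, which determines the value because the
  values on both sides are integers. That F(X) leaves some ball forces F(a) to be nonzero; the
  transcendence of a rests on this.\<close>

lemma infinite_case:
  assumes st: "\<And>m. stage m (s m)" and lim: "\<And>m. s m - a \<in> K.vge (real m)"
  shows "a \<in> K.\<O>"
    and "poly (map_poly of_int F) a \<noteq> 0 \<Longrightarrow> v (poly (map_poly of_int F) a) \<in> \<int>"
    and "poly (map_poly of_int F) X \<noteq> 0 \<Longrightarrow>
      poly (map_poly of_int F) a \<noteq> 0 \<and> w (poly (map_poly of_int F) X) = v (poly (map_poly of_int F) a)"
proof -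
  have sO: "s m \<in> K.\<O>" for m by (rule stage_integral[OF st])
  show aO: "a \<in> K.\<O>" using K.vge_diff_iff[of "s 0" a 0] lim[of 0] sO[of 0] by simp
  let ?F = "map_poly of_int F :: 'k poly" and ?FX = "poly (map_poly of_int F) X"
  have close: "poly ?F (s m) - poly ?F a \<in> K.vge (real m)" for m
    using sO aO lim by (intro ideal_poly_diff[OF K.subring_O K.ideal_vge] of_int_polys_over K.subring_O) auto
  show int: "v (poly ?F a) \<in> \<int>" if nz: "poly ?F a \<noteq> 0"
  proof -
    obtain m where m: "v (poly ?F a) < real m" using reals_Archimedean2 by blast
    have "poly ?F a - poly ?F (s m) \<in> K.vgt (v (poly ?F a))"
      using K.vge_imp_vgt[OF close m] K.vgt_minus_commute by blast
    from K.v_eq_of_close[OF nz this] show ?thesis using v_poly_stage[OF st, of F m] by simp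
  qed
  have iso: "?FX \<in> A.vge (real k) \<longleftrightarrow> poly ?F a \<in> K.vge (real k)" for k
  proof (cases "k = 0")
    case True
    have "?FX \<in> A.\<O>" by (intro poly_in_subring[OF A.subring_O] of_int_polys_over A.subring_O X_integral)
    moreover have "poly ?F a \<in> K.\<O>" by (intro poly_in_subring[OF K.subring_O] of_int_polys_over K.subring_O aO)
    ultimately show ?thesis using True by simp
  next
    case False
    then show ?thesis using poly_stage_isometry[OF st, of k F] K.vge_diff_iff[OF close] by auto
  qed
  assume nz: "?FX \<noteq> 0"
  have "?FX \<in> A.\<O>" by (intro poly_in_subring[OF A.subring_O] of_int_polys_over A.subring_O X_integral)
  then have "w ?FX \<ge> 0" using nz by (simp add: A.vge_def)
  moreover obtain i where i: "w ?FX = of_int i" using w_Ints[OF nz] by (auto elim: Ints_cases)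
  ultimately obtain j where j: "w ?FX = real j" by (metis nonneg_int_cases of_int_0_le_iff of_int_of_nat_eq)
  have 1: "poly ?F a \<in> K.vge (real j)" using iso[of j] j by (simp add: A.vge_def)
  have 2: "poly ?F a \<notin> K.vge (real (Suc j))" using iso[of "Suc j"] j nz by (simp add: A.vge_def)
  have nz': "poly ?F a \<noteq> 0" using 2 by auto
  then obtain i' where i': "v (poly ?F a) = of_int i'" using int by (auto elim: Ints_cases)
  have "real j \<le> of_int i'" "of_int i' < real (Suc j)" using 1 2 nz' i' by (auto simp: K.vge_def)
  then have "i' = int j" by linarith
  then show "poly ?F a \<noteq> 0 \<and> w ?FX = v (poly ?F a)" using nz' i' j by simp
qed

text \<open>The Taylor expansion is carried out at the pair (r, a), so its coefficients lie in
  \<open>lifts 1\<close> and inherit integral values.\<close>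

lemma taylor_coeff_stage:
  assumes "stage m a" and b: "b = coeff (pcompose (map_poly of_int F) [:a, 1:]) i"
  shows "b \<in> K.\<O>" "b \<noteq> 0 \<Longrightarrow> v b \<in> \<int>"
proof -
  obtain r where r: "(r, a) \<in> lifts 1" using assms by (auto simp: stage_def)
  define Q where "Q = pcompose (map_poly of_int F) [:(r, a), 1:]"
  note S = subring_lifts
  have "Q \<in> polys_over (lifts 1)"
    unfolding Q_def using r subring_one[OF S] zero_polys_over[OF S]
    by (intro pcompose_polys_over of_int_polys_over S) auto
  then have c: "coeff Q i \<in> lifts 1" by (rule coeff_polys_over)
  moreover have "b = snd (coeff Q i)"
  proof -
    have "map_poly snd Q = pcompose (map_poly of_int F) [:a, 1:]"
      unfolding Q_def map_poly_snd_pcompose by (simp add: map_poly_pCons)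
    then show ?thesis unfolding b by (metis coeff_map_poly snd_zero)
  qed
  ultimately show "b \<in> K.\<O>" "b \<noteq> 0 \<Longrightarrow> v b \<in> \<int>"
    using v_snd_lifts[of 1 "coeff Q i"] snd_G[of "coeff Q i"] lifts_subset_G[of 1] by auto
qed

text \<open>With X = r + p^m y, dividing F(X) by p^\<mu> gives a polynomial in y whose coefficients
  \<open>c i\<close> have algebraic residues, with a unit at i0. A value in the maximal ideal would
  make the residue of y algebraic, so F(X) / p^\<mu> is a unit.\<close>

lemma terminal_case:
  assumes t: "terminal m a" and b: "\<And>i. b i = coeff (pcompose (map_poly of_int F) [:a, 1:]) i"
    and ge: "\<And>i. b i \<in> K.vge (real \<mu> - real i * real m)"
    and eq: "b i0 \<noteq> 0" "v (b i0) = real \<mu> - real i0 * real m"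
  shows "poly (map_poly of_int F) X \<noteq> 0 \<and> w (poly (map_poly of_int F) X) = real \<mu>"
proof -
  \<comment> \<open>Precision m + 1 makes the residue of y transcendental by
    \<open>terminal\<close>; exceeding \<mu> lets coefficients be divided by p^\<mu> and shows that
    \<open>c i0\<close> is a unit, for which one digit beyond \<mu> - i0 m is inspected.\<close>
  define M where "M = Suc (max m \<mu>)"
  have M: "M \<ge> 1" "M \<ge> Suc m" "M > \<mu>" by (auto simp: M_def)
  have st: "stage m a" using t by (simp add: terminal_def)
  then obtain r where r: "(r, a) \<in> lifts M" "X - r \<in> A.vge (real m)" using M(1) unfolding stage_def by blast
  define y where "y = (X - r) / of_nat p ^ m"
  have y: "y \<in> A.\<O>" "y \<notin> A.alg_res"
    using r t M unfolding y_def terminal_def by (auto simp: A.div_p_vge)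
  define Q where "Q = pcompose (map_poly of_int F) [:(r, a), 1:]"
  note S = subring_lifts[of M]
  have "Q \<in> polys_over (lifts M)"
    unfolding Q_def using r subring_one[OF S] zero_polys_over[OF S]
    by (intro pcompose_polys_over of_int_polys_over S) auto
  then have Q: "coeff Q i \<in> lifts M" for i by (rule coeff_polys_over)
  have "map_poly snd Q = pcompose (map_poly of_int F) [:a, 1:]"
    unfolding Q_def map_poly_snd_pcompose by (simp add: map_poly_pCons)
  then have bQ: "b i = snd (coeff Q i)" for i unfolding b by (metis coeff_map_poly snd_zero)
  have QO: "fst (coeff Q i) \<in> A.\<O>" for i using Q lifts_subset_G fst_G by blast
  let ?P = "of_nat p :: 'a"
  define c where "c i = fst (coeff Q i) * ?P ^ (i * m) / ?P ^ \<mu>" for i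
  have c_le: "c i = fst (coeff Q i) / ?P ^ (\<mu> - i * m)" if "i * m \<le> \<mu>" for i
  proof -
    have "?P ^ \<mu> = ?P ^ (i * m) * ?P ^ (\<mu> - i * m)" using that by (simp flip: power_add)
    then show ?thesis by (simp add: c_def)
  qed
  have real_diff: "real (\<mu> - i * m) = real \<mu> - real i * real m" if "i * m \<le> \<mu>" for i
    by (simp only: of_nat_diff[OF that] of_nat_mult)
  have c_alg: "c i \<in> A.alg_res" for i
  proof (cases "i * m \<le> \<mu>")
    case True
    have "snd (coeff Q i) \<in> K.vge (real (\<mu> - i * m))"
      using ge[of i] unfolding bQ[of i] real_diff[OF True] .
    moreover have "\<mu> - i * m \<le> M" using M(3) by linarith
    ultimately have "fst (coeff Q i) \<in> A.vge (real (\<mu> - i * m))"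
      using lifts_isometry[OF M(1) Q] by blast
    then show ?thesis unfolding c_le[OF True] using M(3)
      by (intro lifts_quotient_alg_res[OF Q]) auto
  next
    case False
    then have im: "i * m = \<mu> + (i * m - \<mu>)" "i * m - \<mu> > 0" by auto
    have "c i = fst (coeff Q i) * ?P ^ (i * m - \<mu>)"
      unfolding c_def by (subst im(1)) (simp add: power_add)
    moreover have "?P ^ (i * m - \<mu>) \<in> A.\<M>" using im(2) A.power_in_M[OF A.vgt_imp_vge[OF A.p_in_M]] by simp
    ultimately show ?thesis using QO by (auto intro!: A.M_alg_res ideal_mult[OF A.ideal_M])
  qed
  have i0: "i0 * m \<le> \<mu>"
  proof -
    have "b i0 \<in> K.\<O>" by (rule taylor_coeff_stage[OF st b])
    then have "0 \<le> real \<mu> - real i0 * real m" using eq by (simp add: K.vge_def)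
    then show ?thesis by (metis diff_ge_0_iff_ge of_nat_le_iff of_nat_mult)
  qed
  have c_i0: "c i0 \<notin> A.\<M>"
  proof
    assume "c i0 \<in> A.\<M>"
    then have "fst (coeff Q i0) / ?P ^ (\<mu> - i0 * m) \<in> A.vge 1"
      using w_gt_0_imp_ge_1 c_le[OF i0] by simp
    then have "fst (coeff Q i0) \<in> A.vge (real (Suc (\<mu> - i0 * m)))"
      by (simp add: A.div_p_vge add.commute)
    then have "b i0 \<in> K.vge (real (Suc (\<mu> - i0 * m)))"
      using lifts_isometry[OF M(1) Q, of "Suc (\<mu> - i0 * m)" i0] bQ[of i0] M(3) by simp
    then show False using eq real_diff[OF i0] by (simp add: K.vge_def)
  qed
  have i0d: "i0 \<le> degree Q" using eq(1) bQ[of i0] by (intro le_degree) auto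
  let ?FX = "poly (map_poly of_int F) X"
  \<comment> \<open>Only the first component counts, and there r + p^m y = X; the entry 0 is a
    placeholder.\<close>
  have "fst (poly Q (?P ^ m * y, 0)) = ?FX"
    unfolding Q_def by (simp add: poly_pcompose fst_poly y_def)
  moreover have "fst (poly Q (?P ^ m * y, 0)) = (\<Sum>i\<le>degree Q. fst (coeff Q i) * (?P ^ m * y) ^ i)"
    by (simp add: poly_altdef fst_sum)
  ultimately have "?FX / ?P ^ \<mu> = (\<Sum>i\<le>degree Q. fst (coeff Q i) * (?P ^ m * y) ^ i) / ?P ^ \<mu>" by simp
  also have "\<dots> = (\<Sum>i\<le>degree Q. c i * y ^ i)"
    by (simp add: sum_divide_distrib c_def power_mult_distrib mult.commute[of m] mult.assoc flip: power_mult)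
  finally have FX: "?FX / ?P ^ \<mu> = (\<Sum>i\<le>degree Q. c i * y ^ i)" .
  have "?FX / ?P ^ \<mu> \<notin> A.\<M>"
    unfolding FX using alg_res_of_equation[where y = y and c = c, OF y(1) c_alg _ i0d c_i0] y(2) by blast
  moreover have "?FX / ?P ^ \<mu> \<in> A.\<O>"
    unfolding FX using y(1) A.alg_res_integral[OF c_alg]
    by (intro subring_sum[OF A.subring_O] subring_mult[OF A.subring_O] subring_power[OF A.subring_O])
  ultimately have "?FX / ?P ^ \<mu> \<noteq> 0" "w (?FX / ?P ^ \<mu>) = 0" using A.unit_iff by blast+
  then show ?thesis by (simp add: A.v_divide A.v_p_power)
qed

end

section \<open>Finite-dimensional spaces over the field of p-adic numbers\<close>

lemma clear_denominators:
  fixes f :: "rat poly"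
  shows "\<exists>D F. D > 0 \<and> smult (of_int D) f = map_poly of_int F"
proof (induction f)
  case 0
  show ?case by (rule exI[of _ 1], rule exI[of _ 0]) simp
next
  case (pCons a f)
  then obtain D F where D: "D > 0" "smult (of_int D) f = map_poly of_int F" by blast
  obtain n d where a: "a = of_int n / of_int d" "d > 0" by (meson quotient_of_unique quotient_of_div quotient_of_denom_pos surj_pair)
  have "smult (of_int (D * d)) (pCons a f) = map_poly of_int (pCons (D * n) (smult d F))"
  proof -
    have "smult (of_int (D * d)) f = smult (of_int d) (smult (of_int D) f)" by (simp add: mult.commute)
    also have "\<dots> = map_poly of_int (smult d F)"
      unfolding D(2) by (rule poly_eqI) (simp add: coeff_map_poly)
    finally show ?thesis using a by (simp add: map_poly_pCons)
  qed
  moreover have "D * d > 0" using D a by simp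
  ultimately show ?case by blast
qed

locale complete_p_adic =
  fixes p :: nat and v :: "'k::field_char_0 \<Rightarrow> real"
  assumes is_Cp: "is_Cp p v"

sublocale complete_p_adic \<subseteq> closed_pvaluation p v
proof
  show p: "prime p" using is_Cp by (simp add: is_Cp_def)
  show "v (x * y) = v x + v y" if "x \<noteq> 0" "y \<noteq> 0" for x y
    using is_Cp that by (simp add: is_Cp_def)
  show "min (v x) (v y) \<le> v (x + y)" if "x \<noteq> 0" "y \<noteq> 0" "x + y \<noteq> 0" for x y
    using is_Cp that unfolding is_Cp_def by blast
  show "of_nat p \<noteq> (0 :: 'k)" using p by (simp add: prime_gt_0_nat)
  have "v (of_rat q) = of_int (vp_rat p q)" if "q \<noteq> 0" for q using is_Cp that by (simp add: is_Cp_def)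
  from this[of "of_nat p"] show "v (of_nat p) = 1"
    using p quotient_of_int[of "int p"] by (simp add: vp_rat_def prime_gt_0_nat)
  show "\<exists>z::'k. poly P z = 0" if "degree P > 0" for P using is_Cp that by (simp add: is_Cp_def)
qed

context complete_p_adic
begin

lemma p_pos [simp]: "0 < p"
  using prime_p by (rule prime_gt_0_nat)

lemma cauchy_converges:
  fixes s :: "nat \<Rightarrow> 'k"
  assumes "\<And>N::real. \<exists>M. \<forall>m\<ge>M. \<forall>n\<ge>M. s m - s n \<in> vgt N"
  shows "\<exists>y. \<forall>N. \<exists>M. \<forall>n\<ge>M. s n - y \<in> vgt N"
proof -
  have cauchy: "\<forall>N::real. \<exists>M. \<forall>m\<ge>M. \<forall>n\<ge>M. s m = s n \<or> v (s m - s n) > N"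
    using assms by (simp add: vgt_def)
  have "\<forall>s :: nat \<Rightarrow> 'k.
        (\<forall>N::real. \<exists>M. \<forall>m\<ge>M. \<forall>n\<ge>M. s m = s n \<or> v (s m - s n) > N) \<longrightarrow>
        (\<exists>y. \<forall>N::real. \<exists>M. \<forall>n\<ge>M. s n = y \<or> v (s n - y) > N)"
    using is_Cp unfolding is_Cp_def by blast
  from mp[OF spec[OF this, of s] cauchy] show ?thesis by (simp add: vgt_def)
qed

section \<open>The closure of the rationals as a complete field\<close>

definition v_closed :: "'k set \<Rightarrow> bool" where
  "v_closed S \<longleftrightarrow> (\<forall>x. (\<forall>N. \<exists>y\<in>S. x - y \<in> vgt N) \<longrightarrow> x \<in> S)"

abbreviation "Qp \<equiv> Qp_in v"

lemma Qp_iff: "x \<in> Qp \<longleftrightarrow> (\<forall>N. \<exists>q. x - of_rat q \<in> vgt N)"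
  by (simp add: Qp_in_def vgt_def)

lemma v_closed_Qp: "v_closed Qp"
  unfolding v_closed_def
proof (intro allI impI)
  fix x assume x: "\<forall>N. \<exists>y\<in>Qp. x - y \<in> vgt N"
  show "x \<in> Qp"
    unfolding Qp_iff
  proof
    fix N
    obtain y where y: "y \<in> Qp" "x - y \<in> vgt N" using x by blast
    obtain q where "y - of_rat q \<in> vgt N" using y(1) by (auto simp: Qp_iff)
    then show "\<exists>q. x - of_rat q \<in> vgt N" using vgt_trans[OF y(2)] by blast
  qed
qed

lemma of_rat_Qp [simp]: "of_rat q \<in> Qp"
  unfolding Qp_iff by (metis cancel_comm_monoid_add_class.diff_cancel vgt_zero)

lemma vgt_mono: "x \<in> vgt r \<Longrightarrow> s \<le> r \<Longrightarrow> x \<in> vgt s"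
  by (auto simp: vgt_def)

lemma vgt_sum: "(\<And>i. f i \<in> vgt r) \<Longrightarrow> sum f I \<in> vgt r"
  by (induction I rule: infinite_finite_induct) (auto intro: vgt_add)

lemma subring_Qp: "is_subring Qp"
proof (rule is_subringI)
  show "1 \<in> Qp" using of_rat_Qp[of 1] by simp
  fix x assume x: "x \<in> Qp"
  show "- x \<in> Qp"
    unfolding Qp_iff
  proof
    fix N
    obtain q where "x - of_rat q \<in> vgt N" using x by (auto simp: Qp_iff)
    then have "- x - of_rat (- q) \<in> vgt N" using vgt_uminus[of "x - of_rat q" N] by (simp add: of_rat_minus)
    then show "\<exists>q. - x - of_rat q \<in> vgt N" by blast
  qed
  fix y assume y: "y \<in> Qp"
  show "x + y \<in> Qp"
    unfolding Qp_iff
  proof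
    fix N
    obtain q r where "x - of_rat q \<in> vgt N" "y - of_rat r \<in> vgt N" using x y unfolding Qp_iff by blast
    then have "x + y - of_rat (q + r) \<in> vgt N"
      using vgt_add[of "x - of_rat q" N "y - of_rat r"] by (simp add: of_rat_add algebra_simps)
    then show "\<exists>q. x + y - of_rat q \<in> vgt N" by blast
  qed
  show "x * y \<in> Qp"
    unfolding Qp_iff
  proof
    fix N
    define B where "B = min (v x) (v y)"
    have B: "x \<in> vge B" "y \<in> vge B" by (auto simp: vge_def B_def)
    \<comment> \<open>The additional bound B gives \<open>of_rat r\<close> at least the value B,
      like y itself, so that multiplying the error of q by it loses at most B.\<close>
    obtain q r where q: "x - of_rat q \<in> vgt (N - B)" and r: "y - of_rat r \<in> vgt (max (N - B) B)"
      using x y unfolding Qp_iff by blast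
    have "of_rat r \<in> vge B"
      using vge_diff_iff[OF vge_mono[OF vgt_imp_vge[OF r]], of B] B(2) by simp
    then have "of_rat r * (x - of_rat q) \<in> vgt N" using vgt_mult[OF _ q] by fastforce
    moreover have "x * (y - of_rat r) \<in> vgt N"
      using vgt_mult[OF B(1) vgt_mono[OF r, of "N - B"]] by simp
    ultimately have "x * y - of_rat (q * r) \<in> vgt N"
      using vgt_add[of "of_rat r * (x - of_rat q)" N "x * (y - of_rat r)"] by (simp add: of_rat_mult algebra_simps)
    then show "\<exists>q. x * y - of_rat q \<in> vgt N" by blast
  qed
qed

lemma inverse_Qp: assumes x: "x \<in> Qp" shows "inverse x \<in> Qp"
proof (cases "x = 0")
  case False
  show ?thesis
    unfolding Qp_iff
  proof
    fix N
    \<comment> \<open>Closeness beyond \<open>v x\<close> gives q the value of x; the bound N + 2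
      v(x) compensates for the denominator x q.\<close>
    obtain q where q: "x - of_rat q \<in> vgt (max (v x) (N + 2 * v x))"
      using x by (auto simp: Qp_iff)
    have q0: "of_rat q \<noteq> (0::'k)" "v (of_rat q) = v x"
      using v_eq_of_close[OF False vgt_mono[OF q]] by auto
    have "inverse x - inverse (of_rat q) = inverse (x * of_rat q) * - (x - of_rat q)"
      using False q0 by (simp add: field_simps)
    moreover have "inverse (x * of_rat q) \<in> vge (- 2 * v x)"
      using False q0 by (simp add: vge_def v_mult v_inverse)
    moreover have "- (x - of_rat q) \<in> vgt (N + 2 * v x)" unfolding vgt_uminus by (rule vgt_mono[OF q]) simp
    ultimately have "inverse x - of_rat (inverse q) \<in> vgt N"
      using vgt_mult[of "inverse (x * of_rat q)" "- 2 * v x" "- (x - of_rat q)" "N + 2 * v x"]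
      by (simp add: of_rat_inverse)
    then show "\<exists>q. inverse x - of_rat q \<in> vgt N" by blast
  qed
qed (use of_rat_Qp[of 0] in simp)

section \<open>Spans of finite families over the p-adic numbers\<close>

definition Qp_span :: "(nat \<Rightarrow> 'k) \<Rightarrow> nat \<Rightarrow> 'k set" where
  "Qp_span e n = {\<Sum>i<n. c i * e i | c. \<forall>i. c i \<in> Qp}"

lemma Qp_span_add: assumes "x \<in> Qp_span e n" "y \<in> Qp_span e n" shows "x + y \<in> Qp_span e n"
proof -
  from assms obtain c d where "x = (\<Sum>i<n. c i * e i)" "y = (\<Sum>i<n. d i * e i)" "\<forall>i. c i \<in> Qp" "\<forall>i. d i \<in> Qp"
    by (auto simp: Qp_span_def)
  then show ?thesis unfolding Qp_span_def
    by (intro CollectI exI[of _ "\<lambda>i. c i + d i"]) (auto simp: sum.distrib algebra_simps intro: subring_add[OF subring_Qp])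
qed

lemma Qp_span_scale: assumes "x \<in> Qp_span e n" "b \<in> Qp" shows "b * x \<in> Qp_span e n"
proof -
  from assms obtain c where "x = (\<Sum>i<n. c i * e i)" "\<forall>i. c i \<in> Qp"
    by (auto simp: Qp_span_def)
  then show ?thesis unfolding Qp_span_def using assms(2)
    by (intro CollectI exI[of _ "\<lambda>i. b * c i"]) (auto simp: sum_distrib_left mult.assoc intro: subring_mult[OF subring_Qp])
qed

lemma Qp_span_zero: "0 \<in> Qp_span e n"
  unfolding Qp_span_def using subring_zero[OF subring_Qp] by (intro CollectI exI[of _ "\<lambda>_. 0"]) simp

lemma Qp_span_uminus: "x \<in> Qp_span e n \<Longrightarrow> - x \<in> Qp_span e n"
  using Qp_span_scale[of x e n "- 1"] subring_uminus[OF subring_Qp subring_one[OF subring_Qp]] by simp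

lemma Qp_span_diff: "x \<in> Qp_span e n \<Longrightarrow> y \<in> Qp_span e n \<Longrightarrow> x - y \<in> Qp_span e n"
  using Qp_span_add[OF _ Qp_span_uminus, of x e n y] by simp

lemma Qp_span_sum: "(\<And>i. i \<in> I \<Longrightarrow> f i \<in> Qp_span e n) \<Longrightarrow> sum f I \<in> Qp_span e n"
  by (induction I rule: infinite_finite_induct) (auto intro: Qp_span_zero Qp_span_add)

lemma Qp_span_Suc: "x \<in> Qp_span e (Suc n) \<longleftrightarrow> (\<exists>y\<in>Qp_span e n. \<exists>c\<in>Qp. x = y + c * e n)"
proof
  assume "x \<in> Qp_span e (Suc n)"
  then show "\<exists>y\<in>Qp_span e n. \<exists>c\<in>Qp. x = y + c * e n" by (auto simp: Qp_span_def)
next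
  assume "\<exists>y\<in>Qp_span e n. \<exists>c\<in>Qp. x = y + c * e n"
  then obtain c d where "x = (\<Sum>i<n. d i * e i) + c * e n" "c \<in> Qp" "\<forall>i. d i \<in> Qp" by (auto simp: Qp_span_def)
  then show "x \<in> Qp_span e (Suc n)"
    unfolding Qp_span_def by (intro CollectI exI[of _ "d(n := c)"]) auto
qed

lemma Qp_span_base: "i < n \<Longrightarrow> e i \<in> Qp_span e n"
  unfolding Qp_span_def using subring_zero[OF subring_Qp] subring_one[OF subring_Qp]
  by (intro CollectI exI[of _ "\<lambda>j. if j = i then 1 else 0"]) (simp add: if_distrib[of "\<lambda>x. x * _"] sum.delta cong: if_cong)

text \<open>A vector \<open>e n\<close> outside the smaller span, which is closed by induction,
  keeps a distance from it given by C. Hence the coefficients of \<open>e n\<close> in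
  approximations of x form a Cauchy sequence; subtracting the limit coefficient leaves a limit of
  elements of the smaller span.\<close>

lemma v_closed_Qp_span: "v_closed (Qp_span e n)"
proof (induction n)
  case 0
  have "x = 0" if "\<And>N. x \<in> vgt N" for x using that[of "v x"] by (simp add: vgt_def)
  then show ?case by (auto simp: v_closed_def Qp_span_def)
next
  case (Suc n)
  show ?case
  proof (cases "e n \<in> Qp_span e n")
    case True
    have "Qp_span e (Suc n) = Qp_span e n"
    proof (intro equalityI subsetI)
      show "x \<in> Qp_span e n" if "x \<in> Qp_span e (Suc n)" for x
        using that True unfolding Qp_span_Suc by (auto intro: Qp_span_add Qp_span_scale)
      show "x \<in> Qp_span e (Suc n)" if "x \<in> Qp_span e n" for x
        using that subring_zero[OF subring_Qp] unfolding Qp_span_Suc by force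
    qed
    with Suc show ?thesis by simp
  next
    case False
    then obtain C where C: "\<And>y. y \<in> Qp_span e n \<Longrightarrow> e n - y \<notin> vgt C"
      using Suc unfolding v_closed_def by blast
    show ?thesis
      unfolding v_closed_def
    proof (intro allI impI)
      fix x assume x: "\<forall>N. \<exists>y\<in>Qp_span e (Suc n). x - y \<in> vgt N"
      have "\<forall>k. \<exists>y c. y \<in> Qp_span e n \<and> c \<in> Qp \<and> x - (y + c * e n) \<in> vgt (real k)"
        using x unfolding Bex_def Qp_span_Suc by metis
      then obtain y c where y: "\<And>k. y k \<in> Qp_span e n" and c: "\<And>k. c k \<in> Qp"
        and xk: "\<And>k. x - (y k + c k * e n) \<in> vgt (real k)" by metis
      have cauchy: "c k - c l \<in> vgt (real j - C)" if "j \<le> k" "j \<le> l" for j k l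
      proof (cases "c k = c l")
        case False
        \<comment> \<open>Two approximations differ by (c k - c l) (e n - u) with u in the smaller
          span, and e n - u has value at most C.\<close>
        define u where "u = inverse (c k - c l) * (y l - y k)"
        have "u \<in> Qp_span e n"
          unfolding u_def using y c by (intro Qp_span_scale Qp_span_diff inverse_Qp subring_diff[OF subring_Qp])
        then have u: "e n - u \<notin> vgt C" by (rule C)
        have "(x - (y l + c l * e n)) - (x - (y k + c k * e n)) \<in> vgt (real j)"
          using that by (intro vgt_diff vgt_mono[OF xk]) auto
        moreover have "(x - (y l + c l * e n)) - (x - (y k + c k * e n)) = (c k - c l) * (e n - u)"
          using False by (simp add: u_def field_simps)
        ultimately have "(c k - c l) * (e n - u) \<in> vgt (real j)" by simp
        then show ?thesis using u False by (auto simp: vgt_def v_mult)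
      qed simp
      have "\<exists>d. \<forall>N. \<exists>M. \<forall>k\<ge>M. c k - d \<in> vgt N"
      proof (rule cauchy_converges)
        fix N
        obtain j where "N + C < real j" using reals_Archimedean2 by blast
        then show "\<exists>M. \<forall>k\<ge>M. \<forall>l\<ge>M. c k - c l \<in> vgt N"
          by (intro exI[of _ j] allI impI vgt_mono[OF cauchy]) auto
      qed
      then obtain d where d: "\<And>N. \<exists>M. \<forall>k\<ge>M. c k - d \<in> vgt N" by blast
      have dQ: "d \<in> Qp"
        using v_closed_Qp unfolding v_closed_def using c d vgt_minus_commute by (meson order_refl)
      have "x - d * e n \<in> Qp_span e n"
      proof -
        have "\<exists>u\<in>Qp_span e n. x - d * e n - u \<in> vgt N" for N
        proof -
          obtain M where M: "\<And>k. k \<ge> M \<Longrightarrow> c k - d \<in> vgt (N - v (e n))" using d by blast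
          obtain j where j: "N < real j" using reals_Archimedean2 by blast
          define k where "k = max M j"
          have "e n * (c k - d) \<in> vgt N"
            using vgt_mult[of "e n" "v (e n)" "c k - d" "N - v (e n)"] M[of k] by (simp add: vge_def k_def)
          moreover have "x - (y k + c k * e n) \<in> vgt N" using j by (intro vgt_mono[OF xk]) (auto simp: k_def)
          ultimately have "x - d * e n - y k \<in> vgt N"
            using vgt_add[of "e n * (c k - d)" N "x - (y k + c k * e n)"] by (simp add: algebra_simps)
          then show ?thesis using y by blast
        qed
        then show ?thesis using Suc unfolding v_closed_def by blast
      qed
      then show "x \<in> Qp_span e (Suc n)"
        unfolding Qp_span_Suc using dQ by (intro bexI[of _ "x - d * e n"] bexI[of _ d]) auto
    qed
  qed
qed

text \<open>Gaussian elimination: a pivot j0 clears the last spanning vector from all the other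
  elements, and its own coefficient is recovered at the end.\<close>

lemma Qp_span_dependent:
  assumes "finite I" "card I > n" "\<And>j. j \<in> I \<Longrightarrow> x j \<in> Qp_span e n"
  shows "\<exists>c. (\<forall>j. c j \<in> Qp) \<and> (\<exists>j\<in>I. c j \<noteq> 0) \<and> (\<Sum>j\<in>I. c j * x j) = 0"
  using assms
proof (induction n arbitrary: I x)
  case 0
  then obtain j where "j \<in> I" by fastforce
  moreover have "x j = 0" if "j \<in> I" for j using 0(3)[OF that] by (auto simp: Qp_span_def)
  ultimately show ?case using subring_one[OF subring_Qp] by (intro exI[of _ "\<lambda>_. 1"]) auto
next
  case (Suc n)
  have "\<forall>j\<in>I. \<exists>y d. y \<in> Qp_span e n \<and> d \<in> Qp \<and> x j = y + d * e n"
    using Suc.prems(3) unfolding Qp_span_Suc by blast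
  then obtain y d where y: "\<And>j. j \<in> I \<Longrightarrow> y j \<in> Qp_span e n" and d: "\<And>j. j \<in> I \<Longrightarrow> d j \<in> Qp"
    and x: "\<And>j. j \<in> I \<Longrightarrow> x j = y j + d j * e n" by metis
  show ?case
  proof (cases "\<forall>j\<in>I. d j = 0")
    case True
    then have "x j \<in> Qp_span e n" if "j \<in> I" for j using x y that by simp
    then show ?thesis using Suc.IH[of I x] Suc.prems by simp
  next
    case False
    then obtain j0 where j0: "j0 \<in> I" "d j0 \<noteq> 0" by blast
    define b where "b j = d j * inverse (d j0)" for j
    have b: "b j \<in> Qp" if "j \<in> I" for j
      unfolding b_def using d that j0 by (intro subring_mult[OF subring_Qp] inverse_Qp) auto
    have "\<exists>c. (\<forall>j. c j \<in> Qp) \<and> (\<exists>j\<in>I - {j0}. c j \<noteq> 0) \<and> (\<Sum>j\<in>I - {j0}. c j * (x j - b j * x j0)) = 0"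
    proof (rule Suc.IH)
      show "finite (I - {j0})" "n < card (I - {j0})" using Suc.prems j0 by auto
      fix j assume j: "j \<in> I - {j0}"
      have "x j - b j * x j0 = y j - b j * y j0"
        using x[of j] x[of j0] j j0 by (simp add: b_def field_simps)
      then show "x j - b j * x j0 \<in> Qp_span e n"
        using j j0 y b by (auto intro!: Qp_span_diff Qp_span_scale)
    qed
    then obtain c where c: "\<forall>j. c j \<in> Qp" "\<exists>j\<in>I - {j0}. c j \<noteq> 0" "(\<Sum>j\<in>I - {j0}. c j * (x j - b j * x j0)) = 0"
      by blast
    define c' where "c' = c(j0 := - (\<Sum>j\<in>I - {j0}. c j * b j))"
    have "(\<Sum>j\<in>I. c' j * x j) = c' j0 * x j0 + (\<Sum>j\<in>I - {j0}. c' j * x j)"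
      using Suc.prems(1) j0(1) by (simp add: sum.remove)
    also have "(\<Sum>j\<in>I - {j0}. c' j * x j) = (\<Sum>j\<in>I - {j0}. c j * x j)"
      by (intro sum.cong) (auto simp: c'_def)
    also have "c' j0 * x j0 + (\<Sum>j\<in>I - {j0}. c j * x j) = (\<Sum>j\<in>I - {j0}. c j * (x j - b j * x j0))"
      by (simp add: c'_def sum_subtractf right_diff_distrib sum_distrib_right mult.assoc)
    finally have "(\<Sum>j\<in>I. c' j * x j) = 0" using c(3) by simp
    moreover have "c' j \<in> Qp" for j
      using c(1) b by (auto simp: c'_def intro!: subring_uminus[OF subring_Qp] subring_sum[OF subring_Qp] subring_mult[OF subring_Qp])
    moreover have "\<exists>j\<in>I. c' j \<noteq> 0" using c(2) by (auto simp: c'_def)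
    ultimately show ?thesis by blast
  qed
qed

section \<open>Digit sums generate minimal extensions\<close>

text \<open>The digits of \<open>a\<close> are limits of polynomials in \<open>b\<close>, hence lie in the finite-dimensional, and
  therefore closed, space spanned by the powers of \<open>b\<close>.\<close>
lemma teich_sum_degree:
  assumes a: "teich_sum m a" and ba: "b - a \<in> vge (real m)"
    and Q: "Q \<noteq> 0" "Qp_poly v Q" "poly Q b = 0"
  shows "\<exists>P. P \<noteq> 0 \<and> Qp_poly v P \<and> poly P a = 0 \<and> degree P \<le> degree Q"
proof -
  define n where "n = degree Q"
  have n: "n > 0"
  proof (rule ccontr)
    assume "\<not> n > 0"
    then obtain c where "Q = [:c:]" by (metis degree_eq_zeroE gr0I n_def)
    then show False using Q by simp
  qed
  define V where "V = Qp_span (\<lambda>i. b ^ i) n"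
  have base: "b ^ i \<in> V" if "i < n" for i unfolding V_def using Qp_span_base[OF that, of "\<lambda>i. b ^ i"] .
  have Qc: "coeff Q i \<in> Qp" for i using Q(2) by (simp add: Qp_poly_def)
  have bn: "b ^ n \<in> V"
  proof -
    have lc: "coeff Q n \<noteq> 0" using Q(1) by (simp add: n_def)
    have "coeff Q n * b ^ n = - (\<Sum>i<n. coeff Q i * b ^ i)"
      using Q(3) unfolding poly_altdef n_def[symmetric]
      by (simp add: eq_neg_iff_add_eq_0 add.commute flip: lessThan_Suc_atMost)
    then have "b ^ n = inverse (coeff Q n) * - (\<Sum>i<n. coeff Q i * b ^ i)"
      using lc by (simp add: field_simps)
    also have "\<dots> \<in> V"
      using Qc base unfolding V_def
      by (intro Qp_span_scale Qp_span_uminus Qp_span_sum inverse_Qp) auto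
    finally show ?thesis .
  qed
  have bV: "b * x \<in> V" if x: "x \<in> V" for x
  proof -
    obtain c where c: "\<forall>i. c i \<in> Qp" "x = (\<Sum>i<n. c i * b ^ i)" using x by (auto simp: V_def Qp_span_def)
    have "b * x = (\<Sum>i<n. c i * b ^ Suc i)" by (simp add: c(2) sum_distrib_left mult_ac)
    also have "\<dots> \<in> V"
      unfolding V_def
    proof (intro Qp_span_sum Qp_span_scale)
      fix i assume "i \<in> {..<n}"
      then show "b ^ Suc i \<in> Qp_span ((^) b) n"
        using base[of "Suc i"] bn unfolding V_def by (cases "Suc i = n") auto
    qed (use c in auto)
    finally show ?thesis .
  qed
  have bj: "b ^ j * x \<in> V" if x: "x \<in> V" for j x
    by (induction j) (use x bV in \<open>auto simp: mult.assoc\<close>)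
  have one: "1 \<in> V" using base[of 0] n by simp
  have SV: "is_subring V"
  proof (rule is_subringI[OF one])
    fix x assume x: "x \<in> V"
    then show "- x \<in> V" unfolding V_def by (rule Qp_span_uminus)
    fix y assume y: "y \<in> V"
    show "x + y \<in> V" using x y unfolding V_def by (rule Qp_span_add)
    obtain c where c: "\<forall>i. c i \<in> Qp" "x = (\<Sum>i<n. c i * b ^ i)" using x by (auto simp: V_def Qp_span_def)
    have "x * y = (\<Sum>i<n. c i * (b ^ i * y))" by (simp add: c(2) sum_distrib_right mult.assoc)
    also have "\<dots> \<in> V"
      unfolding V_def using c(1) bj[OF y, unfolded V_def] by (intro Qp_span_sum Qp_span_scale[of "_ * y"]) auto
    finally show "x * y \<in> V" .
  qed
  have "a \<in> V"
    using a ba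
  proof (induction rule: teich_sum.induct)
    case teich_sum_0
    show ?case by (rule subring_zero[OF SV])
  next
    case (teich_sum_Suc m a k t)
    have tO: "t \<in> \<O>" by (rule teich_integral[OF teich_sum_Suc.hyps(2,3)])
    have "b - a - of_nat p ^ m * t \<in> vge (real m)"
      using vge_mono[OF teich_sum_Suc.prems, of "real m"] by (simp add: diff_diff_eq)
    then have "b - a \<in> vge (real m)"
      using vge_diff_iff[of "b - a" "of_nat p ^ m * t" "real m"] p_power_mult_vge[of m t 0] tO by simp
    then have aV: "a \<in> V" by (rule teich_sum_Suc.IH)
    define y where "y = (b - a) / of_nat p ^ m"
    have "inverse (of_nat p ^ m) \<in> Qp"
      by (intro inverse_Qp subring_power[OF subring_Qp] subring_of_nat[OF subring_Qp])
    then have yV: "y \<in> V"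
      using Qp_span_scale[of "b - a" "\<lambda>i. b ^ i" n "inverse (of_nat p ^ m)"] subring_diff[OF SV bj[OF one, of 1] aV]
      unfolding V_def[symmetric] by (simp add: y_def divide_inverse mult.commute)
    have "y - t = (b - a - of_nat p ^ m * t) / of_nat p ^ m"
      by (simp add: y_def diff_divide_distrib)
    moreover have "\<dots> \<in> vge 1"
      using teich_sum_Suc.prems by (simp add: div_p_vge diff_diff_eq add.commute)
    \<comment> \<open>The hypothesis has precision m + 1 and the divisor is p^m, which leaves the
      precision 1 from which Frobenius powers of y converge to t.\<close>
    ultimately have yt: "y - t \<in> vge 1" by simp
    have yO: "y \<in> \<O>" using vge_diff_iff[OF vge_mono[OF yt], of 0] tO by simp
    have "t \<in> V"
    proof -
      have "\<exists>u\<in>V. t - u \<in> vgt N" for N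
      proof -
        obtain M where M: "N < real M" using reals_Archimedean2 by blast
        have "y ^ (p ^ (k * M)) - t ^ (p ^ (k * M)) \<in> vge (1 + real (k * M))"
          by (rule power_p_power_diff[OF yO tO yt order_refl])
        moreover have "t ^ (p ^ (k * M)) = t" using teich_mult[OF teich_sum_Suc.hyps(3), of M] by (simp add: teich_def)
        moreover have "M \<le> k * M" using teich_sum_Suc.hyps(2) by simp
        then have "N < 1 + real (k * M)" using M by linarith
        ultimately have "y ^ (p ^ (k * M)) - t \<in> vgt N" using vge_imp_vgt by metis
        then show ?thesis using vgt_minus_commute subring_power[OF SV yV] by blast
      qed
      then show ?thesis using v_closed_Qp_span unfolding v_closed_def V_def by blast
    qed
    then show ?case
      using aV subring_add[OF SV] subring_mult[OF SV] subring_power[OF SV subring_of_nat[OF SV]] by blast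
  qed
  \<comment> \<open>The n + 1 powers of a up to exponent n lie in a space spanned by n vectors; a
    linear relation among them is the polynomial sought.\<close>
  then have "a ^ j \<in> V" for j by (rule subring_power[OF SV])
  then obtain c where c: "\<forall>j. c j \<in> Qp" "\<exists>j\<in>{..n}. c j \<noteq> 0" "(\<Sum>j\<le>n. c j * a ^ j) = 0"
    using Qp_span_dependent[of "{..n}" n "\<lambda>j. a ^ j" "\<lambda>i. b ^ i"] unfolding V_def by auto
  define P where "P = (\<Sum>j\<le>n. monom (c j) j)"
  have cP: "coeff P j = (if j \<le> n then c j else 0)" for j
    by (simp add: P_def coeff_sum)
  have "P \<noteq> 0" using c(2) cP by (metis atMost_iff coeff_0)
  moreover have "Qp_poly v P" using c(1) subring_zero[OF subring_Qp] by (simp add: Qp_poly_def cP)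
  moreover have "poly P a = 0" using c(3) by (simp add: P_def poly_sum poly_monom)
  moreover have "degree P \<le> n" by (rule degree_le) (simp add: cP)
  ultimately show ?thesis unfolding n_def by blast
qed

text \<open>Algebraic numbers are dense, so one of them lies within p^m of a, and the degree
  comparison transfers algebraicity from it to a.\<close>

lemma Qp_alg_teich_sum: assumes "teich_sum m a" shows "Qp_alg v a"
proof -
  have "\<forall>(x :: 'k) N. \<exists>y. algebraic y \<and> (x = y \<or> v (x - y) > N)" using is_Cp unfolding is_Cp_def by blast
  from spec[OF spec[OF this, of a], of "real m"]
  obtain b where b: "algebraic b" "a = b \<or> v (a - b) > real m" by blast
  have "a - b \<in> vge (real m)" using b(2) by (auto simp: vge_def)
  then have "b - a \<in> vge (real m)" by (simp only: vge_minus_commute[of b a])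
  moreover obtain F where F: "F \<noteq> 0" "poly (map_poly of_int F) b = 0" using algebraicE'[OF b(1)] by blast
  moreover have "(map_poly of_int F :: 'k poly) \<noteq> 0" using F(1) by (simp add: map_poly_eq_0_iff)
  moreover have "Qp_poly v (map_poly of_int F)"
    using subring_of_int[OF subring_Qp] by (simp add: Qp_poly_def coeff_map_poly)
  ultimately show ?thesis using teich_sum_degree[OF assms] unfolding Qp_alg_def by blast
qed

lemma minimal_pair_teich_sum: assumes "teich_sum m a" shows "minimal_pair v a (real m)"
  unfolding minimal_pair_def
proof (intro conjI allI impI)
  show "Qp_alg v a" by (rule Qp_alg_teich_sum[OF assms])
  fix b assume b: "Qp_alg v b" "b = a \<or> real m \<le> v (b - a)"
  have "\<exists>n P. P \<noteq> 0 \<and> Qp_poly v P \<and> poly P b = 0 \<and> degree P = n" using b(1) by (auto simp: Qp_alg_def)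
  then have "\<exists>P. P \<noteq> 0 \<and> Qp_poly v P \<and> poly P b = 0 \<and> degree P = Qp_deg v b"
    unfolding Qp_deg_def by (rule LeastI_ex)
  then obtain Q where Q: "Q \<noteq> 0" "Qp_poly v Q" "poly Q b = 0" "degree Q = Qp_deg v b" by blast
  have "b - a \<in> vge (real m)" using b(2) by (auto simp: vge_def)
  from teich_sum_degree[OF assms this Q(1-3)]
  obtain P where P: "P \<noteq> 0" "Qp_poly v P" "poly P a = 0" "degree P \<le> degree Q" by blast
  have "Qp_deg v a \<le> degree P" unfolding Qp_deg_def using P by (intro Least_le) blast
  then show "Qp_deg v a \<le> Qp_deg v b" using P(4) Q(4) by simp
qed

section \<open>Unramified generators\<close>

lemma v_rat_poly_Ints:
  assumes "\<And>F. poly (map_poly of_int F) a \<noteq> 0 \<Longrightarrow> v (poly (map_poly of_int F) a) \<in> \<int>"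
    and f: "poly (map_poly of_rat f) a \<noteq> 0"
  shows "v (poly (map_poly of_rat f) a) \<in> \<int>"
proof -
  obtain D F where D: "D > 0" "smult (of_int D) f = map_poly of_int F" using clear_denominators by blast
  have "map_poly of_int F = smult (of_int D) (map_poly of_rat f :: 'k poly)"
  proof (rule poly_eqI)
    fix i
    have "of_int D * coeff f i = of_int (coeff F i)"
      using arg_cong[OF D(2), of "\<lambda>f. coeff f i"] by (simp add: coeff_map_poly)
    then have "(of_rat (of_int D * coeff f i) :: 'k) = of_rat (of_int (coeff F i))" by simp
    then show "coeff (map_poly of_int F :: 'k poly) i = coeff (smult (of_int D) (map_poly of_rat f)) i"
      by (simp add: coeff_map_poly of_rat_mult)
  qed
  then have eq: "poly (map_poly of_int F) a = of_int D * poly (map_poly of_rat f) a" by simp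
  have D0: "(of_int D :: 'k) \<noteq> 0" using D by simp
  have "v (of_int D) \<in> \<int>" using assms(1)[of "[:D:]"] D0 by (simp add: map_poly_pCons)
  moreover have "v (of_int D * poly (map_poly of_rat f) a) \<in> \<int>"
    using assms(1)[of F] eq D0 f by simp
  ultimately show ?thesis
    using v_mult[OF D0 f] Ints_diff[of "v (of_int D * poly (map_poly of_rat f) a)" "v (of_int D)"] by simp
qed

text \<open>Rational coefficients closer to those of P than the value of P(a) leave that value
  unchanged, since a is integral.\<close>

lemma v_Qp_poly_Ints:
  assumes aO: "a \<in> \<O>" 
    and int: "\<And>F. poly (map_poly of_int F) a \<noteq> 0 \<Longrightarrow> v (poly (map_poly of_int F) a) \<in> \<int>"
    and P: "Qp_poly v P" "poly P a \<noteq> 0"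
  shows "v (poly P a) \<in> \<int>"
proof -
  have "\<forall>i. \<exists>q. coeff P i - of_rat q \<in> vgt (v (poly P a))" using P(1) by (simp add: Qp_poly_def Qp_iff)
  then obtain q where q: "\<And>i. coeff P i - of_rat (q i) \<in> vgt (v (poly P a))" by metis
  define f where "f = (\<Sum>i\<le>degree P. monom (q i) i)"
  have cf: "coeff f i = (if i \<le> degree P then q i else 0)" for i
    by (simp add: f_def coeff_sum)
  have "map_poly of_rat f = (\<Sum>i\<le>degree P. monom (of_rat (q i) :: 'k) i)"
    by (rule poly_eqI) (simp add: coeff_map_poly cf coeff_sum)
  then have "poly (map_poly of_rat f) a = (\<Sum>i\<le>degree P. of_rat (q i) * a ^ i)"
    by (simp add: poly_sum poly_monom)
  then have "poly P a - poly (map_poly of_rat f) a = (\<Sum>i\<le>degree P. a ^ i * (coeff P i - of_rat (q i)))"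
    by (simp add: poly_altdef[of P] sum_subtractf algebra_simps)
  also have "\<dots> \<in> vgt (v (poly P a))"
  proof -
    have "a ^ i * (coeff P i - of_rat (q i)) \<in> vgt (v (poly P a))" for i
      using vgt_mult[OF subring_power[OF subring_O aO] q[of i], of i] by simp
    then show ?thesis by (rule vgt_sum)
  qed
  finally have "poly P a - poly (map_poly of_rat f) a \<in> vgt (v (poly P a))" .
  from v_eq_of_close[OF P(2) this] show ?thesis using v_rat_poly_Ints[OF int, of f] by simp
qed

text \<open>Elements of Q_p(a) are quotients of values of p-adic polynomials, so integer polynomials
  already confine the value group to Z; powers of p realize all of Z.\<close>

lemma Qp_unramifiedI:
  assumes aO: "a \<in> \<O>"
    and int: "\<And>F. poly (map_poly of_int F) a \<noteq> 0 \<Longrightarrow> v (poly (map_poly of_int F) a) \<in> \<int>"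
  shows "Qp_unramified v a" "a \<in> Op_br v"
proof -
  have one: "Qp_poly v 1"
    using subring_one[OF subring_Qp] subring_zero[OF subring_Qp] by (simp add: Qp_poly_def coeff_1)
  show u: "Qp_unramified v a"
    unfolding Qp_unramified_def Qp_adj_vgroup_def
  proof (intro equalityI subsetI)
    fix g assume "g \<in> v ` (Qp_adj v a - {0})"
    then obtain x where x: "x \<in> Qp_adj v a" "x \<noteq> 0" "g = v x" by blast
    then obtain P Q where "x = poly P a / poly Q a" "Qp_poly v P" "Qp_poly v Q" "poly Q a \<noteq> 0"
      by (auto simp: Qp_adj_def)
    moreover from this x have "poly P a \<noteq> 0" by auto
    ultimately show "g \<in> \<int>" using x v_Qp_poly_Ints[OF aO int] by (simp add: v_divide)
  next
    fix g :: real assume "g \<in> \<int>"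
    then obtain k where k: "g = of_int k" by (auto elim: Ints_cases)
    define x :: 'k where "x = (if k \<ge> 0 then of_nat p ^ nat k else inverse (of_nat p ^ nat (- k)))"
    have "x \<in> Qp" unfolding x_def
      by (auto intro!: inverse_Qp subring_power[OF subring_Qp] subring_of_nat[OF subring_Qp])
    then have "Qp_poly v [:x:]" using subring_zero[OF subring_Qp]
      by (auto simp: Qp_poly_def coeff_pCons split: nat.splits)
    moreover have "x = poly [:x:] a / poly 1 a" "poly 1 a \<noteq> 0" by auto
    ultimately have "x \<in> Qp_adj v a" unfolding Qp_adj_def using one by blast
    moreover have "x \<noteq> 0" "v x = g"
      by (auto simp: x_def k v_inverse v_p_power)
    ultimately show "g \<in> v ` (Qp_adj v a - {0})" by blast
  qed
  have "Cp_br v a"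
    unfolding Cp_br_def using u unfolding Qp_unramified_def by (intro exI[of _ 1]) auto
  then show "a \<in> Op_br v" using aO by (auto simp: Op_br_def vge_def)
qed

end

section \<open>Discrete valuation rings of the rational function field\<close>

lemma const_rf_mult: "const_rf (c * d) = const_rf c * const_rf d"
  by (simp add: const_rf_def mult.commute)

lemma const_rf_one [simp]: "const_rf 1 = 1"
  by (simp add: const_rf_def One_fract_def one_pCons)

lemma const_rf_eq_0_iff [simp]: "const_rf c = 0 \<longleftrightarrow> c = 0"
  by (simp add: const_rf_def Zero_fract_def eq_fract)

lemma const_rf_of_nat: "const_rf (of_nat n) = of_nat n"
  by (simp add: const_rf_def of_nat_fract of_nat_poly)

lemma const_rf_of_int: "const_rf (of_int n) = of_int n"
proof (cases n)
  case (nonneg k)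
  then show ?thesis using const_rf_of_nat[of k] by simp
next
  case (neg k)
  have "const_rf (- c) = - const_rf c" for c by (simp add: const_rf_def)
  then show ?thesis using neg const_rf_of_nat[of "Suc k"] by (metis of_int_minus of_int_of_nat_eq)
qed

lemma const_rf_inverse: "c \<noteq> 0 \<Longrightarrow> const_rf (inverse c) = inverse (const_rf c)"
  by (rule inverse_unique[symmetric]) (simp flip: const_rf_mult)

lemma poly_X_rf: "poly (map_poly of_int F) X_rf = Fract (map_poly of_int F) 1"
proof (induction F)
  case (pCons a F)
  have "poly (map_poly of_int (pCons a F)) X_rf = of_int a + X_rf * Fract (map_poly of_int F) 1"
    using pCons by (simp add: map_poly_pCons)
  also have "\<dots> = Fract (map_poly of_int (pCons a F)) 1"
    by (simp add: map_poly_pCons X_rf_def const_rf_def flip: const_rf_of_int)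
  finally show ?case .
qed (simp add: Zero_fract_def)

lemma Fract_smult: "Fract (smult c f) g = const_rf c * Fract f g"
  by (simp add: const_rf_def)

lemma Fract_eq_0_iff: "Fract f 1 = (0 :: 'a::idom fract) \<longleftrightarrow> f = 0"
  by (simp add: Zero_fract_def eq_fract)

lemma int_prime_decompose:
  assumes "prime (p::nat)" "n \<noteq> 0"
  obtains m where "n = int p ^ multiplicity (int p) n * m" "\<not> int p dvd m"
proof (rule multiplicity_decompose'[of n "int p"])
  have "prime (int p)" using assms(1) by simp
  then show "\<not> is_unit (int p)" using not_prime_unit by blast
qed (use assms in auto)

text \<open>Normalization at p fixes the values of integers, so w and v agree there and clearing
  denominators shifts both sides equally.\<close>

lemma (in pvaluation) v_of_int:
  assumes "n \<noteq> 0" shows "of_int n \<noteq> (0::'a)" "v (of_int n) = real (multiplicity (int p) n)"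
proof -
  obtain m where m: "n = int p ^ multiplicity (int p) n * m" "\<not> int p dvd m"
    using int_prime_decompose[OF prime_p assms] .
  have "of_int m \<notin> \<M>" using m(2) of_int_in_M by blast
  then have u: "of_int m \<noteq> (0::'a)" "v (of_int m) = 0"
    using subring_of_int[OF subring_O, of m] unit_iff by blast+
  have eq: "of_int n = of_nat p ^ multiplicity (int p) n * (of_int m :: 'a)"
    by (subst m(1)) simp
  show "of_int n \<noteq> (0::'a)" unfolding eq using u by simp
  show "v (of_int n) = real (multiplicity (int p) n)"
    unfolding eq using u by (simp add: v_mult v_p_power)
qed

section \<open>Values of rational polynomials attached to a pair\<close>

context complete_p_adic
begin

lemma map_poly_of_rat_smult: "map_poly of_rat (smult c f) = smult (of_rat c) (map_poly of_rat f :: 'k poly)"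
  by (rule poly_eqI) (simp add: coeff_map_poly of_rat_mult)

lemma map_poly_of_rat_of_int: "map_poly of_rat (map_poly of_int F) = (map_poly of_int F :: 'k poly)"
  by (rule poly_eqI) (simp add: coeff_map_poly)

lemma taylor_coeff_smult: "taylor_coeff a (smult c f) i = of_rat c * (taylor_coeff a f i :: 'k)"
  by (simp add: taylor_coeff_def map_poly_of_rat_smult pcompose_smult)

definition taylor_vals :: "'k \<Rightarrow> real \<Rightarrow> rat poly \<Rightarrow> real set" where
  "taylor_vals a d f = {v (taylor_coeff a f i) + of_nat i * d | i. taylor_coeff a f i \<noteq> 0}"

lemma finite_taylor_vals: "finite (taylor_vals a d f)"
proof -
  have "taylor_vals a d f \<subseteq> (\<lambda>i. v (taylor_coeff a f i) + of_nat i * d) `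
      {..degree (pcompose (map_poly of_rat f) [:a, 1:])}"
    unfolding taylor_vals_def taylor_coeff_def using le_degree by fastforce
  then show ?thesis using finite_subset by blast
qed

lemma taylor_vals_nonempty: assumes "f \<noteq> 0" shows "taylor_vals a d f \<noteq> {}"
proof -
  have "map_poly of_rat f \<noteq> (0 :: 'k poly)" using assms by (simp add: map_poly_eq_0_iff)
  then have "pcompose (map_poly of_rat f) [:a, 1:] \<noteq> 0"
    using pcompose_eq_0[of "map_poly of_rat f" "[:a, 1:]"] by auto
  then obtain i where "taylor_coeff a f i \<noteq> 0"
    unfolding taylor_coeff_def by (metis leading_coeff_0_iff)
  then show ?thesis unfolding taylor_vals_def by blast
qed

lemma mono_val_taylor_vals: "mono_val v a d f = Min (taylor_vals a d f)"
  by (simp add: mono_val_def taylor_vals_def)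

definition pair_val :: "'k \<Rightarrow> enat \<Rightarrow> rat poly \<Rightarrow> real" where
  "pair_val a d f = (if d = \<infinity> then v (poly (map_poly of_rat f) a) else mono_val v a (real (the_enat d)) f)"

lemma poly_transcendental_nonzero:
  assumes "\<not> algebraic a" "f \<noteq> 0" shows "poly (map_poly of_rat f) a \<noteq> (0 :: 'k)"
proof
  assume "poly (map_poly of_rat f) a = 0"
  moreover have "map_poly of_rat f \<noteq> (0 :: 'k poly)" using assms by (simp add: map_poly_eq_0_iff)
  moreover have "coeff (map_poly of_rat f) i \<in> (\<rat> :: 'k set)" for i by (simp add: coeff_map_poly)
  ultimately show False using assms(1) unfolding algebraic_altdef by blast
qed

lemma pair_val_smult:
  assumes "d = \<infinity> \<Longrightarrow> \<not> algebraic a" "f \<noteq> 0" "c \<noteq> 0"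
  shows "pair_val a d (smult c f) = v (of_rat c) + pair_val a d f"
proof (cases "d = \<infinity>")
  case True
  then show ?thesis
    using assms poly_transcendental_nonzero[of a f] by (simp add: pair_val_def map_poly_of_rat_smult v_mult)
next
  case False
  let ?d = "real (the_enat d)"
  have im: "taylor_vals a ?d g = (\<lambda>i. v (taylor_coeff a g i) + of_nat i * ?d) ` {i. taylor_coeff a g i \<noteq> 0}" for g
    by (auto simp: taylor_vals_def)
  have "taylor_vals a ?d (smult c f) = (\<lambda>x. v (of_rat c) + x) ` taylor_vals a ?d f"
    unfolding im image_image using assms(3)
    by (intro image_cong) (simp_all add: taylor_coeff_smult v_mult)
  moreover have "mono (\<lambda>x::real. v (of_rat c) + x)" by (simp add: mono_def)
  from mono_Min_commute[OF this finite_taylor_vals taylor_vals_nonempty[OF assms(2)]]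
  have "v (of_rat c) + Min (taylor_vals a ?d f) = Min ((\<lambda>x. v (of_rat c) + x) ` taylor_vals a ?d f)" .
  ultimately show ?thesis
    using False unfolding pair_val_def mono_val_taylor_vals by (simp only: if_False)
qed

lemma Zp_ring_eq:
  assumes "d = \<infinity> \<Longrightarrow> \<not> algebraic a"
  shows "Zp_ring v a d = {phi. \<exists>f g. g \<noteq> 0 \<and> phi = Fract f g \<and> (f = 0 \<or> pair_val a d f \<ge> pair_val a d g)}"
proof (cases "d = \<infinity>")
  case True
  have "poly (map_poly of_rat f) a = 0 \<longleftrightarrow> f = 0" for f
    using poly_transcendental_nonzero[of a f] assms True by auto
  then show ?thesis using True by (auto simp: Zp_ring_def pair_val_def)
next
  case False
  then show ?thesis unfolding Zp_ring_def pair_val_def by (simp only: if_False)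
qed

text \<open>Taylor coefficients at a are rational polynomials in a, so they lie in Q_p(a), where
  values are integers; a finite d is an integer too, and the minimum is attained.\<close>

lemma pair_val_Ints:
  assumes u: "Qp_unramified v a" and a: "d = \<infinity> \<Longrightarrow> \<not> algebraic a" and f: "f \<noteq> 0"
  shows "pair_val a d f \<in> \<int>"
proof -
  have int: "v (poly (map_poly of_rat g) a) \<in> \<int>" if g: "poly (map_poly of_rat g) a \<noteq> 0" for g
  proof -
    have "Qp_poly v (map_poly of_rat g)" "Qp_poly v 1" "poly 1 a \<noteq> 0"
      "poly (map_poly of_rat g) a = poly (map_poly of_rat g) a / poly 1 a"
      using of_rat_Qp[of 0] of_rat_Qp[of 1] by (auto simp: Qp_poly_def coeff_map_poly coeff_1)
    then have "poly (map_poly of_rat g) a \<in> Qp_adj v a" unfolding Qp_adj_def by blast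
    then have "v (poly (map_poly of_rat g) a) \<in> Qp_adj_vgroup v a" using g by (auto simp: Qp_adj_vgroup_def)
    then show ?thesis using u by (simp add: Qp_unramified_def)
  qed
  show ?thesis
  proof (cases "d = \<infinity>")
    case True
    then show ?thesis using int[of f] poly_transcendental_nonzero[of a f] a f by (simp add: pair_val_def)
  next
    case False
    let ?R = "range (\<lambda>g. poly (map_poly of_rat g) a)"
    have R: "is_subring ?R"
    proof (rule is_subringI)
      show "1 \<in> ?R" by (rule image_eqI[of _ _ 1]) auto
      fix x assume "x \<in> ?R"
      then obtain g where g: "x = poly (map_poly of_rat g) a" by blast
      have "- x = poly (map_poly of_rat (smult (- 1) g)) a"
        unfolding map_poly_of_rat_smult by (simp add: g)
      then show "- x \<in> ?R" by blast
      fix y assume "y \<in> ?R"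
      then obtain h where h: "y = poly (map_poly of_rat h) a" by blast
      have "map_poly of_rat (g + h) = map_poly of_rat g + (map_poly of_rat h :: 'k poly)"
        by (rule poly_eqI) (simp add: coeff_map_poly of_rat_add)
      then have "x + y = poly (map_poly of_rat (g + h)) a" by (simp add: g h)
      then show "x + y \<in> ?R" by blast
      have "map_poly of_rat (g * h) = map_poly of_rat g * (map_poly of_rat h :: 'k poly)"
        by (rule poly_eqI) (simp add: coeff_map_poly coeff_mult of_rat_sum of_rat_mult)
      then have "x * y = poly (map_poly of_rat (g * h)) a" by (simp add: g h)
      then show "x * y \<in> ?R" by blast
    qed
    have c: "of_rat q \<in> ?R" for q by (rule image_eqI[of _ _ "[:q:]"]) (auto simp: map_poly_pCons)
    have aR: "a \<in> ?R" by (rule image_eqI[of _ _ "[:0, 1:]"]) (auto simp: map_poly_pCons)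
    have "pcompose (map_poly of_rat f) [:a, 1:] \<in> polys_over ?R"
      using c aR subring_one[OF R] zero_polys_over[OF R]
      by (intro pcompose_polys_over[OF R]) (auto simp: polys_over_def[of _] coeff_map_poly coeff_pCons subring_zero[OF R] split: nat.splits)
    then have t: "taylor_coeff a f i \<in> ?R" for i unfolding taylor_coeff_def by (rule coeff_polys_over)
    have "Min (taylor_vals a (real (the_enat d)) f) \<in> taylor_vals a (real (the_enat d)) f"
      by (rule Min_in[OF finite_taylor_vals taylor_vals_nonempty[OF f]])
    then obtain i where "mono_val v a (real (the_enat d)) f = v (taylor_coeff a f i) + of_nat i * real (the_enat d)"
      "taylor_coeff a f i \<noteq> 0" unfolding mono_val_taylor_vals taylor_vals_def by blast
    moreover have "v (taylor_coeff a f i) \<in> \<int>" using t[of i] int calculation(2) by auto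
    ultimately show ?thesis using False unfolding pair_val_def by (simp del: not_infinity_eq)
  qed
qed

end

section \<open>The valuation of W and its restriction to the constants\<close>

locale dvr_over_Z_loc =
  fixes p :: nat and W :: "rat poly fract set" and w :: "rat poly fract \<Rightarrow> int"
  assumes prime_p: "prime p" and val: "dvr_valuation W w" and Z_loc: "{c. const_rf c \<in> W} = Z_loc p"
begin

lemma w_mult: "x \<noteq> 0 \<Longrightarrow> y \<noteq> 0 \<Longrightarrow> w (x * y) = w x + w y"
  and w_add: "x \<noteq> 0 \<Longrightarrow> y \<noteq> 0 \<Longrightarrow> x + y \<noteq> 0 \<Longrightarrow> min (w x) (w y) \<le> w (x + y)"
  and w_surj: "\<exists>x. x \<noteq> 0 \<and> w x = n"
  and W_iff: "x \<in> W \<longleftrightarrow> x = 0 \<or> w x \<ge> 0"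
  using val unfolding dvr_valuation_def by blast+

lemma w_one: "w 1 = 0" using w_mult[of 1 1] by simp

lemma w_inverse: "x \<noteq> 0 \<Longrightarrow> w (inverse x) = - w x"
  using w_mult[of x "inverse x"] w_one by simp

lemma w_power: "x \<noteq> 0 \<Longrightarrow> w (x ^ n) = int n * w x"
  by (induction n) (auto simp: w_mult w_one algebra_simps)

lemma p_nonzero [simp]: "of_nat p \<noteq> (0 :: rat poly fract)"
  using prime_p by (simp add: prime_gt_0_nat flip: const_rf_of_nat)

lemma w_p_pos: "w (of_nat p) > 0"
proof (rule ccontr)
  assume "\<not> w (of_nat p) > 0"
  then have "inverse (of_nat p) \<in> W" using w_inverse[OF p_nonzero] by (simp add: W_iff del: of_nat_eq_0_iff)
  moreover have "inverse (of_nat p) = const_rf (inverse (of_nat p))"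
    using prime_p by (simp add: const_rf_inverse const_rf_of_nat prime_gt_0_nat)
  ultimately have "inverse (of_nat p) \<in> Z_loc p" using Z_loc by auto
  then obtain a b where ab: "inverse (of_nat p) = of_int a / (of_int b :: rat)" "\<not> int p dvd b"
    by (auto simp: Z_loc_def)
  have "b \<noteq> 0" using ab(2) by auto
  then have "(of_int b :: rat) = of_int (int p * a)"
    using ab(1) prime_p by (simp add: field_simps prime_gt_0_nat)
  then have "b = int p * a" by (simp only: of_int_eq_iff)
  then show False using ab(2) by simp
qed

lemma w_unit: assumes "\<not> int p dvd n" shows "w (of_int n) = 0"
proof -
  have n: "n \<noteq> 0" using assms by auto
  then have n0: "of_int n \<noteq> (0 :: rat poly fract)" by (simp flip: const_rf_of_int)
  have "\<not> int p dvd 1" using prime_p by (auto dest: prime_gt_1_nat)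
  then have "of_int n \<in> Z_loc p" "inverse (of_int n) \<in> Z_loc p"
    unfolding Z_loc_def mem_Collect_eq using assms
    by (intro exI[of _ n] exI[of _ 1], simp, intro exI[of _ 1] exI[of _ n], simp add: inverse_eq_divide)
  then have "const_rf (of_int n) \<in> W" "const_rf (inverse (of_int n)) \<in> W" using Z_loc by auto
  then show ?thesis using n n0 by (simp add: const_rf_of_int const_rf_inverse W_iff w_inverse)
qed

lemma w_p_dvd: assumes "n \<noteq> 0" shows "w (of_nat p) dvd w (of_int n)"
proof -
  obtain m where m: "n = int p ^ multiplicity (int p) n * m" "\<not> int p dvd m"
    using int_prime_decompose[OF prime_p assms] .
  have "m \<noteq> 0" using m(2) by auto
  then have "of_int m \<noteq> (0 :: rat poly fract)" by (simp flip: const_rf_of_int)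
  moreover have "of_int n = of_nat p ^ multiplicity (int p) n * (of_int m :: rat poly fract)"
    by (subst m(1)) simp
  moreover have "of_nat p ^ multiplicity (int p) n \<noteq> (0 :: rat poly fract)" using p_nonzero by (rule power_not_zero)
  ultimately show ?thesis using w_unit[OF m(2)] w_power[OF p_nonzero] by (metis w_mult add.right_neutral dvd_triv_right)
qed

text \<open>On nonzero rationals w is w(p) times the p-adic valuation, so its image consists of the
  multiples of w(p), which is positive.\<close>

lemma surj_on_constants_iff: "w ` (const_rf ` (UNIV - {0})) = UNIV \<longleftrightarrow> w (of_nat p) = 1"
proof
  assume "w ` (const_rf ` (UNIV - {0})) = UNIV"
  then have "1 \<in> (\<lambda>c. w (const_rf c)) ` (UNIV - {0})" by (simp only: UNIV_I image_image)
  then obtain c where "1 = w (const_rf c)" "c \<in> UNIV - {0}" by (rule imageE)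
  then have c: "c \<noteq> 0" "w (const_rf c) = 1" by simp_all
  obtain n d where nd: "c = of_int n / of_int d" "d > 0"
    by (metis surj_pair quotient_of_div quotient_of_denom_pos)
  have n: "n \<noteq> 0" using c nd by auto
  have n0: "of_int n \<noteq> (0 :: rat poly fract)" using n by (simp flip: const_rf_of_int)
  have "of_int n = const_rf c * of_int d"
    using nd by (simp flip: const_rf_of_int const_rf_mult)
  then have "w (of_int n) = w (const_rf c) + w (of_int d)"
    using w_mult[of "const_rf c" "of_int d"] c(1) n0 by auto
  then have "1 = w (of_int n) - w (of_int d)" using c(2) by simp
  moreover have "w (of_nat p) dvd w (of_int n) - w (of_int d)"
    using w_p_dvd[OF n] w_p_dvd[of d] nd(2) by (intro dvd_diff) auto
  ultimately have "w (of_nat p) dvd 1" by simp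
  then show "w (of_nat p) = 1" using w_p_pos by (simp add: zdvd1_eq)
next
  assume p1: "w (of_nat p) = 1"
  show "w ` (const_rf ` (UNIV - {0})) = UNIV"
  proof (intro equalityI subsetI UNIV_I)
    fix k :: int
    define x where "x = (if k \<ge> 0 then of_nat p ^ nat k else inverse (of_nat p ^ nat (- k)) :: rat)"
    have p0: "(of_nat p :: rat) \<noteq> 0" using prime_p by (simp add: prime_gt_0_nat)
    have pw: "const_rf (of_nat p ^ j) = of_nat p ^ j" for j
      using const_rf_of_nat[of "p ^ j"] by simp
    have "x \<noteq> 0" using p0 by (simp add: x_def)
    moreover have "w (const_rf x) = k"
      using p0 p1 by (simp add: x_def const_rf_inverse pw w_inverse w_power)
    ultimately show "k \<in> w ` (const_rf ` (UNIV - {0}))" by (intro image_eqI[of _ _ "const_rf x"] image_eqI[of _ _ x]) auto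
  qed
qed

text \<open>Integrality forces \<open>N f \<ge> N g + 1\<close> for an element \<open>f / g\<close> of valuation 1, which is therefore divisible
  by \<open>p\<close> in \<open>W\<close>.\<close>
lemma w_p_eq_1_of_integral:
  assumes W: "W = {phi. \<exists>f g. g \<noteq> 0 \<and> phi = Fract f g \<and> (f = 0 \<or> N f \<ge> N g)}"
    and int: "\<And>f. f \<noteq> 0 \<Longrightarrow> N f \<in> \<int>"
    and Np: "\<And>f. f \<noteq> 0 \<Longrightarrow> N (smult (of_nat p) f) = (1::real) + N f"
  shows "w (of_nat p) = 1"
proof -
  obtain x where x: "x \<noteq> 0" "w x = 1" using w_surj by blast
  then have "x \<in> W" by (simp add: W_iff)
  then obtain f g where fg: "g \<noteq> 0" "x = Fract f g" "f = 0 \<or> N f \<ge> N g" unfolding W by blast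
  have f: "f \<noteq> 0" using x(1) fg by (auto simp: fract_collapse)
  have "\<not> N f \<le> N g"
  proof
    assume "N f \<le> N g"
    moreover have "inverse x = Fract g f" using fg(2) by simp
    ultimately have "inverse x \<in> W" unfolding W using f by blast
    then show False using x by (simp add: W_iff w_inverse)
  qed
  then have "N f \<ge> 1 + N g" using int[OF f] int[OF fg(1)] by (auto elim!: Ints_cases)
  then have "N f \<ge> N (smult (of_nat p) g)" using Np[OF fg(1)] by simp
  moreover have "smult (of_nat p) g \<noteq> 0" using fg(1) prime_p by (simp add: prime_gt_0_nat)
  ultimately have "Fract f (smult (of_nat p) g) \<in> W" unfolding W by blast
  moreover have "Fract f (smult (of_nat p) g) = x * inverse (of_nat p)"
    by (simp add: fg(2) const_rf_def flip: const_rf_of_nat)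
  moreover have "x * inverse (of_nat p) \<noteq> 0" "w (x * inverse (of_nat p)) = 1 - w (of_nat p)"
    using x p_nonzero w_mult[of x "inverse (of_nat p)"] w_inverse[OF p_nonzero]
    by (simp_all del: of_nat_eq_0_iff)
  ultimately have "w (of_nat p) \<le> 1" by (simp add: W_iff)
  then show ?thesis using w_p_pos by linarith
qed

lemma W_eq_of_values:
  assumes N: "\<And>f. f \<noteq> 0 \<Longrightarrow> real_of_int (w (Fract f 1)) = N f"
  shows "W = {phi. \<exists>f g. g \<noteq> 0 \<and> phi = Fract f g \<and> (f = 0 \<or> N f \<ge> N g)}"
proof -
  have w: "w (Fract f g) = w (Fract f 1) - w (Fract g 1)" if "f \<noteq> 0" "g \<noteq> 0" for f g
  proof -
    have eq: "Fract f g = Fract f 1 * inverse (Fract g 1)" by simp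
    have f0: "Fract f 1 \<noteq> 0" and g0: "Fract g 1 \<noteq> 0" using that by (simp_all add: Fract_eq_0_iff)
    show ?thesis
      unfolding eq w_mult[OF f0 nonzero_imp_inverse_nonzero[OF g0]] w_inverse[OF g0] by (rule add_uminus_conv_diff)
  qed
  have *: "Fract f g \<in> W \<longleftrightarrow> f = 0 \<or> N f \<ge> N g" if "g \<noteq> 0" for f g
  proof (cases "f = 0")
    case False
    have "Fract f g \<noteq> 0" using False that by (simp add: Zero_fract_def eq_fract)
    then show ?thesis using False that w[OF False that]
      by (simp add: W_iff flip: N[OF False] N[OF that])
  qed (simp add: W_iff fract_collapse)
  show ?thesis
  proof (intro equalityI subsetI)
    fix x assume x: "x \<in> W"
    obtain f g where "x = Fract f g" "g \<noteq> 0" by (cases x)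
    then show "x \<in> {phi. \<exists>f g. g \<noteq> 0 \<and> phi = Fract f g \<and> (f = 0 \<or> N f \<ge> N g)}" using x * by auto
  qed (use * in auto)
qed

end

section \<open>The equivalence\<close>

theorem mainTheorem12:
  fixes p :: nat and v :: "'k::field_char_0 \<Rightarrow> real" and W :: "rat poly fract set"
  assumes "is_Cp p v"
    and "is_dvr W"
    and "{c. const_rf c \<in> W} = Z_loc p"
    and "X_rf \<in> W"
  shows "dvr_unramified W \<longleftrightarrow>
    (\<exists>a d. a \<in> Op_br v \<and> admissible v a d \<and>
       (d \<noteq> \<infinity> \<longrightarrow> minimal_pair v a (real (the_enat d))) \<and>
       W = Zp_ring v a d \<and> Qp_unramified v a)"
proof
  interpret K: complete_p_adic p v by unfold_locales (rule assms(1))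
  assume "\<exists>a d. a \<in> Op_br v \<and> admissible v a d \<and>
       (d \<noteq> \<infinity> \<longrightarrow> minimal_pair v a (real (the_enat d))) \<and>
       W = Zp_ring v a d \<and> Qp_unramified v a"
  then obtain a d where ad: "d = \<infinity> \<Longrightarrow> \<not> algebraic a" and W: "W = Zp_ring v a d" and u: "Qp_unramified v a"
    by (auto simp: admissible_def)
  show "dvr_unramified W"
    unfolding dvr_unramified_def
  proof (intro allI impI)
    fix w assume "dvr_valuation W w"
    then interpret dvr_over_Z_loc p W w
      using assms(3) K.prime_p by unfold_locales
    have "w (of_nat p) = 1"
    proof (rule w_p_eq_1_of_integral)
      show "W = {phi. \<exists>f g. g \<noteq> 0 \<and> phi = Fract f g \<and> (f = 0 \<or> K.pair_val a d f \<ge> K.pair_val a d g)}"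
        using W K.Zp_ring_eq[OF ad] by simp
      show "K.pair_val a d f \<in> \<int>" if "f \<noteq> 0" for f using K.pair_val_Ints[OF u ad that] .
      show "K.pair_val a d (smult (of_nat p) f) = 1 + K.pair_val a d f" if "f \<noteq> 0" for f
        using K.pair_val_smult[where c = "of_nat p", OF ad that] by (simp add: K.v_p)
    qed
    then show "w ` (const_rf ` (UNIV - {0})) = UNIV" using surj_on_constants_iff by blast
  qed
next
  interpret K: complete_p_adic p v by unfold_locales (rule assms(1))
  assume u: "dvr_unramified W"
  obtain w where w: "dvr_valuation W w" using assms(2) by (auto simp: is_dvr_def)
  interpret W: dvr_over_Z_loc p W w
    using w assms(3) K.prime_p by unfold_locales
  have wp: "w (of_nat p) = 1" using u w W.surj_on_constants_iff by (auto simp: dvr_unramified_def)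
  \<comment> \<open>A real-valued copy of w, so that both fields become instances of the same
    locale; w(p) = 1 is the normalization demanded there.\<close>
  define wr where "wr x = real_of_int (w x)" for x
  interpret A: pvaluation p wr
  proof
    show "min (wr x) (wr y) \<le> wr (x + y)" if "x \<noteq> 0" "y \<noteq> 0" "x + y \<noteq> 0" for x y
      using W.w_add[OF that] by (simp add: wr_def min_def split: if_splits)
  qed (simp_all add: wr_def W.w_mult wp K.prime_p)
  interpret valuation_pair p wr v
    by unfold_locales (simp add: wr_def)
  obtain G where "compatible G" "\<forall>n>0. \<forall>f\<in>A.alg_res_n n. \<exists>c\<in>K.teich n. (f, c) \<in> G"
    using exists_maximal_compatible by blast
  then interpret generator_matching p wr v G X_rf
    using assms(4) by unfold_locales (auto simp: A.vge_def wr_def W.W_iff)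
  have value_eq: "real_of_int (w (Fract f 1)) = K.pair_val a d f"
    if d: "d = \<infinity> \<Longrightarrow> \<not> algebraic a" and f: "f \<noteq> 0"
      and F: "\<And>F. F \<noteq> 0 \<Longrightarrow> wr (poly (map_poly of_int F) X_rf) = K.pair_val a d (map_poly of_int F)" for a d f
  proof -
    obtain D F where D: "D > 0" "smult (of_int D) f = map_poly of_int F" using clear_denominators by blast
    have D0: "D \<noteq> 0" using D by simp
    have "F \<noteq> 0" using D f by (metis map_poly_0 of_int_eq_0_iff smult_eq_0_iff less_irrefl)
    from F[OF this] have "wr (const_rf (of_int D) * Fract f 1) = K.pair_val a d (smult (of_int D) f)"
      unfolding poly_X_rf D(2)[symmetric] Fract_smult .
    then have "wr (of_int D) + wr (Fract f 1) = v (of_int D) + K.pair_val a d f"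
      using A.v_of_int(1)[OF D0] f K.pair_val_smult[where c = "of_int D", OF d f] D0
      by (simp add: A.v_mult const_rf_of_int Fract_eq_0_iff)
    then show ?thesis using A.v_of_int(2)[OF D0] K.v_of_int(2)[OF D0] by (simp add: wr_def)
  qed
  have X_transcendental: "poly (map_poly of_int F) X_rf \<noteq> 0" if "F \<noteq> 0" for F
    unfolding poly_X_rf using that by (simp add: Fract_eq_0_iff map_poly_eq_0_iff)
  from terminal_or_infinite
  show "\<exists>a d. a \<in> Op_br v \<and> admissible v a d \<and>
       (d \<noteq> \<infinity> \<longrightarrow> minimal_pair v a (real (the_enat d))) \<and>
       W = Zp_ring v a d \<and> Qp_unramified v a"
  proof (elim disjE exE conjE)
    fix m a assume m: "K.teich_sum m a" "terminal m a"
    then have st: "stage m a" by (simp add: terminal_def)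
    have "W = {phi. \<exists>f g. g \<noteq> 0 \<and> phi = Fract f g \<and> (f = 0 \<or> K.pair_val a m f \<ge> K.pair_val a m g)}"
    proof (rule W.W_eq_of_values, rule value_eq)
      fix F :: "int poly" assume F: "F \<noteq> 0"
      let ?f = "map_poly of_int F :: rat poly"
      define b where "b i = coeff (pcompose (map_poly of_int F) [:a, 1:]) i" for i
      have tb: "taylor_coeff a ?f i = b i" for i
        by (simp add: taylor_coeff_def K.map_poly_of_rat_of_int b_def)
      have f0: "?f \<noteq> 0" using F by (simp add: map_poly_eq_0_iff)
      define \<mu> where "\<mu> = mono_val v a (real m) ?f"
      have "\<mu> \<in> K.taylor_vals a (real m) ?f"
        unfolding \<mu>_def K.mono_val_taylor_vals
        by (rule Min_in[OF K.finite_taylor_vals K.taylor_vals_nonempty[OF f0]])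
      then obtain i0 where i0: "b i0 \<noteq> 0" "\<mu> = v (b i0) + real i0 * real m"
        unfolding K.taylor_vals_def tb by blast
      have le: "\<mu> \<le> v (b i) + real i * real m" if "b i \<noteq> 0" for i
        unfolding \<mu>_def K.mono_val_taylor_vals using that
        by (intro Min_le[OF K.finite_taylor_vals]) (auto simp: K.taylor_vals_def tb)
      \<comment> \<open>The minimum \<mu> thereby becomes a natural number, as needed to divide by
        p^\<mu> in \<open>terminal_case\<close>.\<close>
      have "v (b i0) \<in> \<int>" "v (b i0) \<ge> 0"
        using taylor_coeff_stage[OF st b_def, of i0] i0(1) by (auto simp: K.vge_def)
      then obtain j where "v (b i0) = real j"
        by (metis Ints_cases nonneg_int_cases of_int_0_le_iff of_int_of_nat_eq)
      then have \<mu>: "\<mu> = real (j + i0 * m)" using i0 by simp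
      have "wr (poly (map_poly of_int F) X_rf) = real (j + i0 * m)"
      proof (rule conjunct2[OF terminal_case[OF m(2) b_def]])
        show "b i \<in> K.vge (real (j + i0 * m) - real i * real m)" for i
          using le[of i] unfolding \<mu> K.vge_def by (cases "b i = 0") simp_all
        show "b i0 \<noteq> 0" "v (b i0) = real (j + i0 * m) - real i0 * real m" using i0 \<mu> by auto
      qed
      then show "wr (poly (map_poly of_int F) X_rf) = K.pair_val a m ?f"
        using \<mu> by (simp add: K.pair_val_def \<mu>_def)
    qed auto
    then have W: "W = Zp_ring v a (enat m)" by (subst K.Zp_ring_eq) auto
    have min: "minimal_pair v a (real (the_enat (enat m)))"
      using K.minimal_pair_teich_sum[OF m(1)] by (simp only: the_enat.simps)
    have a: "a \<in> Op_br v" "Qp_unramified v a"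
      using K.Qp_unramifiedI[OF stage_integral[OF st] v_poly_stage[OF st]] by blast+
    have "admissible v a (enat m)" using K.Qp_alg_teich_sum[OF m(1)] by (simp add: admissible_def)
    with W min a show ?thesis by blast
  next
    fix s assume s: "\<forall>m. stage m (s m) \<and> s (Suc m) - s m \<in> K.vge (real m)"
    have close: "s (j + k) - s j \<in> K.vge (real j)" for j k
    proof (induction k)
      case (Suc k)
      have "s (Suc (j + k)) - s (j + k) \<in> K.vge (real j)"
        by (rule K.vge_mono[OF conjunct2[OF spec[OF s, of "j + k"]]]) simp
      from K.vge_trans[OF this Suc] show ?case by simp
    qed simp
    have "\<exists>a. \<forall>N. \<exists>M. \<forall>n\<ge>M. s n - a \<in> K.vgt N"
    proof (rule K.cauchy_converges)
      fix N
      obtain j where j: "N < real j" using reals_Archimedean2 by blast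
      have "s k - s l \<in> K.vgt N" if kl: "k \<ge> j" "l \<ge> j" for k l
      proof -
        have "s k - s j \<in> K.vge (real j)" "s l - s j \<in> K.vge (real j)"
          using close[of j "k - j"] close[of j "l - j"] kl by simp_all
        then have "s k - s l \<in> K.vge (real j)" using K.vge_trans K.vge_minus_commute by blast
        then show ?thesis using j by (rule K.vge_imp_vgt)
      qed
      then show "\<exists>M. \<forall>k\<ge>M. \<forall>l\<ge>M. s k - s l \<in> K.vgt N" by blast
    qed
    then obtain a where a: "\<And>N. \<exists>M. \<forall>n\<ge>M. s n - a \<in> K.vgt N" by blast
    have lim: "s j - a \<in> K.vge (real j)" for j
    proof -
      obtain M where "\<And>n. n \<ge> M \<Longrightarrow> s n - a \<in> K.vgt (real j)" using a by blast
      then have "s (j + M) - a \<in> K.vge (real j)" by (intro K.vgt_imp_vge) simp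
      moreover have "s j - s (j + M) \<in> K.vge (real j)" using close K.vge_minus_commute by blast
      ultimately show ?thesis using K.vge_trans by blast
    qed
    have st: "stage j (s j)" for j using s by blast
    note inf = infinite_case[OF st lim]
    \<comment> \<open>An integer polynomial that vanishes at a would have to vanish at X, which is
      transcendental over the constants.\<close>
    have trans: "\<not> algebraic a"
    proof
      assume "algebraic a"
      then obtain F where "F \<noteq> 0" "poly (map_poly of_int F) a = 0" by (rule algebraicE')
      then show False using inf(3) X_transcendental by blast
    qed
    have "W = {phi. \<exists>f g. g \<noteq> 0 \<and> phi = Fract f g \<and> (f = 0 \<or> K.pair_val a \<infinity> f \<ge> K.pair_val a \<infinity> g)}"
    proof (rule W.W_eq_of_values, rule value_eq[OF trans])
      fix F :: "int poly" assume "F \<noteq> 0"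
      then show "wr (poly (map_poly of_int F) X_rf) = K.pair_val a \<infinity> (map_poly of_int F)"
        using inf(3) X_transcendental by (simp add: K.pair_val_def K.map_poly_of_rat_of_int)
    qed
    then have W: "W = Zp_ring v a \<infinity>" by (subst K.Zp_ring_eq) (auto simp: trans)
    have a: "a \<in> Op_br v" "Qp_unramified v a"
      using K.Qp_unramifiedI[OF inf(1,2)] by blast+
    have "admissible v a \<infinity>" using trans by (simp add: admissible_def)
    with W a show ?thesis by blast
  qed
qed

end
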